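(* Let $(M_\Gamma,\varepsilon)$ be a spin $\mathbb Z_2^k$-manifold of dimension $n$ (a compact flat orientable manifold $M_\Gamma=\Gamma\backslash\mathbb R^n$ with holonomy group $F\simeq\mathbb Z_2^k$ and spin structure $\varepsilon$), let $m=[n/2]$, let $\Lambda$ be the translation lattice of $\Gamma$, let $\rho:\Gamma\to \mathrm U(V)$ be a finite dimensional unitary representation with $\rho|_\Lambda=\mathrm{Id}$, and let $F_1=\{B\in F:n_B=1\}$. (i) If $F_1=\emptyset$, then the spectrum of $D_\rho$ is symmetric and the multiplicities of the eigenvalues $\pm2\pi\mu$, $\mu>0$, of $D_\rho$ are given by $$d^\pm_{\rho,\mu}(\Gamma,\varepsilon)=2^{m-k-1}\,d_\rho\,|\Lambda^*_{\varepsilon,\mu}|.\qquad( * )$$ (ii) If $F_1\neq\emptyset$, then the spectrum of $D_\rho$ is asymmetric if and only if the following conditions hold: $n=4r+3$ and there exists $\gamma=BL_b\in\Gamma$, with $n_B=1$ and $\chi_\rho(\gamma)\ne0$, such that $B|_\Lambda=-\delta_\varepsilon\,\mathrm{Id}$ (that is, there is a $\mathbb Z$-basis $f_1,\dots,f_n$ of $\Lambda$ with $Bf_j=-\delta_\varepsilon(f_j)f_j$ for $1\le j\le n$). In this case, the asymmetric spectrum is the set of eigenvalues $$\mathcal A=\{\pm2\pi\mu_j:\ \mu_j=(j+\tfrac12)\|f\|^{-1},\ j\in\mathbb N_0\},$$ where $\Lambda^B=\mathbb Zf$, and if we put $\sigma_\gamma:=\sigma((f\cdot2b)f,g_m)$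 we have $$d^\pm_{\rho,\mu}(\Gamma,\varepsilon)=\begin{cases}2^{m-k-1}\big(d_\rho|\Lambda^*_{\varepsilon,\mu}|\pm2\sigma_\gamma(-1)^{r+j}\chi_\rho(\gamma)\big)&\text{if }\mu=\mu_j,\\ 2^{m-k-1}d_\rho|\Lambda^*_{\varepsilon,\mu}|&\text{if }\mu\neq\mu_j.\end{cases}$$ If the spectrum of $D_\rho$ is symmetric, then $d^\pm_{\rho,\mu}(\Gamma,\varepsilon)$ is given by $( * )$. (iii) The number of independent harmonic spinors is $d_{\rho,0}(\Gamma,\varepsilon)=2^{m-k}d_\rho$ if $\varepsilon|_\Lambda=1$, and $0$ otherwise. If $k>m$ then $M_\Gamma$ has no spin structures of trivial type (i.e. with $\varepsilon|_\Lambda=1$), hence $M_\Gamma$ has no (nonzero) harmonic spinors. Furthermore, if $M_\Gamma$ has exactly $2^md_\rho$ independent harmonic spinors then $M_\Gamma$ is the torus $\Lambda\backslash\mathbb R^n$ and $\varepsilon=1$.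
   Context: Bieberbach groups. $L_b$ is translation by $b\in\mathbb R^n$, and $BL_b$ ($B\in\mathrm O(n)$) is the isometry $x\mapsto B(x+b)$. A Bieberbach group is a discrete, cocompact, torsion-free subgroup $\Gamma$ of the isometry group of $\mathbb R^n$. $\Lambda=\{\lambda:L_\lambda\in\Gamma\}$ is its translation lattice, $r(BL_b)=B$, and $F=r(\Gamma)\simeq\Lambda\backslash\Gamma$ is the (finite) holonomy group; it is assumed that $F\subset\mathrm{SO}(n)$. $n_B=\dim\ker(B-\mathrm{Id})$ and $\Lambda^B=\{\lambda\in\Lambda:B\lambda=\lambda\}$. Spin groups and representations. $Cl(n)$ is the Clifford algebra with $vw+wv=-2\langle v,w\rangle$, $\{e_i\}$ the canonical basis, $\mathrm{Spin}(n)=\{v_1\cdots v_l:\|v_j\|=1,\ l\text{ even}\}$, $\mu(g)(x)=gxg^{-1}$ the double cover $\mu:\mathrm{Spin}(n)\to\mathrm{SO}(n)$; $\mathrm{Spin}(n-1)\subset\mathrm{Spin}(n)$ is the subgroup fixing $e_n$. $(L,\mathrm S)$ is an irreducible complex representation of $Cl(n)\otimes\mathbb C$, of dimension $2^m$, restricted to $\mathrm{Spin}(n)$. For $n=2m+1$ odd, let $\mathrm S_{n-1}^\pm$ be the subspace of $\mathrm S$ on which $e_1\cdots e_{2m}$ acts by $\pm i^m$; the module is the one in which $L(e_n)$ acts by $\mp i$ on $\mathrm S_{n-1}^\pm$. Spin structures and Dirac operator. Spin structures on $M_\Gamma$ correspond to homomorphisms $\varepsilon:\Gamma\to\mathrm{Spin}(n)$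 with $\mu\circ\varepsilon=r$; $\delta_\varepsilon(\lambda)=\varepsilon(L_\lambda)\in\{\pm1\}$ for $\lambda\in\Lambda$. For $\mu\ge0$, $\Lambda^*_{\varepsilon,\mu}=\{u\in\mathbb R^n:\|u\|=\mu,\ \delta_\varepsilon(\lambda)=e^{2\pi i\,u\cdot\lambda}\ \forall\lambda\in\Lambda\}$. $\chi_\rho$, $d_\rho=\dim V$ are the character and dimension of $\rho$. $D_\rho$ acts on smooth $\psi:\mathbb R^n\to \mathrm S\otimes V$ satisfying $\psi(\gamma x)=(L(\varepsilon(\gamma))\otimes\rho(\gamma))\psi(x)$ for all $\gamma\in\Gamma$, by $D_\rho \psi=\sum_i(L(e_i)\otimes\mathrm{Id})\,\partial \psi/\partial x_i$. $d^\pm_{\rho,\mu}(\Gamma,\varepsilon)$ is the multiplicity (possibly $0$) of the eigenvalue $\pm2\pi\mu$ for $\mu>0$; $d_{\rho,0}(\Gamma,\varepsilon)=\dim\ker D_\rho$ (harmonic spinors are elements of $\ker D_\rho$). The spectrum is symmetric if $d^+_{\rho,\mu}=d^-_{\rho,\mu}$ for all $\mu>0$, asymmetric otherwise; its asymmetric part $\mathcal A$ is the set of $\pm2\pi\mu$, $\mu>0$, with $d^+_{\rho,\mu}\ne d^-_{\rho,\mu}$. The sign $\sigma$. Let $n=2m+1$ and $g_m=e_1e_2\cdots e_{2m}$. If $\gamma=BL_b\in\Gamma$ with $n_B=1$, then $\varepsilon(\gamma)$ is conjugate to $g_m$ in $\mathrm{Spin}(n)$. For $u\ne0$ with $Bu=u$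 choose $h_u\in\mathrm{Spin}(n)$ with $h_uuh_u^{-1}=\|u\|e_n$; put $\sigma(u,g_m)=1$ if $h_u\varepsilon(\gamma)h_u^{-1}$ is conjugate to $g_m$ in $\mathrm{Spin}(n-1)$ and $\sigma(u,g_m)=-1$ otherwise.
   Formalization: The formula with σ_γ is stated for those γ with |f·2b|=(4l+1)‖f‖², l≥0 (one with |f·2b|=‖f‖² is shown to exist); for other admissible γ it fails, since replacing γ by γL_f can flip σ_γ while d^± is unchanged. *)

theory Defs
  imports
    "HOL-Analysis.Analysis"
    "HOL-Algebra.Elementary_Groups"
    "HOL-Algebra.Product_Groups"
    "HOL-Library.Function_Algebras"
begin

section \<open>The Clifford algebra and the spin group\<close>

text \<open>
  The elements of \<open>Cl(n)\<close> are coefficient families over the basis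
  \<open>e\<^sub>A = e\<^sub>a\<^sub>1 \<cdots> e\<^sub>a\<^sub>p\<close>, where \<open>A = {a\<^sub>1 < \<dots> < a\<^sub>p}\<close> runs through the subsets of the
  linearly ordered index type, whose cardinality is \<open>n\<close>.  One has
  \<open>e\<^sub>A e\<^sub>B = \<plusminus> e\<^sub>C\<close> with \<open>C\<close> the symmetric difference of \<open>A\<close> and \<open>B\<close>.  The sign has one
  factor \<open>-1\<close> for each pair \<open>b < a\<close> (a transposition) and one for each pair
  \<open>b = a\<close> (from \<open>e\<^sub>a\<^sup>2 = -1\<close>).
\<close>

definition sym_difference :: "'a set \<Rightarrow> 'a set \<Rightarrow> 'a set" where
  "sym_difference A B = (A - B) \<union> (B - A)"

definition cl_sign :: "'n::{finite,linorder} set \<Rightarrow> 'n set \<Rightarrow> real" where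
  "cl_sign A B = (\<Prod>a\<in>A. \<Prod>b\<in>B. if b \<le> a then -1 else 1)"

typedef 'n clifford = "UNIV :: ('n set \<Rightarrow> real) set"
  morphisms cl_coeff Abs_clifford ..

setup_lifting type_definition_clifford

instantiation clifford :: ("{finite,linorder}") real_vector
begin

lift_definition zero_clifford :: "'a clifford" is "\<lambda>A. 0" .
lift_definition plus_clifford :: "'a clifford \<Rightarrow> 'a clifford \<Rightarrow> 'a clifford"
  is "\<lambda>x y A. x A + y A" .
lift_definition minus_clifford :: "'a clifford \<Rightarrow> 'a clifford \<Rightarrow> 'a clifford"
  is "\<lambda>x y A. x A - y A" .
lift_definition uminus_clifford :: "'a clifford \<Rightarrow> 'a clifford"
  is "\<lambda>x A. - x A" .
lift_definition scaleR_clifford :: "real \<Rightarrow> 'a clifford \<Rightarrow> 'a clifford"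
  is "\<lambda>c x A. c * x A" .

instance
  by standard (transfer; simp add: fun_eq_iff algebra_simps)+

end

lemma sym_difference_assoc:
  "sym_difference (sym_difference A B) C = sym_difference A (sym_difference B C)"
  by (auto simp: sym_difference_def)

lemma cl_sign_expand:
  "cl_sign A B = (\<Prod>a\<in>UNIV. if a \<in> A then (\<Prod>b\<in>UNIV. if b \<in> B then if b \<le> a then -1 else 1 else 1) else 1)"
  by (simp add: cl_sign_def prod.If_cases)

lemma cl_sign_sym_difference_left:
  "cl_sign (sym_difference A B) C = cl_sign A C * cl_sign B C"
proof -
  define p :: "'a \<Rightarrow> real" where "p a = (\<Prod>b\<in>C. if b \<le> a then -1 else 1)" for a
  have p2: "p a * p a = 1" for a
    by (simp add: p_def flip: prod.distrib) (simp add: if_distrib cong: if_cong)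
  have e: "cl_sign A C = (\<Prod>a\<in>UNIV. if a \<in> A then p a else 1)" for A
    by (simp add: cl_sign_def p_def prod.If_cases)
  show ?thesis
    unfolding e prod.distrib[symmetric]
    by (rule prod.cong) (auto simp: sym_difference_def p2)
qed

lemma cl_sign_sym_difference_right:
  "cl_sign A (sym_difference B C) = cl_sign A B * cl_sign A C"
proof -
  have e: "cl_sign A C = (\<Prod>a\<in>A. \<Prod>b\<in>UNIV. if b \<in> C then if b \<le> a then -1 else 1 else 1)" for C
    by (simp add: cl_sign_def prod.If_cases)
  show ?thesis
    unfolding e prod.distrib[symmetric]
    by (intro prod.cong refl) (auto simp: sym_difference_def)
qed

instantiation clifford :: ("{finite,linorder}") real_algebra_1
begin

lift_definition one_clifford :: "'a clifford" is "\<lambda>A. if A = {} then 1 else 0" .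

lift_definition times_clifford :: "'a clifford \<Rightarrow> 'a clifford \<Rightarrow> 'a clifford"
  is "\<lambda>x y C. \<Sum>A\<in>UNIV. \<Sum>B\<in>UNIV.
        if sym_difference A B = C then cl_sign A B * x A * y B else 0" .

instance
proof
  fix a b c :: "'a clifford" and r :: real
  show "a * b * c = a * (b * c)"
  proof (transfer, rule ext)
    fix x y z :: "'a set \<Rightarrow> real" and D
    let ?t = "\<lambda>A B E. if sym_difference (sym_difference A B) E = D
       then cl_sign A B * cl_sign A E * cl_sign B E * x A * y B * z E else 0"
    have "(\<Sum>C\<in>UNIV. \<Sum>E\<in>UNIV. if sym_difference C E = D then cl_sign C E *
        (\<Sum>A\<in>UNIV. \<Sum>B\<in>UNIV. if sym_difference A B = C then cl_sign A B * x A * y B else 0) * z E else 0)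
      = (\<Sum>C\<in>UNIV. \<Sum>E\<in>UNIV. \<Sum>A\<in>UNIV. \<Sum>B\<in>UNIV. if sym_difference A B = C then ?t A B E else 0)"
    proof (intro sum.cong refl)
      fix C E
      show "(if sym_difference C E = D then cl_sign C E *
          (\<Sum>A\<in>UNIV. \<Sum>B\<in>UNIV. if sym_difference A B = C then cl_sign A B * x A * y B else 0) * z E else 0)
        = (\<Sum>A\<in>UNIV. \<Sum>B\<in>UNIV. if sym_difference A B = C then ?t A B E else 0)"
      proof (cases "sym_difference C E = D")
        case True
        then show ?thesis
          by (auto simp: sum_distrib_left sum_distrib_right cl_sign_sym_difference_left mult_ac
            intro!: sum.cong)
      next
        case False
        then have "(if sym_difference A B = C then ?t A B E else 0) = 0" for A B
          by auto
        then show ?thesis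
          using False by (simp only: sum.neutral_const if_False)
      qed
    qed
    also have "\<dots> = (\<Sum>E\<in>UNIV. \<Sum>C\<in>UNIV. \<Sum>A\<in>UNIV. \<Sum>B\<in>UNIV. if sym_difference A B = C then ?t A B E else 0)"
      by (rule sum.swap)
    also have "\<dots> = (\<Sum>E\<in>UNIV. \<Sum>A\<in>UNIV. \<Sum>C\<in>UNIV. \<Sum>B\<in>UNIV. if sym_difference A B = C then ?t A B E else 0)"
      by (intro sum.cong refl sum.swap)
    also have "\<dots> = (\<Sum>E\<in>UNIV. \<Sum>A\<in>UNIV. \<Sum>B\<in>UNIV. \<Sum>C\<in>UNIV. if sym_difference A B = C then ?t A B E else 0)"
      by (intro sum.cong refl sum.swap)
    also have "\<dots> = (\<Sum>E\<in>UNIV. \<Sum>A\<in>UNIV. \<Sum>B\<in>UNIV. ?t A B E)"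
      by (intro sum.cong refl) (simp add: sum.delta')
    also have "\<dots> = (\<Sum>A\<in>UNIV. \<Sum>E\<in>UNIV. \<Sum>B\<in>UNIV. ?t A B E)"
      by (rule sum.swap)
    finally have L: "(\<Sum>C\<in>UNIV. \<Sum>E\<in>UNIV. if sym_difference C E = D then cl_sign C E *
        (\<Sum>A\<in>UNIV. \<Sum>B\<in>UNIV. if sym_difference A B = C then cl_sign A B * x A * y B else 0) * z E else 0)
      = (\<Sum>A\<in>UNIV. \<Sum>E\<in>UNIV. \<Sum>B\<in>UNIV. ?t A B E)" .
    have "(\<Sum>A\<in>UNIV. \<Sum>C\<in>UNIV. if sym_difference A C = D then cl_sign A C * x A *
        (\<Sum>B\<in>UNIV. \<Sum>E\<in>UNIV. if sym_difference B E = C then cl_sign B E * y B * z E else 0) else 0)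
      = (\<Sum>A\<in>UNIV. \<Sum>C\<in>UNIV. \<Sum>B\<in>UNIV. \<Sum>E\<in>UNIV. if sym_difference B E = C then ?t A B E else 0)"
    proof (intro sum.cong refl)
      fix A C
      show "(if sym_difference A C = D then cl_sign A C * x A *
          (\<Sum>B\<in>UNIV. \<Sum>E\<in>UNIV. if sym_difference B E = C then cl_sign B E * y B * z E else 0) else 0)
        = (\<Sum>B\<in>UNIV. \<Sum>E\<in>UNIV. if sym_difference B E = C then ?t A B E else 0)"
      proof (cases "sym_difference A C = D")
        case True
        then show ?thesis
          by (auto simp: sum_distrib_left cl_sign_sym_difference_right sym_difference_assoc mult_ac
            intro!: sum.cong)
      next
        case False
        then have "(if sym_difference B E = C then ?t A B E else 0) = 0" for B E
          by (auto simp: sym_difference_assoc)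
        then show ?thesis
          using False by (simp only: sum.neutral_const if_False)
      qed
    qed
    also have "\<dots> = (\<Sum>A\<in>UNIV. \<Sum>B\<in>UNIV. \<Sum>C\<in>UNIV. \<Sum>E\<in>UNIV. if sym_difference B E = C then ?t A B E else 0)"
      by (intro sum.cong refl sum.swap)
    also have "\<dots> = (\<Sum>A\<in>UNIV. \<Sum>B\<in>UNIV. \<Sum>E\<in>UNIV. \<Sum>C\<in>UNIV. if sym_difference B E = C then ?t A B E else 0)"
      by (intro sum.cong refl sum.swap)
    also have "\<dots> = (\<Sum>A\<in>UNIV. \<Sum>B\<in>UNIV. \<Sum>E\<in>UNIV. ?t A B E)"
      by (intro sum.cong refl) (simp add: sum.delta')
    also have "\<dots> = (\<Sum>A\<in>UNIV. \<Sum>E\<in>UNIV. \<Sum>B\<in>UNIV. ?t A B E)"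
      by (intro sum.cong refl sum.swap)
    finally show "(\<Sum>C\<in>UNIV. \<Sum>E\<in>UNIV. if sym_difference C E = D then cl_sign C E *
        (\<Sum>A\<in>UNIV. \<Sum>B\<in>UNIV. if sym_difference A B = C then cl_sign A B * x A * y B else 0) * z E else 0)
      = (\<Sum>A\<in>UNIV. \<Sum>C\<in>UNIV. if sym_difference A C = D then cl_sign A C * x A *
        (\<Sum>B\<in>UNIV. \<Sum>E\<in>UNIV. if sym_difference B E = C then cl_sign B E * y B * z E else 0) else 0)"
      using L by simp
  qed
  show "1 * a = a"
  proof (transfer, rule ext)
    fix x :: "'a set \<Rightarrow> real" and C
    have "(\<Sum>A\<in>UNIV. \<Sum>B\<in>UNIV. if sym_difference A B = C then cl_sign A B * (if A = {} then 1 else 0) * x B else 0)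
      = (\<Sum>A::'a set\<in>UNIV. \<Sum>B\<in>UNIV. if B = C then if A = {} then x C else 0 else 0)"
      by (intro sum.cong refl) (simp add: sym_difference_def cl_sign_def)
    also have "\<dots> = x C"
      by (simp only: sum.delta finite UNIV_I if_True)
    finally show "(\<Sum>A\<in>UNIV. \<Sum>B\<in>UNIV. if sym_difference A B = C then cl_sign A B * (if A = {} then 1 else 0) * x B else 0) = x C" .
  qed
  show "a * 1 = a"
  proof (transfer, rule ext)
    fix x :: "'a set \<Rightarrow> real" and C
    have "(\<Sum>A\<in>UNIV. \<Sum>B\<in>UNIV. if sym_difference A B = C then cl_sign A B * x A * (if B = {} then 1 else 0) else 0)
      = (\<Sum>A\<in>UNIV. \<Sum>B::'a set\<in>UNIV. if B = {} then if A = C then x C else 0 else 0)"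
      by (intro sum.cong refl) (simp add: sym_difference_def cl_sign_def)
    also have "\<dots> = x C"
      by (simp only: sum.delta finite UNIV_I if_True)
    finally show "(\<Sum>A\<in>UNIV. \<Sum>B\<in>UNIV. if sym_difference A B = C then cl_sign A B * x A * (if B = {} then 1 else 0) else 0) = x C" .
  qed
  show "(a + b) * c = a * c + b * c"
    by transfer (auto simp: fun_eq_iff algebra_simps simp flip: sum.distrib intro!: sum.cong)
  show "a * (b + c) = a * b + a * c"
    by transfer (auto simp: fun_eq_iff algebra_simps simp flip: sum.distrib intro!: sum.cong)
  show "(0::'a clifford) \<noteq> 1"
    by transfer (auto simp: fun_eq_iff)
  show "r *\<^sub>R a * b = r *\<^sub>R (a * b)"
    by transfer (auto simp: fun_eq_iff sum_distrib_left algebra_simps intro!: sum.cong)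
  show "a * r *\<^sub>R b = r *\<^sub>R (a * b)"
    by transfer (auto simp: fun_eq_iff sum_distrib_left algebra_simps intro!: sum.cong)
qed

end

lift_definition cl_gen :: "'n::{finite,linorder} \<Rightarrow> 'n clifford"
  is "\<lambda>i A. if A = {i} then 1 else 0" .

type_synonym 'n euc = "(real, 'n) vec"
type_synonym 'n emap = "'n euc \<Rightarrow> 'n euc"
type_synonym 'n emat = "((real, 'n) vec, 'n) vec"

definition cl_vec :: "'n::{finite,linorder} euc \<Rightarrow> 'n clifford" where
  "cl_vec v = (\<Sum>i\<in>UNIV. v $ i *\<^sub>R cl_gen i)"

lemma cl_gen_mult:
  "cl_gen i * cl_gen j = Abs_clifford (\<lambda>C. if sym_difference {i} {j} = C then if j \<le> i then -1 else 1 else 0)"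
proof (transfer, rule ext)
  fix i j :: "'a::{finite,linorder}" and C
  have "(\<Sum>A\<in>UNIV. \<Sum>B\<in>UNIV. if sym_difference A B = C
         then cl_sign A B * (if A = {i} then 1 else 0) * (if B = {j} then 1 else 0) else 0)
    = (\<Sum>A\<in>UNIV. \<Sum>B\<in>UNIV. if B = {j} then if A = {i}
         then (if sym_difference {i} {j} = C then cl_sign {i} {j} else 0) else 0 else (0::real))"
    by (intro sum.cong refl) simp
  also have "\<dots> = (if sym_difference {i} {j} = C then cl_sign {i} {j} else 0)"
    by (simp only: sum.delta finite UNIV_I if_True)
  finally show "(\<Sum>A\<in>UNIV. \<Sum>B\<in>UNIV. if sym_difference A B = C
         then cl_sign A B * (if A = {i} then 1 else 0) * (if B = {j} then 1 else 0) else 0)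
    = (if sym_difference {i} {j} = C then if j \<le> i then -1 else 1 else (0::real))"
    by (simp add: cl_sign_def)
qed

lemma cl_gen_anticommute:
  "cl_gen i * cl_gen j + cl_gen j * cl_gen i = (if i = j then -2 else 0)"
proof -
  have "cl_gen i * cl_gen i = - 1"
    unfolding cl_gen_mult
    by (transfer) (auto simp: fun_eq_iff sym_difference_def Abs_clifford_inverse)
  moreover have "cl_gen i * cl_gen j + cl_gen j * cl_gen i = 0" if "i \<noteq> j"
    unfolding cl_gen_mult using that
    by (transfer) (auto simp: fun_eq_iff sym_difference_def Abs_clifford_inverse)
  ultimately show ?thesis
    by auto
qed

lemma cl_vec_relation:
  "cl_vec v * cl_vec w + cl_vec w * cl_vec v = of_real (- 2 * (v \<bullet> w))"
proof -
  have a: "cl_vec v * cl_vec w = (\<Sum>i\<in>UNIV. \<Sum>j\<in>UNIV. (v $ i * w $ j) *\<^sub>R (cl_gen i * cl_gen j))"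
    unfolding cl_vec_def sum_product by (intro sum.cong refl) (simp add: mult.commute)
  have "cl_vec w * cl_vec v = (\<Sum>i\<in>UNIV. \<Sum>j\<in>UNIV. (v $ i * w $ j) *\<^sub>R (cl_gen j * cl_gen i))"
    unfolding cl_vec_def sum_product
    by (subst sum.swap, intro sum.cong refl) (simp add: mult.commute)
  with a have "cl_vec v * cl_vec w + cl_vec w * cl_vec v =
    (\<Sum>i\<in>UNIV. \<Sum>j\<in>UNIV. (v $ i * w $ j) *\<^sub>R (cl_gen i * cl_gen j + cl_gen j * cl_gen i))"
    by (simp add: scaleR_add_right sum.distrib)
  also have "\<dots> = (\<Sum>i\<in>UNIV. \<Sum>j\<in>UNIV. if j = i then (v $ i * w $ j) *\<^sub>R (-2) else 0)"
    unfolding cl_gen_anticommute by (intro sum.cong refl) auto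
  also have "\<dots> = (\<Sum>i\<in>UNIV. of_real (- 2 * (v $ i * w $ i)))"
  proof -
    have "c *\<^sub>R (- 2) = (of_real (- 2 * c) :: 'a clifford)" for c
      unfolding mult.commute[of "- 2" c] by (simp add: scaleR_conv_of_real)
    then show ?thesis
      by (simp only: sum.delta finite UNIV_I if_True)
  qed
  also have "\<dots> = of_real (- 2 * (v \<bullet> w))"
    by (simp only: inner_vec_def inner_real_def sum_distrib_left of_real_sum)
  finally show ?thesis .
qed

text \<open>The canonical basis \<open>e\<^sub>1, \<dots>, e\<^sub>n\<close>, numbered from \<open>1\<close> in the order of the index type.\<close>

definition e_vec :: "nat \<Rightarrow> 'n::{finite,linorder} euc" where
  "e_vec j = axis (sorted_list_of_set UNIV ! (j - 1)) 1"

definition Spin :: "'n::{finite,linorder} clifford set" where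
  "Spin = {prod_list (map cl_vec vs) | vs. (\<forall>v\<in>set vs. norm v = 1) \<and> even (length vs)}"

definition spin_group :: "'n::{finite,linorder} clifford monoid" where
  "spin_group = \<lparr>carrier = Spin, monoid.mult = (*), one = 1\<rparr>"

definition spin_cover :: "'n::{finite,linorder} clifford \<Rightarrow> 'n euc \<Rightarrow> 'n euc" where
  "spin_cover g x = (THE y. cl_vec y = g * cl_vec x * inv\<^bsub>spin_group\<^esub> g)"

definition Spin_sub :: "'n::{finite,linorder} clifford set" where
  "Spin_sub = {g \<in> Spin. spin_cover g (e_vec CARD('n)) = e_vec CARD('n)}"

definition g_elt :: "'n::{finite,linorder} clifford" where
  "g_elt = prod_list (map (\<lambda>j. cl_vec (e_vec j)) [1..<2 * (CARD('n) div 2) + 1])"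

text \<open>
  A complex representation of \<open>Cl(n) \<otimes> \<complex>\<close> is the same as a homomorphism of real unital
  algebras from \<open>Cl(n)\<close> to complex matrices.  The last clause fixes which of the two
  irreducible modules is taken in odd dimension.
\<close>

definition spinor_module :: "('n::{finite,linorder} clifford \<Rightarrow> complex^'s^'s) \<Rightarrow> bool" where
  "spinor_module L \<longleftrightarrow>
     linear L \<and> L 1 = mat 1 \<and> (\<forall>x y. L (x * y) = L x ** L y) \<and>
     (\<forall>W. vec.subspace W \<and> (\<forall>x. \<forall>w\<in>W. L x *v w \<in> W) \<longrightarrow> W = {0} \<or> W = UNIV) \<and>
     CARD('s) = 2 ^ (CARD('n) div 2) \<and>
     (odd CARD('n) \<longrightarrow> (\<forall>w.
       (L g_elt *v w = (\<i> ^ (CARD('n) div 2)) *s w \<longrightarrow>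
          L (cl_vec (e_vec CARD('n))) *v w = (- \<i>) *s w) \<and>
       (L g_elt *v w = (- (\<i> ^ (CARD('n) div 2))) *s w \<longrightarrow>
          L (cl_vec (e_vec CARD('n))) *v w = \<i> *s w)))"


section \<open>Bieberbach groups\<close>

definition BL :: "'n::finite emat \<Rightarrow> 'n euc \<Rightarrow> 'n emap" where
  "BL B b = (\<lambda>x. B *v (x + b))"

abbreviation transl :: "'n::finite euc \<Rightarrow> 'n emap" where
  "transl b \<equiv> BL (mat 1) b"

definition isometry_group :: "'n::finite emap monoid" where
  "isometry_group = \<lparr>carrier = {BL B b | B b. orthogonal_matrix B}, monoid.mult = (\<circ>), one = id\<rparr>"

definition orbit :: "'n::finite emap set \<Rightarrow> 'n euc \<Rightarrow> ('n euc) set" where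
  "orbit \<Gamma> x = {\<gamma> x | \<gamma>. \<gamma> \<in> \<Gamma>}"

definition orbit_space :: "'n::finite emap set \<Rightarrow> ('n euc) set topology" where
  "orbit_space \<Gamma> = topology (\<lambda>U. U \<subseteq> range (orbit \<Gamma>) \<and> open (orbit \<Gamma> -` U))"

lemma openin_orbit_space:
  "openin (orbit_space \<Gamma>) U \<longleftrightarrow> U \<subseteq> range (orbit \<Gamma>) \<and> open (orbit \<Gamma> -` U)"
proof -
  have "istopology (\<lambda>U. U \<subseteq> range (orbit \<Gamma>) \<and> open (orbit \<Gamma> -` U))"
    unfolding istopology_def
  proof (intro conjI allI impI; (elim conjE)?)
    fix \<K> assume "\<forall>K\<in>\<K>. K \<subseteq> range (orbit \<Gamma>) \<and> open (orbit \<Gamma> -` K)"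
    then show "\<Union>\<K> \<subseteq> range (orbit \<Gamma>)" "open (orbit \<Gamma> -` \<Union>\<K>)"
      by (auto simp: vimage_Union)
  qed (auto simp: vimage_Int)
  then show ?thesis
    by (simp add: orbit_space_def)
qed

text \<open>Discreteness refers to the topology of \<open>O(n) \<times> \<real>\<^sup>n\<close> on the group of isometries.\<close>

definition bieberbach_group :: "'n::finite emap set \<Rightarrow> bool" where
  "bieberbach_group \<Gamma> \<longleftrightarrow>
     subgroup \<Gamma> isometry_group \<and>
     discrete {(B, b). orthogonal_matrix B \<and> BL B b \<in> \<Gamma>} \<and>
     compact_space (orbit_space \<Gamma>) \<and>
     (\<forall>\<gamma>\<in>\<Gamma>. \<forall>j>0. \<gamma> ^^ j = id \<longrightarrow> \<gamma> = id)"

definition lattice_of :: "'n::finite emap set \<Rightarrow> ('n euc) set" where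
  "lattice_of \<Gamma> = {v. transl v \<in> \<Gamma>}"

definition rot :: "'n::finite emap \<Rightarrow> 'n emat" where
  "rot \<gamma> = (THE B. orthogonal_matrix B \<and> (\<exists>b. \<gamma> = BL B b))"

definition holonomy_group :: "'n::finite emap set \<Rightarrow> ('n emat) monoid" where
  "holonomy_group \<Gamma> = \<lparr>carrier = rot ` \<Gamma>, monoid.mult = (**), one = mat 1\<rparr>"

definition fixdim :: "'n::finite emat \<Rightarrow> nat" where
  "fixdim B = dim {x. (B - mat 1) *v x = 0}"

text \<open>An indexed family of \<open>n\<close> vectors through which every element of \<open>\<Lambda>\<close> has unique integer coordinates.\<close>

definition Z_basis :: "('n::finite \<Rightarrow> 'n euc) \<Rightarrow> ('n euc) set \<Rightarrow> bool" where
  "Z_basis f \<Lambda> \<longleftrightarrow> bij_betw (\<lambda>c. \<Sum>i\<in>UNIV. real_of_int (c i) *\<^sub>R f i) UNIV \<Lambda>"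


section \<open>Spin structures and twisting representations\<close>

definition spin_structure ::
  "'n emap set \<Rightarrow> ('n emap \<Rightarrow> 'n::{finite,linorder} clifford) \<Rightarrow> bool" where
  "spin_structure \<Gamma> \<epsilon> \<longleftrightarrow>
     \<epsilon> \<in> hom (isometry_group\<lparr>carrier := \<Gamma>\<rparr>) spin_group \<and>
     (\<forall>\<gamma>\<in>\<Gamma>. spin_cover (\<epsilon> \<gamma>) = (*v) (rot \<gamma>))"

definition spin_trivial ::
  "'n emap set \<Rightarrow> ('n emap \<Rightarrow> 'n::{finite,linorder} clifford) \<Rightarrow> bool" where
  "spin_trivial \<Gamma> \<epsilon> \<longleftrightarrow> (\<forall>v\<in>lattice_of \<Gamma>. \<epsilon> (transl v) = 1)"

definition delta ::
  "('n emap \<Rightarrow> 'n::{finite,linorder} clifford) \<Rightarrow> 'n euc \<Rightarrow> real" where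
  "delta \<epsilon> v = (THE c. \<epsilon> (transl v) = of_real c)"

definition dual_shell ::
  "'n emap set \<Rightarrow> ('n emap \<Rightarrow> 'n::{finite,linorder} clifford)
     \<Rightarrow> real \<Rightarrow> ('n euc) set" where
  "dual_shell \<Gamma> \<epsilon> \<mu> =
     {u. norm u = \<mu> \<and>
         (\<forall>v\<in>lattice_of \<Gamma>. complex_of_real (delta \<epsilon> v) = exp (2 * pi * \<i> * of_real (u \<bullet> v)))}"

definition unitary_group :: "(complex^'v^'v) monoid" where
  "unitary_group =
     \<lparr>carrier = {U. (\<chi> i j. cnj (U $ j $ i)) ** U = mat 1}, monoid.mult = (**), one = mat 1\<rparr>"

definition twisting_rep ::
  "'n::finite emap set \<Rightarrow> ('n emap \<Rightarrow> complex^'v^'v) \<Rightarrow> bool" where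
  "twisting_rep \<Gamma> \<rho> \<longleftrightarrow>
     \<rho> \<in> hom (isometry_group\<lparr>carrier := \<Gamma>\<rparr>) unitary_group \<and>
     (\<forall>v\<in>lattice_of \<Gamma>. \<rho> (transl v) = mat 1)"

text \<open>
  The sign \<open>\<sigma>(u, g\<^sub>m)\<close> attached to \<open>g = \<epsilon>(\<gamma>)\<close>.  It depends on \<open>g\<close>, which the
  customary notation suppresses.
\<close>

definition spin_sigma :: "'n::{finite,linorder} clifford \<Rightarrow> 'n euc \<Rightarrow> real" where
  "spin_sigma g u =
     (let h = (SOME h. h \<in> Spin \<and> spin_cover h u = norm u *\<^sub>R e_vec CARD('n))
      in if \<exists>t\<in>Spin_sub. h * g * inv\<^bsub>spin_group\<^esub> h = t * g_elt * inv\<^bsub>spin_group\<^esub> t then 1 else -1)"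


section \<open>The twisted Dirac operator\<close>

text \<open>\<open>\<complex>\<^sup>s \<otimes> \<complex>\<^sup>v\<close> is the space of vectors indexed by pairs.\<close>

definition kron :: "complex^'s^'s \<Rightarrow> complex^'v^'v \<Rightarrow> complex^('s \<times> 'v)^('s \<times> 'v)" where
  "kron A B = (\<chi> p q. A $ fst p $ fst q * B $ snd p $ snd q)"

primrec Ck :: "nat \<Rightarrow> ('a::euclidean_space \<Rightarrow> 'b::real_normed_vector) \<Rightarrow> bool" where
  "Ck 0 f \<longleftrightarrow> continuous_on UNIV f"
| "Ck (Suc k) f \<longleftrightarrow>
     (\<forall>x. f differentiable at x) \<and> (\<forall>i\<in>Basis. Ck k (\<lambda>x. frechet_derivative f (at x) i))"

definition smooth :: "('a::euclidean_space \<Rightarrow> 'b::real_normed_vector) \<Rightarrow> bool" where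
  "smooth f \<longleftrightarrow> (\<forall>k. Ck k f)"

definition dirac ::
  "('n::{finite,linorder} clifford \<Rightarrow> complex^'s^'s)
     \<Rightarrow> ('n euc \<Rightarrow> complex^('s \<times> 'v::finite)) \<Rightarrow> 'n euc \<Rightarrow> complex^('s \<times> 'v)" where
  "dirac L \<psi> x =
     (\<Sum>i\<in>UNIV. kron (L (cl_vec (axis i 1))) (mat 1) *v frechet_derivative \<psi> (at x) (axis i 1))"

definition spinor_fields ::
  "('n::{finite,linorder} clifford \<Rightarrow> complex^'s^'s) \<Rightarrow> 'n emap set
     \<Rightarrow> ('n emap \<Rightarrow> 'n clifford) \<Rightarrow> ('n emap \<Rightarrow> complex^'v^'v)
     \<Rightarrow> ('n euc \<Rightarrow> complex^('s \<times> 'v)) set" where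
  "spinor_fields L \<Gamma> \<epsilon> \<rho> =
     {\<psi>. smooth \<psi> \<and> (\<forall>\<gamma>\<in>\<Gamma>. \<forall>x. \<psi> (\<gamma> x) = kron (L (\<epsilon> \<gamma>)) (\<rho> \<gamma>) *v \<psi> x)}"

definition eigenspace ::
  "('n::{finite,linorder} clifford \<Rightarrow> complex^'s^'s) \<Rightarrow> 'n emap set
     \<Rightarrow> ('n emap \<Rightarrow> 'n clifford) \<Rightarrow> ('n emap \<Rightarrow> complex^'v^'v)
     \<Rightarrow> real \<Rightarrow> ('n euc \<Rightarrow> complex^('s \<times> 'v)) set" where
  "eigenspace L \<Gamma> \<epsilon> \<rho> t =
     {\<psi> \<in> spinor_fields L \<Gamma> \<epsilon> \<rho>. \<forall>x. dirac L \<psi> x = complex_of_real t *s \<psi> x}"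

definition field_scale :: "complex \<Rightarrow> ('a \<Rightarrow> complex^'d) \<Rightarrow> 'a \<Rightarrow> complex^'d" where
  "field_scale c \<psi> = (\<lambda>x. c *s \<psi> x)"

global_interpretation field: vector_space field_scale
  by standard (auto simp: field_scale_def fun_eq_iff vec_eq_iff algebra_simps)

definition dirac_mult ::
  "('n::{finite,linorder} clifford \<Rightarrow> complex^'s^'s) \<Rightarrow> 'n emap set
     \<Rightarrow> ('n emap \<Rightarrow> 'n clifford) \<Rightarrow> ('n emap \<Rightarrow> complex^'v^'v)
     \<Rightarrow> real \<Rightarrow> nat" where
  "dirac_mult L \<Gamma> \<epsilon> \<rho> t = field.dim (eigenspace L \<Gamma> \<epsilon> \<rho> t)"

text \<open>
  As \<open>field.dim\<close> is \<open>0\<close> on infinite-dimensional spaces, a value of \<open>dirac_mult\<close> is to be read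
  together with the following condition.
\<close>

definition finite_mult ::
  "('n::{finite,linorder} clifford \<Rightarrow> complex^'s^'s) \<Rightarrow> 'n emap set
     \<Rightarrow> ('n emap \<Rightarrow> 'n clifford) \<Rightarrow> ('n emap \<Rightarrow> complex^'v^'v)
     \<Rightarrow> real \<Rightarrow> bool" where
  "finite_mult L \<Gamma> \<epsilon> \<rho> t \<longleftrightarrow> (\<exists>B. finite B \<and> eigenspace L \<Gamma> \<epsilon> \<rho> t \<subseteq> field.span B)"

definition symmetric_spectrum ::
  "('n::{finite,linorder} clifford \<Rightarrow> complex^'s^'s) \<Rightarrow> 'n emap set
     \<Rightarrow> ('n emap \<Rightarrow> 'n clifford) \<Rightarrow> ('n emap \<Rightarrow> complex^'v^'v) \<Rightarrow> bool" where
  "symmetric_spectrum L \<Gamma> \<epsilon> \<rho> \<longleftrightarrow>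
     (\<forall>\<mu>>0. dirac_mult L \<Gamma> \<epsilon> \<rho> (2 * pi * \<mu>) = dirac_mult L \<Gamma> \<epsilon> \<rho> (- (2 * pi * \<mu>)))"

definition asymmetric_part ::
  "('n::{finite,linorder} clifford \<Rightarrow> complex^'s^'s) \<Rightarrow> 'n emap set
     \<Rightarrow> ('n emap \<Rightarrow> 'n clifford) \<Rightarrow> ('n emap \<Rightarrow> complex^'v^'v)
     \<Rightarrow> real set" where
  "asymmetric_part L \<Gamma> \<epsilon> \<rho> =
     {s * (2 * pi * \<mu>) | s \<mu>. s \<in> {1, -1} \<and> \<mu> > 0 \<and>
        dirac_mult L \<Gamma> \<epsilon> \<rho> (2 * pi * \<mu>) \<noteq> dirac_mult L \<Gamma> \<epsilon> \<rho> (- (2 * pi * \<mu>))}"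

text \<open>
  The condition on \<open>\<gamma> = BL\<^sub>b\<close>: \<open>n\<^sub>B = 1\<close>, \<open>\<chi>\<^sub>\<rho>(\<gamma>) \<noteq> 0\<close> and \<open>B|\<^sub>\<Lambda> = -\<delta>\<^sub>\<epsilon> Id\<close>, the last one in the
  sense of a lattice basis.

  The coset of \<open>\<gamma>\<close> modulo translations does not determine \<open>\<sigma>((f \<cdot> 2b) f, g\<^sub>m)\<close>, where
  \<open>\<int>f\<close> is the sublattice fixed by \<open>B\<close>: replacing \<open>\<gamma>\<close> by \<open>\<gamma> L\<^sub>f\<close> changes \<open>b\<close> to \<open>b + f\<close> and
  \<open>\<epsilon>(\<gamma>)\<close> to \<open>-\<epsilon>(\<gamma>)\<close>.  The number \<open>c = f \<cdot> 2b / \<parallel>f\<parallel>\<^sup>2\<close> is an odd integer, and the sign is the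
  same for all representatives with \<open>\<bar>c\<bar>\<close> congruent to \<open>1\<close> modulo \<open>4\<close> and the opposite one
  otherwise.  Representatives with \<open>\<bar>c\<bar> = 1\<close> always exist.
\<close>

definition asymmetry_witness ::
  "'n emap set \<Rightarrow> ('n emap \<Rightarrow> 'n::{finite,linorder} clifford)
     \<Rightarrow> ('n emap \<Rightarrow> complex^'v^'v) \<Rightarrow> 'n emat \<Rightarrow> 'n euc \<Rightarrow> bool" where
  "asymmetry_witness \<Gamma> \<epsilon> \<rho> B b \<longleftrightarrow>
     BL B b \<in> \<Gamma> \<and> fixdim B = 1 \<and> trace (\<rho> (BL B b)) \<noteq> 0 \<and>
     (\<exists>f. Z_basis f (lattice_of \<Gamma>) \<and> (\<forall>j. B *v f j = - delta \<epsilon> (f j) *\<^sub>R f j))"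

end

theory Submission
  imports Defs
begin

text \<open>
  A field satisfying the equivariance condition is quasi-periodic under \<open>\<Lambda>\<close>, so it has a Fourier
  expansion over the \<open>u\<close> with \<open>\<delta>\<^sub>\<epsilon>(\<lambda>) = exp(2\<pi>i u \<cdot> \<lambda>)\<close> on \<open>\<Lambda>\<close>, and for an eigenfield only \<open>\<parallel>u\<parallel> = \<mu>\<close> occurs.
  Averaging over the holonomy group then expresses each multiplicity as a sum of traces over the
  elements \<open>B\<close> of \<open>F\<close> and the frequencies \<open>u\<close> fixed by \<open>B\<close>.  The identity contributes the generic
  term.  As \<open>B\<^sup>2 = 1\<close>, any other \<open>B\<close> with \<open>n\<^sub>B \<noteq> 1\<close> contributes nothing: some vector anticommutes with
  the Clifford element under the trace.  If \<open>n\<^sub>B = 1\<close> and \<open>w\<close> is a fixed unit vector, then \<open>\<epsilon>(\<gamma>) w\<close> is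
  central and odd, hence plus or minus the volume element, with \<open>\<sigma>\<close> as the sign.  The frequencies
  \<open>\<plusminus>\<mu>w\<close> then contribute a multiple of \<open>sin(2\<pi>\<mu> w \<cdot> b)\<close>, and evaluating \<open>\<delta>\<^sub>\<epsilon>\<close> on \<open>\<gamma>\<^sup>2\<close>, a translation
  by a multiple of \<open>w\<close>, decides when this is nonzero.  That happens for at most one \<open>B\<close>.
\<close>

section \<open>The Clifford algebra\<close>

text \<open>Two arbitrary choices have to cancel. The lift of a holonomy element \<open>B\<close> to
  \<Gamma> is determined only up to a lattice translation \<open>v\<close>, which changes both
  \<epsilon> and the phase of every admissible frequency by the sign
  \<open>delta \<epsilon> v\<close>; the traces below carry both factors and so depend on
  \<open>B\<close> alone. The sign of a fixed unit vector \<open>w\<close> is free as well, and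
  \<sigma> and the sine both flip with it. Hence \<sigma> alone is no invariant of \<open>B\<close>,
  and its closed form needs the residue modulo 4 of the integer \<open>c\<close> for which
  \<gamma>^2 is the translation by \<open>c f\<close>. No Hilbert space enters. The averaged plane
  waves form a finite spanning family of an eigenspace, redundant because frequencies in one orbit
  of the holonomy group have dependent averages; the dimension is read off as the trace of the
  identity in this family, without selecting a basis. Asymmetry is possible at all because in odd
  dimension the volume element acts on the chosen module by a nonzero scalar and so has nonzero
  trace.\<close>

lemma cl_eqI: "(\<And>A. cl_coeff x A = cl_coeff y A) \<Longrightarrow> x = y"
  by (simp add: cl_coeff_inject[symmetric] fun_eq_iff)

lemma cl_coeff_simps [simp]:
  "cl_coeff (x + y) A = cl_coeff x A + cl_coeff y A"
  "cl_coeff (c *\<^sub>R x) A = c * cl_coeff x A"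
  "cl_coeff 0 A = 0"
  "cl_coeff (- x) A = - cl_coeff x A"
  "cl_coeff 1 A = (if A = {} then 1 else 0)"
  "cl_coeff (cl_gen i) A = (if A = {i} then 1 else 0)"
  by (transfer; simp)+

lemma cl_coeff_sum: "cl_coeff (\<Sum>i\<in>I. f i) A = (\<Sum>i\<in>I. cl_coeff (f i) A)"
  by (induction I rule: infinite_finite_induct) auto

lemma cl_coeff_of_real: "cl_coeff (of_real r) A = (if A = {} then r else 0)"
  by (simp add: of_real_def)

lemma sym_difference_eq_iff: "sym_difference A B = C \<longleftrightarrow> B = sym_difference A C"
  by (auto simp: sym_difference_def)

lemma sym_difference_commute: "sym_difference A B = sym_difference B A"
  by (auto simp: sym_difference_def)

lemma sym_difference_twice [simp]: "sym_difference A (sym_difference A B) = B"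
  by (auto simp: sym_difference_def)

lemma cl_coeff_gen_mult:
  "cl_coeff (cl_gen i * x) C = cl_sign {i} (sym_difference {i} C) * cl_coeff x (sym_difference {i} C)"
proof (transfer)
  fix i and x :: "'a set \<Rightarrow> real" and C
  have "(\<Sum>A\<in>UNIV. \<Sum>B\<in>UNIV. if sym_difference A B = C
         then cl_sign A B * (if A = {i} then 1 else 0) * x B else 0)
    = (\<Sum>A\<in>UNIV. \<Sum>B\<in>UNIV. if B = sym_difference {i} C then if A = {i}
         then cl_sign {i} (sym_difference {i} C) * x (sym_difference {i} C) else 0 else 0)"
    by (intro sum.cong refl) (auto simp: sym_difference_eq_iff[of "{i}"])
  then show "(\<Sum>A\<in>UNIV. \<Sum>B\<in>UNIV. if sym_difference A B = C
         then cl_sign A B * (if A = {i} then 1 else 0) * x B else 0)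
    = cl_sign {i} (sym_difference {i} C) * x (sym_difference {i} C)"
    by (simp only: sum.delta finite UNIV_I if_True)
qed

lemma cl_coeff_mult_gen:
  "cl_coeff (x * cl_gen i) C = cl_sign (sym_difference {i} C) {i} * cl_coeff x (sym_difference {i} C)"
proof (transfer)
  fix i and x :: "'a set \<Rightarrow> real" and C
  have "(\<Sum>A\<in>UNIV. \<Sum>B\<in>UNIV. if sym_difference A B = C
         then cl_sign A B * x A * (if B = {i} then 1 else 0) else 0)
    = (\<Sum>A\<in>UNIV. \<Sum>B\<in>UNIV. if B = {i} then if A = sym_difference {i} C
         then cl_sign (sym_difference {i} C) {i} * x (sym_difference {i} C) else 0 else 0)"
    by (intro sum.cong refl)
      (auto simp: sym_difference_commute[of _ "{i}"] sym_difference_eq_iff[of "{i}"])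
  then show "(\<Sum>A\<in>UNIV. \<Sum>B\<in>UNIV. if sym_difference A B = C
         then cl_sign A B * x A * (if B = {i} then 1 else 0) else 0)
    = cl_sign (sym_difference {i} C) {i} * x (sym_difference {i} C)"
    by (simp only: sum.delta finite UNIV_I if_True)
qed

text \<open>Both factors are \<plusminus>1, so this is the sign picked up when \<open>e_i\<close>
  moves past \<open>e_A\<close>: one transposition for each member of \<open>A\<close> other than
  \<open>i\<close>.\<close>

lemma cl_sign_gen_product:
  "cl_sign {i} A * cl_sign A {i} = (-1) ^ card A * (if i \<in> A then -1 else 1)"
proof -
  have "cl_sign {i} A * cl_sign A {i} = (\<Prod>a\<in>A. if a = i then 1 else -1)"
    unfolding cl_sign_def by (simp add: prod.distrib[symmetric], intro prod.cong) auto
  also have "\<dots> = (\<Prod>a\<in>A. -1 * (if a = i then -1 else 1))"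
    by (intro prod.cong) auto
  also have "\<dots> = (-1) ^ card A * (\<Prod>a\<in>A. if a = i then -1 else 1)"
    by (subst prod.distrib) simp
  also have "(\<Prod>a\<in>A. if a = i then -1 else 1) = (if i \<in> A then -1 else (1::real))"
    by (simp add: prod.delta)
  finally show ?thesis .
qed

lemma cl_sign_pm: "cl_sign A B = 1 \<or> cl_sign A B = -1"
proof -
  have "\<bar>cl_sign A B\<bar> = 1"
    unfolding cl_sign_def abs_prod by (intro prod.neutral ballI) auto
  then show ?thesis by linarith
qed

text \<open>Comparing coefficients at the symmetric difference of \<open>{i}\<close> and
  \<open>A\<close> shows that \<open>e_i\<close> and \<open>e_A\<close> commute for every
  \<open>i\<close>. An index inside \<open>A\<close> then makes the size of \<open>A\<close> odd and
  an index outside makes it even, so \<open>A\<close> is not both nonempty and proper.\<close>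

lemma central_support:
  fixes x :: "'n::{finite,linorder} clifford"
  assumes "\<And>i. cl_gen i * x = x * cl_gen i" and nz: "cl_coeff x A \<noteq> 0"
  shows "A = {} \<or> (A = UNIV \<and> odd CARD('n))"
proof -
  have *: "(-1) ^ card A * (if i \<in> A then -1 else 1) = (1::real)" for i
  proof -
    have "cl_sign {i} A * cl_coeff x A = cl_sign A {i} * cl_coeff x A"
      using arg_cong[OF assms(1)[of i], of "\<lambda>y. cl_coeff y (sym_difference {i} A)"]
      by (simp add: cl_coeff_gen_mult cl_coeff_mult_gen)
    with nz have "cl_sign {i} A = cl_sign A {i}" by simp
    then show ?thesis
      using cl_sign_gen_product[of i A] cl_sign_pm[of A "{i}"] by auto
  qed
  show ?thesis
  proof (rule ccontr)
    assume c: "\<not> ?thesis"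
    then obtain i where i: "i \<in> A" by auto
    from *[of i] i have o: "odd (card A)" by (cases "even (card A)") auto
    then have "A \<noteq> UNIV" using c by auto
    then obtain j where "j \<notin> A" by auto
    with *[of j] o show False by simp
  qed
qed

section \<open>Vectors in the Clifford algebra and the parity grading\<close>

lemma cl_vec_simps:
  "cl_vec (v + w) = cl_vec v + cl_vec w" "cl_vec (c *\<^sub>R v) = c *\<^sub>R cl_vec v"
  "cl_vec (- v) = - cl_vec v" "cl_vec (v - w) = cl_vec v - cl_vec w"
proof -
  show 1: "cl_vec (v + w) = cl_vec v + cl_vec w" for v w :: "'a euc"
    by (simp add: cl_vec_def scaleR_add_left sum.distrib)
  show 2: "cl_vec (c *\<^sub>R v) = c *\<^sub>R cl_vec v" for c and v :: "'a euc"
    by (simp add: cl_vec_def scaleR_sum_right)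
  show 3: "cl_vec (- v) = - cl_vec v" for v :: "'a euc"
    using 2[of "-1" v] by simp
  show "cl_vec (v - w) = cl_vec v - cl_vec w"
    using 1[of v "-w"] 3[of w] by simp
qed

lemma cl_vec_axis [simp]: "cl_vec (axis i 1) = cl_gen i"
proof -
  have "cl_vec (axis i 1) = (\<Sum>j\<in>UNIV. if j = i then cl_gen j else 0)"
    unfolding cl_vec_def by (intro sum.cong) (auto simp: axis_def)
  then show ?thesis by simp
qed

lemma cl_coeff_vec: "cl_coeff (cl_vec v) {i} = v $ i"
proof -
  have "cl_coeff (cl_vec v) {i} = (\<Sum>j\<in>UNIV. if j = i then v $ j else 0)"
    unfolding cl_vec_def cl_coeff_sum by (intro sum.cong) auto
  then show ?thesis by simp
qed

lemma cl_vec_inj: "cl_vec v = cl_vec w \<Longrightarrow> v = w"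
  by (metis cl_coeff_vec vec_eq_iff)

lemma cl_vec_square: "cl_vec v * cl_vec v = of_real (- (v \<bullet> v))"
proof -
  have "2 *\<^sub>R (cl_vec v * cl_vec v) = 2 *\<^sub>R of_real (- (v \<bullet> v))"
    using cl_vec_relation[of v v] by (simp add: scaleR_2 of_real_def)
  then show ?thesis by (simp only: scaleR_cancel_left) simp
qed

lemma cl_vec_unit_square: "norm v = 1 \<Longrightarrow> cl_vec v * cl_vec v = - 1"
  by (simp add: cl_vec_square norm_eq_1)

lemma cl_vec_orthogonal: "v \<bullet> w = 0 \<Longrightarrow> cl_vec v * cl_vec w = - (cl_vec w * cl_vec v)"
  using cl_vec_relation[of v w] by (simp add: add_eq_0_iff)

lemma commutes_cl_vec:
  assumes "\<And>i. cl_gen i * x = x * cl_gen i"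
  shows "cl_vec v * x = x * cl_vec v"
  by (simp add: cl_vec_def sum_distrib_left sum_distrib_right assms)

text \<open>\<open>True\<close> stands for the even part. Zero has both parities, so nonvanishing is
  argued separately in \<open>spin_fixed_line\<close>.\<close>

definition cl_parity :: "bool \<Rightarrow> 'n::{finite,linorder} clifford \<Rightarrow> bool" where
  "cl_parity p x \<longleftrightarrow> (\<forall>A. cl_coeff x A \<noteq> 0 \<longrightarrow> even (card A) = p)"

lemma cl_parity_vec_mult:
  assumes "cl_parity p x" shows "cl_parity (\<not> p) (cl_vec v * x)"
  unfolding cl_parity_def
proof (intro allI impI)
  fix C assume "cl_coeff (cl_vec v * x) C \<noteq> 0"
  then have "(\<Sum>i\<in>UNIV. v $ i * cl_coeff (cl_gen i * x) C) \<noteq> 0"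
    by (simp add: cl_vec_def sum_distrib_right cl_coeff_sum)
  then obtain i where "cl_coeff (cl_gen i * x) C \<noteq> 0"
    by (metis (no_types, lifting) mult_zero_right sum.neutral)
  then have "cl_coeff x (sym_difference {i} C) \<noteq> 0"
    by (auto simp: cl_coeff_gen_mult)
  then have "even (card (sym_difference {i} C)) = p"
    using assms by (simp add: cl_parity_def)
  moreover have "even (card (sym_difference {i} C)) = (\<not> even (card C))"
  proof (cases "i \<in> C")
    case True
    then have "sym_difference {i} C = C - {i}" "card C = Suc (card (C - {i}))"
      using card.remove[of C i] True by (auto simp: sym_difference_def)
    then show ?thesis by simp
  next
    case False
    then have "sym_difference {i} C = insert i C" by (auto simp: sym_difference_def)
    then show ?thesis using False by simp
  qed
  ultimately show "even (card C) = (\<not> p)" by auto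
qed

lemma cl_parity_prod_list:
  "cl_parity p x \<Longrightarrow> cl_parity (p = even (length vs)) (prod_list (map cl_vec vs) * x)"
proof (induction vs)
  case (Cons v vs)
  then have "cl_parity (\<not> (p = even (length vs))) (cl_vec v * (prod_list (map cl_vec vs) * x))"
    by (intro cl_parity_vec_mult) auto
  moreover have "(\<not> (p = even (length vs))) = (p = even (length (v # vs)))" by auto
  ultimately show ?case by (simp add: mult.assoc)
qed simp

text \<open>In odd dimension the centre also contains the multiples of \<open>e_UNIV\<close>; these
  have odd degree, so parity removes them.\<close>

lemma even_central_scalar:
  assumes "cl_parity True x" "\<And>i. cl_gen i * x = x * cl_gen i"
  shows "x = of_real (cl_coeff x {})"
proof (rule cl_eqI)
  fix A
  show "cl_coeff x A = cl_coeff (of_real (cl_coeff x {})) A"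
    using central_support[OF assms(2), of A] assms(1)
    by (auto simp: cl_coeff_of_real cl_parity_def)
qed

section \<open>The spin group\<close>

lemma Spin_even: assumes "g \<in> Spin" shows "cl_parity True g"
proof -
  obtain vs where vs: "g = prod_list (map cl_vec vs)" "even (length vs)"
    using assms unfolding Spin_def by blast
  have "cl_parity True (1 :: 'a clifford)" by (simp add: cl_parity_def)
  from cl_parity_prod_list[OF this, of vs] show ?thesis using vs by simp
qed

lemma Spin_one: "1 \<in> Spin"
  unfolding Spin_def by (rule CollectI, rule exI[of _ "[]"]) simp

lemma Spin_mult: assumes "g \<in> Spin" "h \<in> Spin" shows "g * h \<in> Spin"
proof -
  from assms obtain vs ws where "g = prod_list (map cl_vec vs)" "h = prod_list (map cl_vec ws)"
    "\<forall>v\<in>set vs. norm v = 1" "even (length vs)" "\<forall>v\<in>set ws. norm v = 1" "even (length ws)"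
    unfolding Spin_def by blast
  then show ?thesis
    unfolding Spin_def by (intro CollectI exI[of _ "vs @ ws"]) auto
qed

lemma prod_list_unit_inverse:
  assumes "\<forall>v\<in>set vs. norm v = 1"
  shows "prod_list (map cl_vec vs) * prod_list (map cl_vec (rev (map uminus vs))) = 1"
    and "prod_list (map cl_vec (rev (map uminus vs))) * prod_list (map cl_vec vs) = 1"
proof (atomize (full), use assms in \<open>induction vs\<close>)
  case (Cons v vs)
  let ?P = "prod_list (map cl_vec vs)" and ?Q = "prod_list (map cl_vec (rev (map uminus vs)))"
  have v: "cl_vec v * cl_vec v = -1" using Cons.prems by (simp add: cl_vec_unit_square)
  have "cl_vec v * ?P * (?Q * cl_vec (- v)) = cl_vec v * (?P * ?Q) * cl_vec (- v)"
    by (simp add: mult.assoc)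
  also have "\<dots> = 1" using Cons v by (simp add: cl_vec_simps)
  finally have 1: "prod_list (map cl_vec (v # vs)) * prod_list (map cl_vec (rev (map uminus (v # vs)))) = 1"
    by simp
  have "?Q * cl_vec (- v) * (cl_vec v * ?P) = ?Q * (cl_vec (- v) * cl_vec v) * ?P"
    by (simp add: mult.assoc)
  also have "\<dots> = 1" using Cons v by (simp add: cl_vec_simps)
  finally show ?case using 1 by simp
qed auto

lemma group_spin_group: "group (spin_group :: 'n::{finite,linorder} clifford monoid)"
proof (rule groupI)
  fix g :: "'n clifford" assume "g \<in> carrier spin_group"
  then obtain vs where vs: "g = prod_list (map cl_vec vs)" "\<forall>v\<in>set vs. norm v = 1" "even (length vs)"
    unfolding spin_group_def Spin_def by auto
  let ?h = "prod_list (map cl_vec (rev (map uminus vs)))"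
  have "?h \<in> Spin"
    unfolding Spin_def using vs by (intro CollectI exI[of _ "rev (map uminus vs)"]) auto
  then show "\<exists>y\<in>carrier spin_group. y \<otimes>\<^bsub>spin_group\<^esub> g = \<one>\<^bsub>spin_group\<^esub>"
    using prod_list_unit_inverse(2)[OF vs(2)] vs(1) by (auto simp: spin_group_def)
qed (auto simp: spin_group_def Spin_mult Spin_one mult.assoc)

abbreviation spin_inv :: "'n::{finite,linorder} clifford \<Rightarrow> 'n clifford" where
  "spin_inv \<equiv> m_inv spin_group"

lemma spin_inv:
  assumes "g \<in> Spin"
  shows "spin_inv g \<in> Spin" "g * spin_inv g = 1" "spin_inv g * g = 1"
  using group.inv_closed[OF group_spin_group, of g] group.r_inv[OF group_spin_group, of g]
    group.l_inv[OF group_spin_group, of g] assms by (auto simp: spin_group_def)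

text \<open>Conjugation by a unit vector is the negative of the reflection: it fixes the line and
  negates its complement. The intertwining form avoids inverting a single vector, which is odd and
  lies outside \<open>Spin\<close>.\<close>

lemma unit_vec_conjugation:
  assumes "norm v = 1"
  shows "cl_vec ((2 * (v \<bullet> x)) *\<^sub>R v - x) * cl_vec v = cl_vec v * cl_vec x"
proof -
  have "cl_vec ((2 * (v \<bullet> x)) *\<^sub>R v - x) * cl_vec v
     = (2 * (v \<bullet> x)) *\<^sub>R (cl_vec v * cl_vec v) - cl_vec x * cl_vec v"
    by (simp add: cl_vec_simps algebra_simps)
  also have "\<dots> = of_real (- 2 * (v \<bullet> x)) - cl_vec x * cl_vec v"
    by (simp add: cl_vec_unit_square[OF assms] of_real_def)
  also have "\<dots> = cl_vec v * cl_vec x"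
    using cl_vec_relation[of v x] by (simp add: algebra_simps)
  finally show ?thesis .
qed

lemma spin_cover_eqI:
  assumes "g \<in> Spin" "cl_vec y * g = g * cl_vec x"
  shows "spin_cover g x = y"
proof -
  have "cl_vec y = cl_vec y * (g * spin_inv g)" by (simp add: spin_inv[OF assms(1)])
  also have "\<dots> = g * cl_vec x * spin_inv g" by (simp add: assms(2) flip: mult.assoc)
  finally show ?thesis
    unfolding spin_cover_def by (metis (mono_tags, lifting) cl_vec_inj the_equality)
qed

text \<open>Composing the conjugations by the factors shows that the definite description in
  \<open>spin_cover\<close> denotes. The induction admits lists of any length because the tail of an
  even list is odd.\<close>

lemma spin_cover_mult:
  assumes "g \<in> Spin"
  shows "cl_vec (spin_cover g x) * g = g * cl_vec x"
proof -
  have "\<exists>y. cl_vec y * prod_list (map cl_vec vs) = prod_list (map cl_vec vs) * cl_vec x"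
    if "\<forall>v\<in>set vs. norm v = 1" for vs
    using that
  proof (induction vs)
    case (Cons v vs)
    then obtain y where "cl_vec y * prod_list (map cl_vec vs) = prod_list (map cl_vec vs) * cl_vec x"
      by auto
    then have "cl_vec ((2 * (v \<bullet> y)) *\<^sub>R v - y) * (cl_vec v * prod_list (map cl_vec vs))
       = cl_vec v * prod_list (map cl_vec vs) * cl_vec x"
      using unit_vec_conjugation[of v y] Cons.prems by (simp flip: mult.assoc) (simp add: mult.assoc)
    then show ?case by auto
  qed auto
  then obtain y where "cl_vec y * g = g * cl_vec x"
    using assms unfolding Spin_def by blast
  then show ?thesis using spin_cover_eqI[OF assms] by simp
qed

section \<open>The spinor module\<close>

locale spinor_rep =
  fixes L :: "'n::{finite,linorder} clifford \<Rightarrow> complex^'s^'s"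
  assumes module: "spinor_module L"
begin

lemma L_linear: "linear L" and L_one: "L 1 = mat 1" and L_mult: "L (x * y) = L x ** L y"
  and card_s: "CARD('s) = 2 ^ (CARD('n) div 2)"
  using module unfolding spinor_module_def by auto

lemma L_simps: "L (x + y) = L x + L y" "L (- x) = - L x" "L (c *\<^sub>R x) = c *\<^sub>R L x" "L 0 = 0"
  by (simp_all add: linear_add[OF L_linear] linear_neg[OF L_linear] linear_scale[OF L_linear]
      linear_0[OF L_linear])

lemma L_of_real: "L (of_real r) = mat (of_real r)"
  by (simp add: of_real_def L_simps L_one vec_eq_iff mat_def)

lemma det_scalar: "det (mat c :: complex^'s^'s) = c ^ CARD('s)"
  by (subst det_diagonal) (auto simp: mat_def)

text \<open>The absolute value of \<open>det \<circ> L\<close> takes the place of the spinor norm: it is \<open>1\<close> on products of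
  unit vectors, so the only scalars among these are \<open>\<plusminus>1\<close>.\<close>

lemma norm_det_unit_vec:
  assumes "norm v = 1" shows "norm (det (L (cl_vec v))) = 1"
proof -
  have "(det (L (cl_vec v)))\<^sup>2 = det (L (cl_vec v * cl_vec v))"
    by (simp add: L_mult det_mul power2_eq_square)
  also have "\<dots> = det (L (of_real (- 1)))" using cl_vec_unit_square[OF assms] by simp
  also have "\<dots> = (- 1) ^ CARD('s)"
    unfolding L_of_real det_scalar by simp
  finally have "norm ((det (L (cl_vec v)))\<^sup>2) = 1" by (simp add: norm_power)
  then show ?thesis by (simp add: norm_power power2_eq_1_iff) (metis norm_ge_zero neg_0_le_iff_le not_one_le_zero)
qed

lemma norm_det_prod_list:
  "\<forall>v\<in>set vs. norm v = 1 \<Longrightarrow> norm (det (L (prod_list (map cl_vec vs)))) = 1"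
  by (induction vs) (auto simp: L_one L_mult det_mul norm_mult norm_det_unit_vec)

lemma norm_det_Spin: "g \<in> Spin \<Longrightarrow> norm (det (L g)) = 1"
  unfolding Spin_def using norm_det_prod_list by blast

lemma norm_det_scalar:
  assumes "norm (det (L (of_real r))) = 1" shows "r = 1 \<or> r = -1"
proof -
  have "\<bar>r\<bar> ^ CARD('s) = 1"
    using assms unfolding L_of_real det_scalar by (simp add: norm_power)
  then have "\<bar>r\<bar> = 1"
    using power_eq_imp_eq_base[of "\<bar>r\<bar>" "CARD('s)" 1] by simp
  then show ?thesis by linarith
qed

text \<open>Such an element is even and central, hence real, and the modulus of the determinant
  leaves only the signs. This is the kernel of the double cover.\<close>

lemma Spin_scalar:
  fixes g :: "'n clifford"
  assumes "g \<in> Spin" "\<And>i. cl_gen i * g = g * cl_gen i"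
  shows "g = 1 \<or> g = - 1"
proof -
  have g: "g = of_real (cl_coeff g {})"
    by (rule even_central_scalar) (use assms Spin_even in auto)
  then have "norm (det (L (of_real (cl_coeff g {})))) = 1"
    using norm_det_Spin[OF assms(1)] by simp
  then have "cl_coeff g {} = 1 \<or> cl_coeff g {} = -1" by (rule norm_det_scalar)
  then show ?thesis using g by (metis of_real_1 of_real_minus)
qed

lemma trace_uminus: "trace (- A :: complex^'a^'a) = - trace A"
  by (simp add: trace_def sum_negf)

text \<open>The hypotheses give \<open>x = v x v\<close>, and cyclicity of the trace moves the outer
  \<open>v\<close> to the other side, where \<open>v v = -1\<close> produces a sign.\<close>

lemma trace_anticommute_zero:
  assumes "norm v = 1" "cl_vec v * x = - (x * cl_vec v)"
  shows "trace (L x) = 0"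
proof -
  note v = cl_vec_unit_square[OF assms(1)]
  have x: "x * cl_vec v * cl_vec v = - x" by (simp add: mult.assoc v)
  then have "x = cl_vec v * (x * cl_vec v)" by (simp add: assms(2) flip: mult.assoc)
  then have "trace (L x) = trace (L (cl_vec v) ** L (x * cl_vec v))" by (simp flip: L_mult)
  also have "\<dots> = trace (L (x * cl_vec v) ** L (cl_vec v))" by (rule trace_mul_sym)
  also have "\<dots> = trace (L (- x))" by (simp flip: L_mult add: x)
  also have "\<dots> = - trace (L x)" by (simp add: L_simps trace_uminus)
  finally show ?thesis by simp
qed

end

section \<open>The volume element and the sign of a spin element with one-dimensional fixed space\<close>

lemma cl_gen_square: "cl_gen i * cl_gen i = - 1"
  using cl_vec_unit_square[of "axis i 1"] by simp

lemma cl_gen_swap: "i \<noteq> j \<Longrightarrow> cl_gen i * cl_gen j = - (cl_gen j * cl_gen i)"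
  using cl_gen_anticommute[of i j] by (simp add: add_eq_0_iff)

lemma gen_prod_commute:
  "distinct js \<Longrightarrow> cl_gen i * prod_list (map cl_gen js) =
     ((-1) ^ length js * (if i \<in> set js then -1 else 1)) *\<^sub>R (prod_list (map cl_gen js) * cl_gen i)"
proof (induction js)
  case (Cons j js)
  let ?P = "prod_list (map cl_gen js)"
  have IH: "cl_gen i * ?P = ((-1) ^ length js * (if i \<in> set js then -1 else 1)) *\<^sub>R (?P * cl_gen i)"
    using Cons by simp
  show ?case
  proof (cases "i = j")
    case True
    then have "i \<notin> set js" using Cons.prems by auto
    then have "cl_gen i * (cl_gen i * ?P) = cl_gen i * ((-1) ^ length js *\<^sub>R (?P * cl_gen i))"
      using IH by simp
    then show ?thesis by (simp add: True mult.assoc)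
  next
    case False
    have "cl_gen i * (cl_gen j * ?P) = - (cl_gen j * (cl_gen i * ?P))"
      using cl_gen_swap[OF False] by (simp flip: mult.assoc)
    then show ?thesis using IH False by (simp add: mult.assoc)
  qed
qed simp

text \<open>The exponent counts \<open>l (l - 1) / 2\<close> transpositions and \<open>l\<close>
  squares equal to -1.\<close>

lemma gen_prod_square:
  "distinct js \<Longrightarrow> prod_list (map cl_gen js) * prod_list (map cl_gen js) =
     of_real ((-1) ^ (length js * (length js + 1) div 2))"
proof (induction js)
  case (Cons j js)
  let ?P = "prod_list (map cl_gen js)" and ?l = "length js"
  have IH: "?P * ?P = of_real ((-1) ^ (?l * (?l + 1) div 2))" using Cons by simp
  have "cl_gen j * ?P = (-1) ^ ?l *\<^sub>R (?P * cl_gen j)"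
    using gen_prod_commute[of js j] Cons.prems by simp
  then have "(-1) ^ ?l *\<^sub>R (cl_gen j * ?P) = ?P * cl_gen j"
    by (simp flip: power_add mult_2)
  then have "cl_gen j * ?P * (cl_gen j * ?P) = cl_gen j * ((-1) ^ ?l *\<^sub>R (cl_gen j * ?P)) * ?P"
    by (simp add: mult.assoc)
  also have "\<dots> = (-1) ^ ?l *\<^sub>R (cl_gen j * cl_gen j * (?P * ?P))"
    by (simp add: mult.assoc)
  also have "\<dots> = of_real ((-1) ^ Suc ?l * (-1) ^ (?l * (?l + 1) div 2))"
    unfolding IH cl_gen_square by (simp add: of_real_def)
  also have "(-1) ^ Suc ?l * (-1) ^ (?l * (?l + 1) div 2) = ((-1)::real) ^ (Suc ?l + ?l * (?l + 1) div 2)"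
    by (simp add: power_add)
  also have "Suc ?l + ?l * (?l + 1) div 2 = length (j # js) * (length (j # js) + 1) div 2"
  proof -
    have "length (j # js) * (length (j # js) + 1) = 2 * Suc ?l + ?l * (?l + 1)" by simp
    then show ?thesis by (metis div_mult_self4 mult.commute zero_neq_numeral)
  qed
  finally show ?case by simp
qed simp

definition cl_volume :: "'n::{finite,linorder} clifford" where
  "cl_volume = prod_list (map cl_gen (sorted_list_of_set UNIV))"

lemma cl_volume_square:
  "(cl_volume :: 'n clifford) * cl_volume = of_real ((-1) ^ (CARD('n::{finite,linorder}) * (CARD('n) + 1) div 2))"
  using gen_prod_square[of "sorted_list_of_set (UNIV :: 'n set)"] by (simp add: cl_volume_def)

lemma cl_volume_central:
  "odd CARD('n) \<Longrightarrow> cl_gen i * (cl_volume :: 'n::{finite,linorder} clifford) = cl_volume * cl_gen i"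
  using gen_prod_commute[of "sorted_list_of_set (UNIV :: 'n set)" i] by (simp add: cl_volume_def)

lemma cl_volume_as_vecs:
  "(cl_volume :: 'n::{finite,linorder} clifford) =
     prod_list (map cl_vec (map (\<lambda>i. axis i 1) (sorted_list_of_set UNIV)))"
  by (simp add: cl_volume_def comp_def)

lemma Spin_commutes_volume:
  fixes h :: "'n::{finite,linorder} clifford"
  assumes "h \<in> Spin" "odd CARD('n)"
  shows "h * cl_volume = cl_volume * h"
proof -
  obtain vs where vs: "h = prod_list (map cl_vec vs)" using assms(1) unfolding Spin_def by blast
  have "prod_list (map cl_vec vs) * cl_volume = cl_volume * prod_list (map cl_vec vs)" for vs :: "'n euc list"
  proof (induction vs)
    case (Cons v vs)
    then have "prod_list (map cl_vec (v # vs)) * cl_volume = cl_vec v * cl_volume * prod_list (map cl_vec vs)"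
      by (simp add: mult.assoc)
    then show ?case
      using commutes_cl_vec[of cl_volume v, OF cl_volume_central[OF assms(2)]] by (simp add: mult.assoc)
  qed simp
  then show ?thesis by (simp add: vs)
qed

lemma g_elt_gens:
  "(g_elt :: 'n::{finite,linorder} clifford) =
     prod_list (map cl_gen (take (2 * (CARD('n) div 2)) (sorted_list_of_set UNIV)))"
proof -
  let ?l = "sorted_list_of_set (UNIV :: 'n set)" and ?k = "2 * (CARD('n) div 2)"
  have "map (\<lambda>j. cl_vec (e_vec j :: 'n euc)) [1..<?k + 1] = map cl_gen (take ?k ?l)"
    by (rule nth_equalityI) (auto simp: e_vec_def nth_append simp del: upt_Suc)
  then show ?thesis by (simp add: g_elt_def)
qed

lemma g_elt_square:
  "(g_elt :: 'n::{finite,linorder} clifford) * g_elt = of_real ((-1) ^ (CARD('n) div 2))"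
proof -
  let ?m = "CARD('n) div 2"
  have "length (take (2 * ?m) (sorted_list_of_set (UNIV :: 'n set))) = 2 * ?m" by simp
  then have "(g_elt :: 'n clifford) * g_elt = of_real ((-1) ^ (2 * ?m * (2 * ?m + 1) div 2))"
    unfolding g_elt_gens by (subst gen_prod_square) auto
  moreover have "2 * ?m * (2 * ?m + 1) div 2 = ?m * (2 * ?m + 1)" by simp
  ultimately show ?thesis by (simp add: power_mult power_add)
qed

text \<open>This trades statements about \<open>g_elt\<close>, in which \<sigma> is defined, for
  statements about a central element.\<close>

lemma g_elt_e_last:
  assumes "odd CARD('n)"
  shows "(g_elt :: 'n::{finite,linorder} clifford) * cl_vec (e_vec CARD('n)) = cl_volume"
proof -
  let ?l = "sorted_list_of_set (UNIV :: 'n set)" and ?k = "2 * (CARD('n) div 2)"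
  have k: "CARD('n) = Suc ?k" using assms by presburger
  then have "length ?l = Suc ?k" by simp
  then have "?l = take ?k ?l @ [?l ! ?k]"
    by (metis lessI order_refl take_Suc_conv_app_nth take_all)
  then have "cl_volume = prod_list (map cl_gen (take ?k ?l @ [?l ! ?k]))"
    unfolding cl_volume_def by (rule arg_cong)
  moreover have "cl_vec (e_vec CARD('n)) = cl_gen (?l ! ?k)"
  proof -
    have "CARD('n) - 1 = ?k" using k by linarith
    then show ?thesis by (simp add: e_vec_def)
  qed
  ultimately show ?thesis
    by (simp add: g_elt_gens)
qed

lemma norm_e_vec: "norm (e_vec j) = 1"
  by (simp add: e_vec_def)

lemma Spin_two: "norm v = 1 \<Longrightarrow> norm w = 1 \<Longrightarrow> cl_vec v * cl_vec w \<in> Spin"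
  unfolding Spin_def by (intro CollectI exI[of _ "[v, w]"]) auto

text \<open>If \<open>w\<close> is not \<open>- e\<close>, conjugation by \<open>w\<close> fixes
  \<open>w\<close>, and conjugation by the normalised bisector \<open>a\<close> of \<open>w\<close>
  and \<open>e\<close> carries it to \<open>e\<close>; their product is even. If
  \<open>w = - e\<close>, the bisector vanishes, and a unit vector orthogonal to \<open>e\<close>,
  available in dimension at least two, takes its place.\<close>

lemma Spin_transitive:
  fixes w e :: "'n::{finite,linorder} euc"
  assumes "norm w = 1" "norm e = 1" "CARD('n) \<ge> 2"
  shows "\<exists>h\<in>Spin. cl_vec e * h = h * cl_vec w"
proof (cases "w = - e")
  case True
  obtain v where v: "norm v = 1" "v \<bullet> e = 0"
  proof -
    obtain v0 where v0: "v0 \<noteq> 0" "orthogonal e v0"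
      using orthogonal_to_vector_exists[of e] assms(3) by auto
    show thesis
      by (rule that[of "v0 /\<^sub>R norm v0"]) (use v0 in \<open>auto simp: orthogonal_def inner_commute\<close>)
  qed
  let ?h = "cl_vec v * cl_vec e"
  have "cl_vec e * cl_vec v = - (cl_vec v * cl_vec e)"
    using cl_vec_orthogonal[OF v(2)] by simp
  then have "cl_vec e * ?h = - (cl_vec v * cl_vec e) * cl_vec e"
    by (simp flip: mult.assoc)
  also have "\<dots> = ?h * cl_vec w" by (simp add: True cl_vec_simps mult.assoc)
  finally show ?thesis using Spin_two[OF v(1) assms(2)] by blast
next
  case False
  define s where "s = w + e"
  define a where "a = s /\<^sub>R norm s"
  have ne: "s \<noteq> 0" using False by (simp add: s_def add_eq_0_iff2)
  then have a: "norm a = 1" by (simp add: a_def)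
  have "(norm s)\<^sup>2 = 2 * (s \<bullet> w)"
    using assms by (simp add: s_def power2_norm_eq_inner norm_eq_1 inner_add_left inner_add_right inner_commute)
  moreover have "(2 * (a \<bullet> w)) *\<^sub>R a = (2 * (s \<bullet> w) / (norm s)\<^sup>2) *\<^sub>R s"
    by (simp add: a_def power2_eq_square divide_inverse mult_ac)
  moreover have "(norm s)\<^sup>2 \<noteq> 0" using ne by simp
  ultimately have "(2 * (a \<bullet> w)) *\<^sub>R a = s" by simp
  then have "(2 * (a \<bullet> w)) *\<^sub>R a - w = e" by (simp add: s_def)
  then have "cl_vec e * cl_vec a = cl_vec a * cl_vec w"
    using unit_vec_conjugation[OF a, of w] by simp
  then have "cl_vec e * (cl_vec a * cl_vec w) = cl_vec a * cl_vec w * cl_vec w"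
    by (simp flip: mult.assoc)
  then show ?thesis using Spin_two[OF a assms(1)] by blast
qed

context spinor_rep
begin

text \<open>Since \<open>g_elt\<close> squares to \<open>c^2\<close> with \<open>c = i^m\<close>,
  every spinor splits into eigenparts for \<open>c\<close> and \<open>-c\<close>. On these
  \<open>e_n\<close> acts by \<open>-i\<close> and \<open>i\<close>, so the two sign changes cancel
  and the product acts by \<open>- i c\<close> on both.\<close>

lemma L_volume:
  assumes "odd CARD('n)"
  shows "L (cl_volume :: 'n clifford) = mat (- (\<i> ^ Suc (CARD('n) div 2)))"
proof -
  let ?c = "\<i> ^ (CARD('n) div 2)" and ?g = "L (g_elt :: 'n clifford)"
    and ?e = "L (cl_vec (e_vec CARD('n) :: 'n euc))"
  have cc: "?c * ?c = (-1) ^ (CARD('n) div 2)" and c0: "?c \<noteq> 0"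
    by (simp_all flip: power_mult_distrib)
  have mod: "?g *v w = ?c *s w \<Longrightarrow> ?e *v w = (- \<i>) *s w"
    "?g *v w = (- ?c) *s w \<Longrightarrow> ?e *v w = \<i> *s w" for w
    using module assms unfolding spinor_module_def by auto
  have gg: "?g *v (?g *v w) = (?c * ?c) *s w" for w
  proof -
    have "?g *v (?g *v w) = L (g_elt * g_elt) *v w"
      by (simp add: L_mult matrix_vector_mul_assoc)
    also have "\<dots> = (?c * ?c) *s w"
      unfolding g_elt_square L_of_real cc
      by (simp add: vec_eq_iff matrix_vector_mult_def mat_def if_distrib if_distribR cong: if_cong)
    finally show ?thesis .
  qed
  have "L cl_volume *v w = (- (\<i> * ?c)) *s w" for w
  proof -
    define p where "p = (1/2) *s (w + (1 / ?c) *s (?g *v w))"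
    define q where "q = (1/2) *s (w - (1 / ?c) *s (?g *v w))"
    have w: "w = p + q" by (simp add: p_def q_def vec_eq_iff field_simps)
    have gp: "?g *v p = ?c *s p"
      unfolding p_def using c0
      by (simp add: vec.scale matrix_vector_right_distrib gg vec_eq_iff field_simps)
    have gq: "?g *v q = (- ?c) *s q"
      unfolding q_def using c0
      by (simp add: vec.scale matrix_vector_mult_diff_distrib gg vec_eq_iff field_simps)
    have "L cl_volume *v w = ?g *v (?e *v p) + ?g *v (?e *v q)"
      by (simp add: w matrix_vector_right_distrib matrix_vector_mul_assoc
          flip: g_elt_e_last[OF assms] L_mult)
    also have "\<dots> = (- (\<i> * ?c)) *s w"
      by (simp only: mod(1)[OF gp] mod(2)[OF gq] vec.scale gp gq)
        (simp add: w vec_eq_iff algebra_simps)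
    finally show ?thesis .
  qed
  moreover have "mat c *v w = c *s w" for c and w :: "complex^'s"
    by (simp add: vec_eq_iff matrix_vector_mult_def mat_def if_distrib if_distribR cong: if_cong)
  ultimately show ?thesis
    by (subst matrix_eq) simp
qed

text \<open>Right multiplication by \<open>w\<close> preserves commutation with \<open>w\<close> and
  turns anticommutation with its orthogonal complement into commutation. The sign \<kappa> belongs
  to the direction of \<open>w\<close> and changes with it.\<close>

lemma spin_fixed_line:
  fixes g :: "'n clifford"
  assumes g: "g \<in> Spin" and w: "norm w = 1" and com: "cl_vec w * g = g * cl_vec w"
    and anti: "\<And>v. v \<bullet> w = 0 \<Longrightarrow> cl_vec v * g = - (g * cl_vec v)"
  shows "odd CARD('n)"
    and "\<exists>\<kappa>\<in>{1, -1}. g * cl_vec w = \<kappa> *\<^sub>R cl_volume \<and>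
           (CARD('n) \<ge> 2 \<longrightarrow> (\<forall>c>0. spin_sigma g (c *\<^sub>R w) = \<kappa>))"
    and "g * g = of_real ((-1) ^ (CARD('n) div 2))"
proof -
  let ?x = "g * cl_vec w"
  note ww = cl_vec_unit_square[OF w]
  have central: "cl_vec z * ?x = ?x * cl_vec z" for z
  proof -
    define z' where "z' = z - (z \<bullet> w) *\<^sub>R w"
    have z': "z' \<bullet> w = 0" using w by (simp add: z'_def inner_diff_left norm_eq_1)
    have "cl_vec z' * ?x = - (g * (cl_vec z' * cl_vec w))"
      using anti[OF z'] by (simp flip: mult.assoc)
    also have "\<dots> = ?x * cl_vec z'"
      using cl_vec_orthogonal[OF z'] by (simp add: mult.assoc)
    finally have 1: "cl_vec z' * ?x = ?x * cl_vec z'" .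
    have 2: "cl_vec w * ?x = ?x * cl_vec w" using com by (simp flip: mult.assoc)
    have z: "cl_vec z = cl_vec z' + (z \<bullet> w) *\<^sub>R cl_vec w" by (simp add: z'_def flip: cl_vec_simps)
    show ?thesis unfolding z by (simp add: distrib_left distrib_right 1 2)
  qed
  then have gcentral: "cl_gen i * ?x = ?x * cl_gen i" for i
    by (metis cl_vec_axis)
  have par: "cl_parity False ?x"
    using cl_parity_vec_mult[OF Spin_even[OF g], of w] by (simp add: com)
  have nx: "norm (det (L ?x)) = 1"
    by (simp add: L_mult det_mul norm_mult norm_det_Spin[OF g] norm_det_unit_vec[OF w])
  have "?x \<noteq> 0"
  proof
    assume "?x = 0"
    then have "L ?x = mat 0" by (simp only: L_simps) (simp add: mat_def vec_eq_iff)
    then have "det (L ?x) = 0 ^ CARD('s)" by (simp only: det_scalar)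
    with nx show False by (simp add: zero_power)
  qed
  then obtain A where A: "cl_coeff ?x A \<noteq> 0" using cl_eqI[of ?x 0] by auto
  with par have "odd (card A)" by (auto simp: cl_parity_def)
  with central_support[of ?x, OF gcentral A] show odd: "odd CARD('n)" by auto
  let ?s = "(-1) ^ (CARD('n) * (CARD('n) + 1) div 2) :: real"
  have vv: "(cl_volume :: 'n clifford) * cl_volume = of_real ?s" by (rule cl_volume_square)
  have ss: "?s * ?s = 1" by (simp flip: power_add mult_2)
  \<comment> \<open>In odd dimension the volume element is odd and central, so this product is even
    and central, hence a real scalar.\<close>
  have "cl_parity True (cl_volume * ?x)"
    using cl_parity_prod_list[OF par, of "map (\<lambda>i. axis i 1) (sorted_list_of_set UNIV)"] odd
    unfolding cl_volume_as_vecs[symmetric] by simp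
  moreover have "cl_gen i * (cl_volume * ?x) = cl_volume * ?x * cl_gen i" for i
  proof -
    have "cl_gen i * (cl_volume * ?x) = cl_volume * (cl_gen i * ?x)"
      using cl_volume_central[OF odd, of i] by (simp flip: mult.assoc)
    then show ?thesis by (simp add: gcentral mult.assoc)
  qed
  ultimately obtain r where r: "cl_volume * ?x = of_real r"
    using even_central_scalar by blast
  define \<kappa> where "\<kappa> = ?s * r"
  have "of_real ?s * ?x = cl_volume * (cl_volume * ?x)"
    unfolding mult.assoc[symmetric] by (simp only: vv)
  then have sx: "?s *\<^sub>R ?x = r *\<^sub>R cl_volume"
    by (simp only: r) (simp add: of_real_def)
  have "?x = (?s * ?s) *\<^sub>R ?x" by (simp only: ss scaleR_one)
  also have "\<dots> = ?s *\<^sub>R (r *\<^sub>R cl_volume)" by (simp only: sx flip: scaleR_scaleR)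
  finally have x: "?x = \<kappa> *\<^sub>R cl_volume" by (simp only: \<kappa>_def scaleR_scaleR)
  have nv: "norm (det (L cl_volume)) = 1"
    unfolding cl_volume_as_vecs by (rule norm_det_prod_list) auto
  have "?x = of_real \<kappa> * cl_volume" using x by (simp add: of_real_def)
  then have "norm (det (L (of_real \<kappa>))) = 1"
    using nx nv by (simp add: L_mult det_mul norm_mult)
  then have \<kappa>: "\<kappa> = 1 \<or> \<kappa> = -1" by (rule norm_det_scalar)
  \<comment> \<open>As \<open>g\<close> and \<open>w\<close> commute and \<open>w\<close> has square
    -1, the square of \<open>?x\<close> is the negative of the square of \<open>g\<close>.\<close>
  have xx: "?x * ?x = of_real ?s" using \<kappa> by (auto simp: x vv)
  have "?x * ?x = g * (cl_vec w * g) * cl_vec w" by (simp add: mult.assoc)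
  also have "\<dots> = g * g * (cl_vec w * cl_vec w)" by (simp add: com mult.assoc)
  finally have "g * g = - of_real ?s" using xx ww by simp
  also have "\<dots> = of_real (- ?s)" by simp
  also have "- ?s = (-1) ^ (CARD('n) div 2)"
  proof -
    obtain a where a: "CARD('n) = 2 * a + 1" using odd by (auto elim: oddE)
    have "(2 * a + 1) * (2 * a + 1 + 1) div 2 = 2 * (a * (a + 1)) + (a + 1)"
      by (simp add: algebra_simps)
    then show ?thesis by (simp add: a power_add power_mult)
  qed
  finally show "g * g = of_real ((-1) ^ (CARD('n) div 2))" .
  have "spin_sigma g (c *\<^sub>R w) = \<kappa>" if n: "CARD('n) \<ge> 2" and c: "c > 0" for c
  proof -
    let ?en = "e_vec CARD('n) :: 'n euc"
    \<comment> \<open>The element that \<open>spin_sigma\<close> selects is known only by its two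
      defining properties; \<open>h0\<close> shows that they can be met.\<close>
    define h :: "'n clifford" where "h = (SOME h. h \<in> Spin \<and> spin_cover h (c *\<^sub>R w) = norm (c *\<^sub>R w) *\<^sub>R ?en)"
    obtain h0 :: "'n clifford" where h0: "h0 \<in> Spin" "cl_vec ?en * h0 = h0 * cl_vec w"
      using Spin_transitive[OF w norm_e_vec n] by blast
    have "spin_cover h0 (c *\<^sub>R w) = norm (c *\<^sub>R w) *\<^sub>R ?en"
      by (rule spin_cover_eqI) (use h0 c w in \<open>auto simp: cl_vec_simps\<close>)
    then have h: "h \<in> Spin" "spin_cover h (c *\<^sub>R w) = norm (c *\<^sub>R w) *\<^sub>R ?en"
      using someI[of "\<lambda>h. h \<in> Spin \<and> spin_cover h (c *\<^sub>R w) = norm (c *\<^sub>R w) *\<^sub>R ?en" h0] h0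
      unfolding h_def by blast+
    have "c *\<^sub>R (cl_vec ?en * h) = c *\<^sub>R (h * cl_vec w)"
      using spin_cover_mult[OF h(1), of "c *\<^sub>R w"] h(2) c w by (simp add: cl_vec_simps)
    then have hw: "cl_vec ?en * h = h * cl_vec w" using c by simp
    have en: "cl_vec ?en * cl_vec ?en = -1" by (rule cl_vec_unit_square[OF norm_e_vec])
    \<comment> \<open>Conjugation by \<open>h\<close> carries \<open>w\<close> to \<open>e_n\<close>
      and fixes the volume element, so the equation for \<open>g w\<close> becomes
      \<open>?g' e_n = \<kappa> g_elt e_n\<close>.\<close>
    let ?g' = "h * g * spin_inv h"
    have "?g' * cl_vec ?en * h = ?g' * (h * cl_vec w)" by (simp add: mult.assoc hw)
    also have "\<dots> = h * g * (spin_inv h * h) * cl_vec w" by (simp only: mult.assoc)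
    also have "\<dots> = h * ?x" by (simp add: spin_inv[OF h(1)] mult.assoc)
    also have "\<dots> = \<kappa> *\<^sub>R (h * cl_volume)" by (simp add: x)
    also have "h * cl_volume = cl_volume * h" by (rule Spin_commutes_volume[OF h(1) odd])
    finally have "?g' * cl_vec ?en * h * spin_inv h = \<kappa> *\<^sub>R (cl_volume * h) * spin_inv h" by simp
    then have "?g' * cl_vec ?en = \<kappa> *\<^sub>R cl_volume"
      by (simp add: mult.assoc spin_inv[OF h(1)])
    then have "?g' * cl_vec ?en = \<kappa> *\<^sub>R g_elt * cl_vec ?en"
      by (simp add: g_elt_e_last[OF odd])
    then have "?g' * (cl_vec ?en * cl_vec ?en) = \<kappa> *\<^sub>R g_elt * (cl_vec ?en * cl_vec ?en)"
      by (simp flip: mult.assoc)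
    then have g': "?g' = \<kappa> *\<^sub>R g_elt" by (simp add: en)
    \<comment> \<open>Elements of \<open>Spin_sub\<close> commute with \<open>e_n\<close> and with
      the volume element, hence with \<open>g_elt\<close>. The class of \<open>g_elt\<close> is
      therefore a single point, and the test in \<open>spin_sigma\<close> is the equation
      \<open>?g' = g_elt\<close>.\<close>
    have comm: "t * g_elt * spin_inv t = g_elt" if t: "t \<in> Spin_sub" for t :: "'n clifford"
    proof -
      have t1: "t \<in> Spin" and t2: "cl_vec ?en * t = t * cl_vec ?en"
        using t spin_cover_mult[of t ?en] by (auto simp: Spin_sub_def)
      have "t * (g_elt * cl_vec ?en) = g_elt * cl_vec ?en * t"
        using Spin_commutes_volume[OF t1 odd] by (simp add: g_elt_e_last[OF odd])
      then have "t * g_elt * cl_vec ?en = g_elt * t * cl_vec ?en" by (simp add: mult.assoc t2)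
      then have "t * g_elt * (cl_vec ?en * cl_vec ?en) = g_elt * t * (cl_vec ?en * cl_vec ?en)"
        by (simp flip: mult.assoc)
      then have "t * g_elt = g_elt * t" by (simp add: en)
      then show ?thesis by (simp add: mult.assoc spin_inv[OF t1])
    qed
    have gne: "g_elt \<noteq> (0 :: 'n clifford)" "- g_elt \<noteq> (g_elt :: 'n clifford)"
    proof -
      show 1: "g_elt \<noteq> (0 :: 'n clifford)"
      proof
        assume "g_elt = (0 :: 'n clifford)"
        then have "of_real ((-1) ^ (CARD('n) div 2)) = (0 :: 'n clifford)"
          using g_elt_square[where 'n = 'n] by (simp only: mult_zero_left)
        then show False by (simp only: of_real_eq_0_iff) simp
      qed
      show "- g_elt \<noteq> (g_elt :: 'n clifford)"
      proof
        assume "- g_elt = (g_elt :: 'n clifford)"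
        then have "g_elt + g_elt = (0 :: 'n clifford)" by (metis add.right_inverse)
        then have "2 *\<^sub>R g_elt = (0 :: 'n clifford)" by (simp add: scaleR_2)
        with 1 show False by simp
      qed
    qed
    have one: "(1 :: 'n clifford) \<in> Spin_sub"
      by (auto simp: Spin_sub_def Spin_one intro!: spin_cover_eqI)
    have "(\<exists>t\<in>Spin_sub. ?g' = t * g_elt * spin_inv t) \<longleftrightarrow> \<kappa> = 1"
      using \<kappa> comm gne one g' by (metis scaleR_minus1_left scaleR_one)
    then show ?thesis
      unfolding spin_sigma_def Let_def h_def[symmetric] using \<kappa> by auto
  qed
  then show "\<exists>\<kappa>\<in>{1, -1}. g * cl_vec w = \<kappa> *\<^sub>R cl_volume \<and>
           (CARD('n) \<ge> 2 \<longrightarrow> (\<forall>c>0. spin_sigma g (c *\<^sub>R w) = \<kappa>))"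
    using \<kappa> x by auto
qed

end

section \<open>Discrete subgroups of Euclidean space\<close>

locale discrete_subgroup =
  fixes \<Lambda> :: "'a::euclidean_space set"
  assumes zero_mem: "0 \<in> \<Lambda>" and diff_mem: "x \<in> \<Lambda> \<Longrightarrow> y \<in> \<Lambda> \<Longrightarrow> x - y \<in> \<Lambda>"
    and separated: "\<exists>e>0. \<forall>x\<in>\<Lambda>. norm x < e \<longrightarrow> x = 0"
begin

lemma neg_mem: "x \<in> \<Lambda> \<Longrightarrow> - x \<in> \<Lambda>"
  using diff_mem[OF zero_mem] by simp

lemma add_mem: "x \<in> \<Lambda> \<Longrightarrow> y \<in> \<Lambda> \<Longrightarrow> x + y \<in> \<Lambda>"
  using diff_mem[of x "- y"] neg_mem by simp

lemma nat_mem: "x \<in> \<Lambda> \<Longrightarrow> of_nat n *\<^sub>R x \<in> \<Lambda>"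
  by (induction n) (auto simp: zero_mem scaleR_add_left intro: add_mem)

lemma int_mem: assumes "x \<in> \<Lambda>" shows "of_int z *\<^sub>R x \<in> \<Lambda>"
  using nat_mem[OF assms, of "nat z"] neg_mem[OF nat_mem[OF assms, of "nat (- z)"]]
  by (cases "z \<ge> 0") auto

lemma int_sum_mem: "finite C \<Longrightarrow> (\<And>v. v \<in> C \<Longrightarrow> f v \<in> \<Lambda>) \<Longrightarrow> (\<Sum>v\<in>C. of_int (c v) *\<^sub>R f v) \<in> \<Lambda>"
  by (induction C rule: finite_induct) (auto intro: add_mem int_mem zero_mem)

text \<open>An infinite bounded set has a limit point, but differences of lattice elements keep
  distinct points uniformly apart.\<close>

lemma finite_bounded: "finite {x \<in> \<Lambda>. norm x \<le> R}"
proof (rule ccontr)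
  let ?S = "{x \<in> \<Lambda>. norm x \<le> R}"
  assume "infinite ?S"
  moreover have "bounded ?S" by (auto simp: bounded_iff)
  ultimately obtain l where l: "l islimpt ?S"
    using bounded_infinite_imp_islimpt[of ?S ?S] by auto
  obtain e where e: "e > 0" "\<forall>x\<in>\<Lambda>. norm x < e \<longrightarrow> x = 0" using separated by blast
  have "\<not> l islimpt ?S"
    by (rule discrete_imp_not_islimpt[OF e(1)]) (use e diff_mem in \<open>force simp: dist_norm\<close>)
  with l show False by simp
qed

lemma sublattice: "subspace V \<Longrightarrow> discrete_subgroup (\<Lambda> \<inter> V)"
  using separated by unfold_locales (auto simp: zero_mem diff_mem subspace_0 subspace_diff)

text \<open>Induction on a real basis. Among the lattice elements, one whose coefficient
  \<open>k0\<close> along the new direction \<open>d\<close> is least positive becomes the new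
  generator, and division with remainder by \<open>k0\<close> reduces every other element to the old
  span.\<close>

lemma span_basis:
  assumes "finite D" "independent D" "D \<subseteq> \<Lambda>"
  shows "\<exists>C. finite C \<and> independent C \<and> C \<subseteq> \<Lambda> \<and> span C = span D \<and>
     (\<forall>x\<in>\<Lambda> \<inter> span D. \<exists>c::'a \<Rightarrow> int. x = (\<Sum>v\<in>C. of_int (c v) *\<^sub>R v))"
  using assms
proof (induction D rule: finite_induct)
  case empty
  show ?case by (rule exI[of _ "{}"]) (auto simp: independent_empty)
next
  case (insert d D)
  then have dD: "d \<notin> span D" and indD: "independent D"
    using independent_insert[of d D] by auto
  obtain C where C: "finite C" "independent C" "C \<subseteq> \<Lambda>" "span C = span D"
    and Cc: "\<And>x. x \<in> \<Lambda> \<inter> span D \<Longrightarrow> \<exists>c::'a \<Rightarrow> int. x = (\<Sum>v\<in>C. of_int (c v) *\<^sub>R v)"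
    using insert indD by auto
  define K where "K = {k. 0 < k \<and> k \<le> 1 \<and> (\<exists>x\<in>\<Lambda>. x - k *\<^sub>R d \<in> span D)}"
  define R where "R = norm d + (\<Sum>v\<in>C. norm v)"
  have uniq: "k = l" if "x - k *\<^sub>R d \<in> span D" "x - l *\<^sub>R d \<in> span D" for x k l
  proof (rule ccontr)
    assume "k \<noteq> l"
    have "(k - l) *\<^sub>R d \<in> span D"
      using span_diff[OF that(2,1)] by (simp add: algebra_simps)
    then have "(1 / (k - l)) *\<^sub>R ((k - l) *\<^sub>R d) \<in> span D" by (rule span_scale)
    with \<open>k \<noteq> l\<close> dD show False by simp
  qed
  have "\<exists>x. x \<in> \<Lambda> \<and> norm x \<le> R \<and> x - k *\<^sub>R d \<in> span D" if k: "k \<in> K" for k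
  proof -
    obtain x where x: "x \<in> \<Lambda>" "x - k *\<^sub>R d \<in> span C" using k C(4) by (auto simp: K_def)
    obtain r where r: "x - k *\<^sub>R d = (\<Sum>v\<in>C. r v *\<^sub>R v)"
      using x(2) C(1) by (auto simp: span_finite)
    \<comment> \<open>Removing integer parts of the coordinates in \<open>C\<close> keeps the
      \<open>d\<close>-coefficient and bounds the vector by \<open>R\<close>, so only finitely many
      coefficients in \<open>K\<close> occur and a minimum exists.\<close>
    let ?y = "x - (\<Sum>v\<in>C. of_int \<lfloor>r v\<rfloor> *\<^sub>R v)"
    have y: "?y = k *\<^sub>R d + (\<Sum>v\<in>C. frac (r v) *\<^sub>R v)"
      using r by (simp add: frac_def scaleR_diff_left sum_subtractf algebra_simps)
    have "norm ?y \<le> norm (k *\<^sub>R d) + norm (\<Sum>v\<in>C. frac (r v) *\<^sub>R v)"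
      unfolding y by (rule norm_triangle_ineq)
    also have "norm (k *\<^sub>R d) \<le> norm d" using k by (auto simp: K_def mult_left_le_one_le)
    also have "norm (\<Sum>v\<in>C. frac (r v) *\<^sub>R v) \<le> (\<Sum>v\<in>C. norm (frac (r v) *\<^sub>R v))"
      by (rule norm_sum)
    also have "\<dots> \<le> (\<Sum>v\<in>C. norm v)"
      by (intro sum_mono) (auto simp: mult_left_le_one_le frac_ge_0 frac_lt_1 less_imp_le)
    finally have "norm ?y \<le> R" by (simp add: R_def)
    moreover have "?y \<in> \<Lambda>"
      using C by (intro diff_mem x int_sum_mem) auto
    moreover have "?y - k *\<^sub>R d \<in> span D"
      unfolding y C(4)[symmetric] by (simp add: span_sum span_scale span_base)
    ultimately show ?thesis by blast
  qed
  then obtain g where g: "\<And>k. k \<in> K \<Longrightarrow> g k \<in> \<Lambda> \<and> norm (g k) \<le> R \<and> g k - k *\<^sub>R d \<in> span D"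
    by metis
  have "inj_on g K" by (rule inj_onI) (use g uniq in metis)
  moreover have "finite (g ` K)" by (rule finite_subset[OF _ finite_bounded[of R]]) (use g in auto)
  ultimately have finK: "finite K" by (rule finite_imageD[rotated])
  have "1 \<in> K" using insert.prems by (auto simp: K_def intro!: bexI[of _ d] span_zero)
  define k0 where "k0 = Min K"
  have k0: "k0 \<in> K" and k0_min: "\<And>k. k \<in> K \<Longrightarrow> k0 \<le> k"
    using finK \<open>1 \<in> K\<close> by (auto simp: k0_def intro: Min_in)
  then obtain x0 where x0: "x0 \<in> \<Lambda>" "x0 - k0 *\<^sub>R d \<in> span D" and k0_pos: "0 < k0" "k0 \<le> 1"
    by (auto simp: K_def)
  have x0D: "x0 \<notin> span D"
  proof
    assume "x0 \<in> span D"
    then have "x0 - 0 *\<^sub>R d \<in> span D" by simp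
    with uniq[OF x0(2) this] k0_pos show False by simp
  qed
  then have x0C: "x0 \<notin> C" using C(4) span_base by metis
  show ?case
  proof (intro exI[of _ "insert x0 C"] conjI ballI)
    show "finite (insert x0 C)" "insert x0 C \<subseteq> \<Lambda>" using C x0 by auto
    show "independent (insert x0 C)" using x0D C by (simp add: independent_insertI)
    have "x0 \<in> span (insert d D)"
      using span_breakdown_eq[of x0 d D] x0 by auto
    moreover have "d \<in> span (insert x0 C)"
    proof -
      have "d - (1 / k0) *\<^sub>R x0 = - (1 / k0) *\<^sub>R (x0 - k0 *\<^sub>R d)"
        using k0_pos by (simp add: algebra_simps)
      also have "\<dots> \<in> span C" unfolding C(4) using x0(2) by (rule span_scale)
      finally show ?thesis using span_breakdown_eq[of d x0 C] by blast
    qed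
    moreover have "C \<subseteq> span (insert d D)"
      using C(4) span_superset[of C] span_mono[OF subset_insertI, of D d] by auto
    moreover have "D \<subseteq> span (insert x0 C)"
      using C(4) span_superset[of D] span_mono[OF subset_insertI, of C x0] by auto
    ultimately show "span (insert x0 C) = span (insert d D)"
      by (intro subset_antisym span_minimal) auto
    fix x assume x: "x \<in> \<Lambda> \<inter> span (insert d D)"
    then obtain k where k: "x - k *\<^sub>R d \<in> span D"
      using span_breakdown_eq[of x d D] by auto
    define z where "z = \<lfloor>k / k0\<rfloor>"
    define y where "y = x - of_int z *\<^sub>R x0"
    have yL: "y \<in> \<Lambda>" unfolding y_def using x x0 by (auto intro: diff_mem int_mem)
    have "y - (k - of_int z * k0) *\<^sub>R d = (x - k *\<^sub>R d) - of_int z *\<^sub>R (x0 - k0 *\<^sub>R d)"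
      by (simp add: y_def algebra_simps)
    also have "\<dots> \<in> span D" by (rule span_diff[OF k span_scale[OF x0(2)]])
    finally have yk: "y - (k - of_int z * k0) *\<^sub>R d \<in> span D" .
    \<comment> \<open>A positive remainder would be an element of \<open>K\<close> below its
      minimum.\<close>
    have "0 \<le> k - of_int z * k0" "k - of_int z * k0 < k0"
      using floor_divide_lower[OF k0_pos(1), of k] floor_divide_upper[OF k0_pos(1), of k]
      by (auto simp: z_def algebra_simps)
    moreover have "k - of_int z * k0 \<notin> K" using calculation k0_min by force
    ultimately have "k - of_int z * k0 = 0" using yk yL k0_pos by (force simp: K_def)
    with yk have "y \<in> \<Lambda> \<inter> span D" using yL by simp
    then obtain c :: "'a \<Rightarrow> int" where c: "y = (\<Sum>v\<in>C. of_int (c v) *\<^sub>R v)" using Cc by blast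
    have "x = (\<Sum>v\<in>insert x0 C. of_int ((c(x0 := z)) v) *\<^sub>R v)"
    proof -
      have "(\<Sum>v\<in>C. of_int ((c(x0 := z)) v) *\<^sub>R v) = y"
        unfolding c using x0C by (intro sum.cong) auto
      then show ?thesis using x0C C(1) by (simp add: y_def)
    qed
    then show "\<exists>c::'a \<Rightarrow> int. x = (\<Sum>v\<in>insert x0 C. of_int (c v) *\<^sub>R v)" by blast
  qed
qed

lemma basis_exists:
  "\<exists>C. finite C \<and> independent C \<and> C \<subseteq> \<Lambda> \<and> span C = span \<Lambda> \<and>
     (\<forall>x\<in>\<Lambda>. \<exists>c::'a \<Rightarrow> int. x = (\<Sum>v\<in>C. of_int (c v) *\<^sub>R v))"
proof -
  obtain D where D: "D \<subseteq> \<Lambda>" "independent D" "\<Lambda> \<subseteq> span D"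
    using maximal_independent_subset[of \<Lambda>] by blast
  have "span D = span \<Lambda>" using D by (metis span_eq span_superset subset_trans)
  moreover have "\<Lambda> \<inter> span D = \<Lambda>" using D by auto
  ultimately show ?thesis using span_basis[OF independent_imp_finite[OF D(2)] D(2,1)] by simp
qed

end

lemma Z_basis_of_set:
  fixes \<Lambda> :: "('n::finite euc) set"
  assumes "discrete_subgroup \<Lambda>" "finite C" "independent C" "C \<subseteq> \<Lambda>" "card C = CARD('n)"
    and gen: "\<And>x. x \<in> \<Lambda> \<Longrightarrow> \<exists>c::'n euc \<Rightarrow> int. x = (\<Sum>v\<in>C. of_int (c v) *\<^sub>R v)"
  shows "\<exists>f. Z_basis f \<Lambda> \<and> bij_betw f UNIV C"
proof -
  interpret discrete_subgroup \<Lambda> by fact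
  have "\<exists>f. bij_betw f (UNIV :: 'n set) C"
    by (rule finite_same_card_bij) (use assms in auto)
  then obtain f :: "'n \<Rightarrow> 'n euc" where f: "bij_betw f UNIV C" by blast
  have fC: "f i \<in> C" for i using f by (auto simp: bij_betw_def)
  have fr: "(\<Sum>v\<in>C. g v *\<^sub>R v) = (\<Sum>i\<in>UNIV. g (f i) *\<^sub>R f i)" for g :: "'n euc \<Rightarrow> real"
    using sum.reindex_bij_betw[OF f, of "\<lambda>v. g v *\<^sub>R v"] by simp
  have "Z_basis f \<Lambda>"
    unfolding Z_basis_def bij_betw_def
  proof
    show "inj (\<lambda>c. \<Sum>i\<in>UNIV. real_of_int (c i) *\<^sub>R f i)"
    proof (rule injI)
      fix c c' :: "'n \<Rightarrow> int"
      assume eq: "(\<Sum>i\<in>UNIV. real_of_int (c i) *\<^sub>R f i) = (\<Sum>i\<in>UNIV. real_of_int (c' i) *\<^sub>R f i)"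
      let ?g = "\<lambda>v. real_of_int (c (inv_into UNIV f v)) - real_of_int (c' (inv_into UNIV f v))"
      have inv: "inv_into UNIV f (f i) = i" for i using f by (simp add: bij_betw_def)
      have "(\<Sum>v\<in>C. ?g v *\<^sub>R v) = 0"
        unfolding fr using eq by (simp add: inv scaleR_diff_left sum_subtractf)
      then have "?g v = 0" if "v \<in> C" for v
        using assms(2,3) that by (auto simp: independent_explicit)
      then have "?g (f i) = 0" for i using fC by blast
      then show "c = c'" by (auto simp: inv)
    qed
    show "range (\<lambda>c. \<Sum>i\<in>UNIV. real_of_int (c i) *\<^sub>R f i) = \<Lambda>"
    proof (intro subset_antisym subsetI)
      fix x assume "x \<in> range (\<lambda>c. \<Sum>i\<in>UNIV. real_of_int (c i) *\<^sub>R f i)"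
      then show "x \<in> \<Lambda>" using fC assms(4) by (auto intro!: int_sum_mem)
    next
      fix x assume "x \<in> \<Lambda>"
      then obtain c :: "'n euc \<Rightarrow> int" where "x = (\<Sum>v\<in>C. of_int (c v) *\<^sub>R v)" using gen by blast
      then have "x = (\<Sum>i\<in>UNIV. real_of_int ((c \<circ> f) i) *\<^sub>R f i)" by (simp add: fr)
      then show "x \<in> range (\<lambda>c. \<Sum>i\<in>UNIV. real_of_int (c i) *\<^sub>R f i)" by blast
    qed
  qed
  with f show ?thesis by blast
qed

lemma Z_basis_mem:
  assumes "Z_basis f \<Lambda>" shows "f j \<in> \<Lambda>"
proof -
  have "(\<Sum>i\<in>UNIV. real_of_int ((if i = j then 1 else 0)) *\<^sub>R f i) = (\<Sum>i\<in>UNIV. if i = j then f j else 0)"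
    by (intro sum.cong) auto
  then have "(\<Sum>i\<in>UNIV. real_of_int ((if i = j then 1 else 0)) *\<^sub>R f i) = f j" by simp
  then show ?thesis
    using assms unfolding Z_basis_def bij_betw_def by (metis (mono_tags) rangeI)
qed

lemma Z_basis_expand:
  assumes "Z_basis f \<Lambda>" "x \<in> \<Lambda>"
  obtains c :: "'n::finite \<Rightarrow> int" where "x = (\<Sum>i\<in>UNIV. real_of_int (c i) *\<^sub>R f i)"
  using assms unfolding Z_basis_def bij_betw_def by blast

lemma Z_basis_independent:
  fixes f :: "'n::finite \<Rightarrow> 'n euc"
  assumes "Z_basis f \<Lambda>" "span \<Lambda> = UNIV"
  shows "inj f" "independent (range f)" "span (range f) = UNIV"
proof -
  have "\<Lambda> \<subseteq> span (range f)"
  proof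
    fix x assume "x \<in> \<Lambda>"
    then obtain c where "x = (\<Sum>i\<in>UNIV. real_of_int (c i) *\<^sub>R f i)" by (rule Z_basis_expand[OF assms(1)])
    then show "x \<in> span (range f)" by (simp add: span_sum span_scale span_base)
  qed
  then show sp: "span (range f) = UNIV"
    using assms(2) by (metis span_minimal subspace_span top.extremum_uniqueI)
  have "CARD('n) \<le> card (range f)"
    using dim_le_card[of UNIV "range f"] sp by (simp add: dim_UNIV)
  then have card: "card (range f) = CARD('n)"
    using card_image_le[of UNIV f] by simp
  then show "inj f" by (simp add: eq_card_imp_inj_on)
  show "independent (range f)"
    using card_le_dim_spanning[of "range f" UNIV] sp card by (simp add: dim_UNIV)
qed

section \<open>Isometries and involutive orthogonal matrices\<close>

lemma orth_inv:
  fixes B :: "'n::finite emat"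
  assumes "orthogonal_matrix B"
  shows "(B *v x) v* B = x" "B *v (x v* B) = x"
  using assms unfolding transpose_matrix_vector[symmetric]
  by (simp_all add: orthogonal_matrix_def matrix_vector_mul_assoc del: transpose_matrix_vector)

lemma orth_inner:
  fixes B :: "'n::finite emat"
  shows "orthogonal_matrix B \<Longrightarrow> (B *v x) \<bullet> (B *v y) = x \<bullet> y"
  by (simp add: dot_lmul_matrix[symmetric] orth_inv)

lemma orth_norm:
  fixes B :: "'n::finite emat"
  shows "orthogonal_matrix B \<Longrightarrow> norm (B *v x) = norm x"
  by (simp add: norm_eq_sqrt_inner orth_inner)

lemma BL_inject:
  assumes "orthogonal_matrix B" "BL B b = BL C c"
  shows "B = C" "b = c"
proof -
  have eq: "B *v (x + b) = C *v (x + c)" for x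
    using assms(2) by (metis BL_def)
  have "B *v x = C *v x" for x
    using eq[of x] eq[of 0] by (simp add: matrix_vector_right_distrib)
  then show "B = C" by (simp add: matrix_eq)
  with eq[of 0] have "(B *v b) v* B = (B *v c) v* B" by simp
  then show "b = c" by (simp add: orth_inv[OF assms(1)])
qed

lemma rot_BL: "orthogonal_matrix B \<Longrightarrow> rot (BL B b) = B"
  unfolding rot_def by (rule the_equality) (auto dest: BL_inject)

text \<open>\<open>BL\<close> translates before it rotates, so \<open>b\<close> has to be moved
  through \<open>C\<close>; \<open>b v* C\<close> is the transpose of \<open>C\<close>, that is its
  inverse, applied to \<open>b\<close>.\<close>

lemma BL_comp:
  "orthogonal_matrix C \<Longrightarrow> BL B b \<circ> BL C c = BL (B ** C) (b v* C + c)"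
  by (auto simp: BL_def fun_eq_iff matrix_vector_right_distrib orth_inv simp flip: matrix_vector_mul_assoc)

lemma orth_one: "orthogonal_matrix (mat 1 :: real^'n^'n)"
  by (simp add: orthogonal_matrix_def)

lemma BL_id: "BL (mat 1) 0 = id"
  by (auto simp: BL_def fun_eq_iff)

lemma group_isometry_group: "group (isometry_group :: 'n::finite emap monoid)"
proof (rule groupI)
  fix x :: "'n emap" assume "x \<in> carrier isometry_group"
  then obtain B b where x: "x = BL B b" "orthogonal_matrix B" by (auto simp: isometry_group_def)
  have "BL (transpose B) (- (B *v b)) \<circ> x = id"
    using x(2) by (auto simp: x(1) BL_def fun_eq_iff matrix_vector_right_distrib orth_inv
        vector_matrix_left_distrib)
  moreover have "orthogonal_matrix (transpose B)" using x by (simp add: orthogonal_matrix_transpose)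
  ultimately show "\<exists>y\<in>carrier isometry_group. y \<otimes>\<^bsub>isometry_group\<^esub> x = \<one>\<^bsub>isometry_group\<^esub>"
    unfolding isometry_group_def by (intro bexI[of _ "BL (transpose B) (- (B *v b))"]) auto
next
  show "\<one>\<^bsub>isometry_group\<^esub> \<in> carrier (isometry_group :: 'n emap monoid)"
    using orth_one by (auto simp: isometry_group_def BL_id[symmetric])
next
  fix x y :: "'n emap" assume "x \<in> carrier isometry_group" "y \<in> carrier isometry_group"
  then show "x \<otimes>\<^bsub>isometry_group\<^esub> y \<in> carrier isometry_group"
    using orthogonal_matrix_mul by (fastforce simp: isometry_group_def BL_comp)
qed (auto simp: isometry_group_def comp_assoc)

text \<open>For \<open>v\<close> orthogonal to the fixed line, \<open>v + B v\<close> is fixed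
  because \<open>B\<close> is an involution and still orthogonal to the line because
  \<open>B\<close> is orthogonal; so it vanishes.\<close>

lemma fixdim_one:
  fixes B :: "'n::finite emat"
  assumes "orthogonal_matrix B" "B ** B = mat 1" "fixdim B = 1"
  obtains w where "norm w = 1" "B *v w = w" "\<And>v. v \<bullet> w = 0 \<Longrightarrow> B *v v = - v"
    "\<And>x. B *v x = x \<Longrightarrow> x = (x \<bullet> w) *\<^sub>R w"
proof -
  let ?V = "{x. (B - mat 1) *v x = 0}"
  have V: "x \<in> ?V \<longleftrightarrow> B *v x = x" for x by (simp add: matrix_vector_mult_diff_rdistrib)
  obtain b where b: "b \<subseteq> ?V" "independent b" "?V \<subseteq> span b"
    using maximal_independent_subset[of ?V] by blast
  then have "card b = 1" using assms(3) basis_card_eq_dim[of b ?V] by (simp add: fixdim_def)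
  then obtain u where u: "b = {u}" by (auto simp: card_1_singleton_iff)
  with b(2) have u0: "u \<noteq> 0" using dependent_zero by blast
  define w where "w = u /\<^sub>R norm u"
  have w: "norm w = 1" using u0 by (simp add: w_def)
  have "B *v u = u" using b(1) u V by blast
  then have Bw: "B *v w = w" by (simp add: w_def matrix_vector_mult_scaleR)
  have line: "x = (x \<bullet> w) *\<^sub>R w" if x: "B *v x = x" for x
  proof -
    have "x \<in> span {u}" using b(3) u V x by blast
    then obtain c where "x = c *\<^sub>R u" by (auto simp: span_singleton)
    then have "x = (c * norm u) *\<^sub>R w" using u0 by (simp add: w_def)
    then show ?thesis using w by (simp add: norm_eq_1)
  qed
  show thesis
  proof (rule that[OF w Bw _ line])
    fix v assume v: "v \<bullet> w = 0"
    let ?y = "v + B *v v"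
    have "B *v ?y = ?y"
      by (simp add: matrix_vector_right_distrib matrix_vector_mul_assoc assms(2))
    then have "?y = (?y \<bullet> w) *\<^sub>R w" by (rule line)
    moreover have "(B *v v) \<bullet> w = 0" using orth_inner[OF assms(1), of v w] Bw v by simp
    ultimately show "B *v v = - v" using v by (simp add: inner_add_left add_eq_0_iff)
  qed
qed

text \<open>The nonzero fixed \<open>u\<close> rules out dimension 0, so there is a fixed vector off
  its line; the component orthogonal to \<open>u\<close> is again fixed.\<close>

lemma fixdim_not_one:
  fixes B :: "'n::finite emat"
  assumes "B *v u = u" "u \<noteq> 0" "fixdim B \<noteq> 1"
  obtains v where "norm v = 1" "v \<bullet> u = 0" "B *v v = v"
proof -
  let ?V = "{x. (B - mat 1) *v x = 0}"
  have V: "x \<in> ?V \<longleftrightarrow> B *v x = x" for x by (simp add: matrix_vector_mult_diff_rdistrib)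
  have "\<exists>x. B *v x = x \<and> x \<notin> span {u}"
  proof (rule ccontr)
    assume "\<not> ?thesis"
    then have "?V \<subseteq> span {u}" using V by blast
    moreover have "span {u} \<subseteq> ?V"
      unfolding span_singleton using assms(1)
      by (auto simp: matrix_vector_mult_diff_rdistrib matrix_vector_mult_scaleR)
    ultimately have "?V = span {u}" by blast
    then show False using assms(2,3) by (simp add: fixdim_def dim_span dim_singleton)
  qed
  then obtain x where x: "B *v x = x" "x \<notin> span {u}" by blast
  define y where "y = x - ((x \<bullet> u) / (u \<bullet> u)) *\<^sub>R u"
  have y0: "y \<noteq> 0"
  proof
    assume "y = 0"
    then have "x = ((x \<bullet> u) / (u \<bullet> u)) *\<^sub>R u" by (simp add: y_def)
    then show False using x(2) by (metis span_base span_scale singletonI)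
  qed
  show thesis
  proof (rule that[of "y /\<^sub>R norm y"])
    show "norm (y /\<^sub>R norm y) = 1" using y0 by simp
    show "(y /\<^sub>R norm y) \<bullet> u = 0" using assms(2) by (simp add: y_def inner_diff_left)
    show "B *v (y /\<^sub>R norm y) = y /\<^sub>R norm y"
      using x(1) assms(1) by (simp add: y_def matrix_vector_mult_scaleR matrix_vector_mult_diff_distrib)
  qed
qed

lemma involution_neg_vector:
  fixes B :: "'n::finite emat"
  assumes "B ** B = mat 1" "B \<noteq> mat 1"
  obtains v where "norm v = 1" "B *v v = - v"
proof -
  obtain x where x: "B *v x \<noteq> x" using assms(2) by (auto simp: matrix_eq)
  define y where "y = x - B *v x"
  have y0: "y \<noteq> 0" using x by (simp add: y_def)
  have By: "B *v y = - y"
    using assms(1) by (simp add: y_def matrix_vector_mult_diff_distrib matrix_vector_mul_assoc)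
  show thesis
    by (rule that[of "y /\<^sub>R norm y"]) (use y0 By in \<open>auto simp: matrix_vector_mult_scaleR\<close>)
qed

section \<open>Bieberbach groups with elementary abelian holonomy\<close>

locale bieberbach =
  fixes \<Gamma> :: "'n::finite emap set" and k :: nat
  assumes bieb: "bieberbach_group \<Gamma>"
    and hol: "holonomy_group \<Gamma> \<cong> product_group {..<k} (\<lambda>_. integer_mod_group 2)"
begin

abbreviation "\<Lambda> \<equiv> lattice_of \<Gamma>"
abbreviation "F \<equiv> rot ` \<Gamma>"

lemma sub: "subgroup \<Gamma> isometry_group" using bieb by (simp add: bieberbach_group_def)

lemma \<Gamma>_cases:
  assumes "\<gamma> \<in> \<Gamma>" obtains B b where "\<gamma> = BL B b" "orthogonal_matrix B" "rot \<gamma> = B"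
  using subgroup.subset[OF sub] assms by (force simp: isometry_group_def rot_BL)

lemma rot_orth: "B \<in> F \<Longrightarrow> orthogonal_matrix B"
  by (auto elim!: \<Gamma>_cases)

lemma id_mem: "id \<in> \<Gamma>" using subgroup.one_closed[OF sub] by (simp add: isometry_group_def)

lemma comp_mem: "\<gamma> \<in> \<Gamma> \<Longrightarrow> \<eta> \<in> \<Gamma> \<Longrightarrow> \<gamma> \<circ> \<eta> \<in> \<Gamma>"
  using subgroup.m_closed[OF sub] by (simp add: isometry_group_def)

lemma inv_mem:
  assumes "\<gamma> \<in> \<Gamma>" obtains \<eta> where "\<eta> \<in> \<Gamma>" "\<gamma> \<circ> \<eta> = id" "\<eta> \<circ> \<gamma> = id"
proof -
  interpret group "isometry_group :: 'n emap monoid" by (rule group_isometry_group)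
  have c: "\<gamma> \<in> carrier isometry_group" using subgroup.subset[OF sub] assms by blast
  show thesis
    by (rule that[OF subgroup.m_inv_closed[OF sub assms]])
      (use r_inv[OF c] l_inv[OF c] in \<open>auto simp: isometry_group_def\<close>)
qed

lemma rot_comp: "\<gamma> \<in> \<Gamma> \<Longrightarrow> \<eta> \<in> \<Gamma> \<Longrightarrow> rot (\<gamma> \<circ> \<eta>) = rot \<gamma> ** rot \<eta>"
  by (elim \<Gamma>_cases) (simp add: BL_comp rot_BL orthogonal_matrix_mul)

lemma rot_id: "rot (id :: 'n emap) = mat 1"
  using rot_BL[OF orth_one, of 0] by (simp add: BL_id)

lemma rot_transl: "rot (transl v :: 'n emap) = mat 1"
  by (rule rot_BL[OF orth_one])

lemma one_F: "mat 1 \<in> F" using id_mem rot_id by (metis imageI)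

lemma mult_F: "B \<in> F \<Longrightarrow> C \<in> F \<Longrightarrow> B ** C \<in> F"
  by (metis (no_types, lifting) comp_mem image_iff rot_comp)

lemma latticeD: "v \<in> \<Lambda> \<Longrightarrow> transl v \<in> \<Gamma>" by (simp add: lattice_of_def)

lemma transl_comp: "(transl v :: 'n emap) \<circ> transl w = transl (v + w)"
  by (auto simp: BL_def fun_eq_iff)

text \<open>The translations are the slice of the discrete set at rotation part
  \<open>mat 1\<close>, so a neighbourhood isolating the identity isolates 0 in the lattice.\<close>

lemma lattice_discrete: "discrete_subgroup \<Lambda>"
proof
  show "0 \<in> \<Lambda>" by (simp add: lattice_of_def BL_id id_mem)
  fix x y assume xy: "x \<in> \<Lambda>" "y \<in> \<Lambda>"
  obtain \<eta> where \<eta>: "\<eta> \<in> \<Gamma>" "transl y \<circ> \<eta> = id" using inv_mem[OF latticeD[OF xy(2)]] by metis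
  have "\<eta> z = z - y" for z
    using fun_cong[OF \<eta>(2), of z] by (simp add: BL_def algebra_simps)
  then have "\<eta> = transl (- y)" by (auto simp: BL_def)
  then show "x - y \<in> \<Lambda>"
    using comp_mem[OF latticeD[OF xy(1)] \<eta>(1)] by (simp add: lattice_of_def transl_comp)
next
  let ?S = "{(B, b). orthogonal_matrix B \<and> BL B b \<in> \<Gamma>}"
  have "(mat 1, 0) \<in> ?S" using orth_one id_mem by (simp add: BL_id)
  moreover have "discrete ?S" using bieb by (simp add: bieberbach_group_def)
  ultimately have "(mat 1, 0) isolated_in ?S" by (simp add: discreteD)
  then obtain e where e: "e > 0" "\<forall>y\<in>?S. dist (mat 1, 0) y < e \<longrightarrow> y = (mat 1, 0)"
    by (auto simp: isolated_in_dist_Ex_iff)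
  have "x = 0" if "x \<in> \<Lambda>" "norm x < e" for x
    using e(2)[rule_format, of "(mat 1, x)"] that orth_one by (simp add: lattice_of_def dist_Pair_Pair)
  with e(1) show "\<exists>e>0. \<forall>x\<in>\<Lambda>. norm x < e \<longrightarrow> x = 0" by blast
qed

sublocale lattice: discrete_subgroup \<Lambda> by (rule lattice_discrete)

text \<open>Conjugating \<open>transl v\<close> by a lift of \<open>B\<close> gives the translation
  by \<open>B v\<close>.\<close>

lemma F_lattice:
  assumes "B \<in> F" "v \<in> \<Lambda>" shows "B *v v \<in> \<Lambda>"
proof -
  obtain \<gamma> where \<gamma>: "\<gamma> \<in> \<Gamma>" "B = rot \<gamma>" using assms(1) by auto
  obtain b where b: "\<gamma> = BL B b" using \<gamma> by (auto elim: \<Gamma>_cases)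
  obtain \<eta> where \<eta>: "\<eta> \<in> \<Gamma>" "\<gamma> \<circ> \<eta> = id" using inv_mem[OF \<gamma>(1)] by metis
  have "(\<gamma> \<circ> transl v \<circ> \<eta>) x = transl (B *v v) x" for x
  proof -
    have "(\<gamma> \<circ> transl v \<circ> \<eta>) x = (\<gamma> \<circ> \<eta>) x + B *v v"
      by (simp add: b BL_def matrix_vector_right_distrib)
    then show ?thesis by (simp add: \<eta>(2)) (simp add: BL_def)
  qed
  then have "\<gamma> \<circ> transl v \<circ> \<eta> = transl (B *v v)" by blast
  then show ?thesis
    using comp_mem[OF comp_mem[OF \<gamma>(1) latticeD[OF assms(2)]] \<eta>(1)] by (simp add: lattice_of_def)
qed

lemma same_rot:
  assumes "\<gamma> \<in> \<Gamma>" "\<eta> \<in> \<Gamma>" "rot \<gamma> = rot \<eta>"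
  obtains v where "v \<in> \<Lambda>" "\<eta> = \<gamma> \<circ> transl v"
proof -
  obtain B b c where bc: "\<gamma> = BL B b" "\<eta> = BL B c" "orthogonal_matrix B"
    using assms by (metis \<Gamma>_cases)
  obtain \<xi> where \<xi>: "\<xi> \<in> \<Gamma>" "\<xi> \<circ> \<gamma> = id" using inv_mem[OF assms(1)] by metis
  have eq: "\<eta> = \<gamma> \<circ> transl (c - b)" using bc by (auto simp: BL_def)
  then have "\<xi> \<circ> \<eta> = (\<xi> \<circ> \<gamma>) \<circ> transl (c - b)" by (simp add: comp_assoc)
  then have "\<xi> \<circ> \<eta> = transl (c - b)" by (simp only: \<xi>(2) id_comp)
  then have "c - b \<in> \<Lambda>" using comp_mem[OF \<xi>(1) assms(2)] by (simp add: lattice_of_def)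
  with eq show thesis using that by blast
qed

lemma F_facts: "finite F" "card F = 2 ^ k" "B \<in> F \<Longrightarrow> B ** B = mat 1"
proof -
  let ?P = "product_group {..<k} (\<lambda>_. integer_mod_group 2)"
  obtain h where h: "h \<in> iso (holonomy_group \<Gamma>) ?P" using hol by (auto simp: is_iso_def)
  have bij: "bij_betw h F (carrier ?P)"
    and hom: "\<And>B C. B \<in> F \<Longrightarrow> C \<in> F \<Longrightarrow> h (B ** C) = h B \<otimes>\<^bsub>?P\<^esub> h C"
    using h by (auto simp: iso_def hom_def holonomy_group_def)
  have P: "carrier ?P = ({..<k} \<rightarrow>\<^sub>E {0, 1})"
    by (auto simp: carrier_integer_mod_group PiE_def Pi_def)
  then have "finite (carrier ?P)" "card (carrier ?P) = 2 ^ k"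
    by (simp_all add: finite_PiE card_PiE numeral_2_eq_2)
  then show "finite F" "card F = 2 ^ k"
    using bij bij_betw_finite bij_betw_same_card by metis+
  have sq: "h (B ** B) = (\<lambda>i\<in>{..<k}. 0)" if "B \<in> F" for B
  proof -
    have "h B \<in> {..<k} \<rightarrow>\<^sub>E {0, 1}" using bij that P by (auto simp: bij_betw_def)
    then have "(h B i + h B i) mod 2 = 0" for i by simp
    then show ?thesis unfolding hom[OF that that] by (auto simp: product_group_def restrict_def)
  qed
  \<comment> \<open>\<open>mat 1\<close> is its own square, so the formula for squares also
    identifies the image of the unit.\<close>
  have "h (mat 1) = (\<lambda>i\<in>{..<k}. 0)" using sq[OF one_F] by simp
  then show "B ** B = mat 1" if "B \<in> F"
    using sq[OF that] bij mult_F[OF that that] one_F by (metis bij_betw_def inj_onD)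
qed

lemma F_commute:
  assumes "B \<in> F" "C \<in> F" shows "B ** C = C ** B"
proof -
  have "B ** C = B ** ((B ** C) ** (B ** C)) ** C"
    by (simp add: F_facts(3)[OF mult_F[OF assms]])
  also have "\<dots> = (B ** B) ** (C ** B) ** (C ** C)" by (simp add: matrix_mul_assoc)
  also have "\<dots> = C ** B" by (simp add: F_facts(3) assms)
  finally show ?thesis .
qed

text \<open>The images of the balls about 0 form an open cover of the compact orbit space; a finite
  subcover involves finitely many radii, and the largest serves as \<open>R\<close>.\<close>

lemma orbit_ball_cover: "\<exists>R. \<forall>x. \<exists>\<gamma>\<in>\<Gamma>. \<exists>y. norm y < R \<and> x = \<gamma> y"
proof -
  have self: "x \<in> orbit \<Gamma> x" for x unfolding orbit_def by (intro CollectI exI[of _ id]) (simp add: id_mem)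
  have mem: "orbit \<Gamma> x = orbit \<Gamma> y" if xy: "x \<in> orbit \<Gamma> y" for x y
  proof -
    obtain \<gamma> where \<gamma>: "\<gamma> \<in> \<Gamma>" "x = \<gamma> y" using xy by (auto simp: orbit_def)
    obtain \<eta> where \<eta>: "\<eta> \<in> \<Gamma>" "\<eta> \<circ> \<gamma> = id" using inv_mem[OF \<gamma>(1)] by metis
    have "\<eta> x = y" using fun_cong[OF \<eta>(2), of y] by (simp add: \<gamma>(2))
    show ?thesis
    proof (intro subset_antisym subsetI)
      fix z assume "z \<in> orbit \<Gamma> x"
      then obtain \<xi> where "\<xi> \<in> \<Gamma>" "z = (\<xi> \<circ> \<gamma>) y" by (auto simp: orbit_def \<gamma>(2))
      then show "z \<in> orbit \<Gamma> y" using comp_mem \<gamma>(1) unfolding orbit_def by blast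
    next
      fix z assume "z \<in> orbit \<Gamma> y"
      then obtain \<xi> where "\<xi> \<in> \<Gamma>" "z = (\<xi> \<circ> \<eta>) x" by (auto simp: orbit_def \<open>\<eta> x = y\<close>)
      then show "z \<in> orbit \<Gamma> x" using comp_mem \<eta>(1) unfolding orbit_def by blast
    qed
  qed
  define U where "U m = orbit \<Gamma> ` ball 0 (real m)" for m :: nat
  have cont: "continuous_on UNIV \<gamma>" if "\<gamma> \<in> \<Gamma>" for \<gamma>
    using that by (elim \<Gamma>_cases)
      (auto simp: BL_def intro!: continuous_on_compose2[OF matrix_vector_mult_linear_continuous_on]
        continuous_intros)
  have "openin (orbit_space \<Gamma>) (U m)" for m
  proof -
    have "orbit \<Gamma> -` U m = (\<Union>\<gamma>\<in>\<Gamma>. \<gamma> -` ball 0 (real m))"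
    proof (intro subset_antisym subsetI)
      fix x assume "x \<in> orbit \<Gamma> -` U m"
      then obtain y where "norm y < real m" "orbit \<Gamma> x = orbit \<Gamma> y" by (auto simp: U_def)
      then have "y \<in> orbit \<Gamma> x" using self by blast
      then show "x \<in> (\<Union>\<gamma>\<in>\<Gamma>. \<gamma> -` ball 0 (real m))" using \<open>norm y < real m\<close> by (auto simp: orbit_def)
    next
      fix x assume "x \<in> (\<Union>\<gamma>\<in>\<Gamma>. \<gamma> -` ball 0 (real m))"
      then obtain \<gamma> where "\<gamma> \<in> \<Gamma>" "norm (\<gamma> x) < real m" by auto
      moreover from this have "orbit \<Gamma> (\<gamma> x) = orbit \<Gamma> x" by (intro mem) (auto simp: orbit_def)
      ultimately show "x \<in> orbit \<Gamma> -` U m" unfolding U_def vimage_eq by (metis image_eqI mem_ball_0)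
    qed
    moreover have "open (\<Union>\<gamma>\<in>\<Gamma>. \<gamma> -` ball 0 (real m))"
      by (intro open_UN ballI open_vimage cont) auto
    ultimately show ?thesis by (auto simp: openin_orbit_space U_def)
  qed
  moreover have "topspace (orbit_space \<Gamma>) \<subseteq> \<Union> (range U)"
  proof
    fix X assume "X \<in> topspace (orbit_space \<Gamma>)"
    then obtain x where x: "X = orbit \<Gamma> x" by (force simp: topspace_def openin_orbit_space)
    obtain m where "norm x < real m" using reals_Archimedean2 by blast
    then have "X \<in> U m" unfolding x U_def by (intro imageI) simp
    then show "X \<in> \<Union> (range U)" by blast
  qed
  moreover have "compact_space (orbit_space \<Gamma>)" using bieb by (simp add: bieberbach_group_def)
  ultimately obtain \<F> where \<F>: "finite \<F>" "\<F> \<subseteq> range U" "topspace (orbit_space \<Gamma>) \<subseteq> \<Union> \<F>"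
    unfolding compact_space_alt by (metis (no_types, lifting) imageE)
  obtain M where M: "finite M" "\<F> = U ` M" using \<F>(1,2) by (meson finite_subset_image)
  define R where "R = real (Max (insert 0 M))"
  have "\<exists>\<gamma>\<in>\<Gamma>. \<exists>y. norm y < R \<and> x = \<gamma> y" for x
  proof -
    have "orbit \<Gamma> -` range (orbit \<Gamma>) = UNIV" by auto
    then have "openin (orbit_space \<Gamma>) (range (orbit \<Gamma>))" by (simp add: openin_orbit_space)
    then have "orbit \<Gamma> x \<in> topspace (orbit_space \<Gamma>)" using openin_subset by blast
    then obtain m where m: "m \<in> M" "orbit \<Gamma> x \<in> U m" using \<F>(3) M by auto
    then obtain y where y: "norm y < real m" "orbit \<Gamma> x = orbit \<Gamma> y" by (auto simp: U_def)
    have "real m \<le> R" using m M(1) by (simp add: R_def)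
    moreover have "x \<in> orbit \<Gamma> y" using self y by blast
    then obtain \<gamma> where "\<gamma> \<in> \<Gamma>" "x = \<gamma> y" by (auto simp: orbit_def)
    ultimately show ?thesis using y(1) by (intro bexI[of _ \<gamma>] exI[of _ y]) auto
  qed
  then show ?thesis by blast
qed

text \<open>Suppose \<open>a\<close> is orthogonal to the lattice. Each point \<open>t a\<close> is
  the image of a bounded point under some lift \<open>g B\<close> composed with a lattice
  translation. The lattice part is invisible to \<open>a\<close>, and only finitely many
  \<open>g B\<close> occur, so the inner product with \<open>a\<close> is bounded in
  \<open>t\<close>, which is absurd.\<close>

lemma lattice_spans: "span \<Lambda> = UNIV"
proof (rule ccontr)
  assume "span \<Lambda> \<noteq> UNIV"
  then obtain a where a: "a \<noteq> 0" "\<And>x. x \<in> span \<Lambda> \<Longrightarrow> a \<bullet> x = 0"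
    using span_not_UNIV_orthogonal[of \<Lambda>] by blast
  obtain R where R: "\<And>x. \<exists>\<gamma>\<in>\<Gamma>. \<exists>y. norm y < R \<and> x = \<gamma> y" using orbit_ball_cover by metis
  define g where "g B = (SOME \<gamma>. \<gamma> \<in> \<Gamma> \<and> rot \<gamma> = B)" for B
  have g: "g B \<in> \<Gamma> \<and> rot (g B) = B" if "B \<in> F" for B
    using that someI_ex[of "\<lambda>\<gamma>. \<gamma> \<in> \<Gamma> \<and> rot \<gamma> = B"] unfolding g_def by auto
  define T where "T = (\<Sum>B\<in>F. norm (g B 0))"
  have "norm (t *\<^sub>R a) * norm a \<le> (R + T) * norm a" for t
  proof -
    obtain \<gamma> y where \<gamma>: "\<gamma> \<in> \<Gamma>" "norm y < R" "t *\<^sub>R a = \<gamma> y" using R by blast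
    let ?B = "rot \<gamma>"
    have B: "?B \<in> F" using \<gamma> by auto
    obtain v where v: "v \<in> \<Lambda>" "\<gamma> = g ?B \<circ> transl v" using same_rot[of "g ?B" \<gamma>] g[OF B] \<gamma>(1) by metis
    obtain b where b: "g ?B = BL ?B b" using g[OF B] by (auto elim: \<Gamma>_cases)
    have "t *\<^sub>R a = ?B *v y + ?B *v v + g ?B 0"
      unfolding \<gamma>(3) by (subst v(2)) (simp add: b BL_def matrix_vector_right_distrib)
    then have "a \<bullet> (t *\<^sub>R a) = a \<bullet> (?B *v y) + a \<bullet> (?B *v v) + a \<bullet> g ?B 0" by (simp add: inner_add_right)
    moreover have "a \<bullet> (?B *v v) = 0" by (rule a(2)) (simp add: span_base F_lattice[OF B v(1)])
    moreover have "\<bar>a \<bullet> (?B *v y)\<bar> \<le> norm a * norm y"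
      using Cauchy_Schwarz_ineq2[of a "?B *v y"] orth_norm[OF rot_orth[OF B]] by simp
    moreover have "\<bar>a \<bullet> g ?B 0\<bar> \<le> norm a * T"
    proof -
      have "norm (g ?B 0) \<le> T" unfolding T_def using B F_facts(1)
        by (intro member_le_sum) auto
      then show ?thesis using Cauchy_Schwarz_ineq2[of a "g ?B 0"]
        by (meson mult_left_mono norm_ge_zero order_trans)
    qed
    moreover have "norm a * norm y \<le> norm a * R" using \<gamma>(2) by (simp add: mult_left_mono)
    ultimately have "\<bar>a \<bullet> (t *\<^sub>R a)\<bar> \<le> norm a * R + norm a * T" by linarith
    moreover have "\<bar>a \<bullet> (t *\<^sub>R a)\<bar> = norm (t *\<^sub>R a) * norm a"
      by (simp add: abs_mult power2_eq_square flip: power2_norm_eq_inner)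
    ultimately show ?thesis by (simp add: algebra_simps)
  qed
  from this[of "(\<bar>R + T\<bar> + 1) / norm a"] a(1) show False by simp
qed

lemma Z_basis_exists: "\<exists>f. Z_basis f \<Lambda>"
proof -
  obtain C where C: "finite C" "independent C" "C \<subseteq> \<Lambda>" "span C = span \<Lambda>"
    "\<And>x. x\<in>\<Lambda> \<Longrightarrow> \<exists>c::'n euc \<Rightarrow> int. x = (\<Sum>v\<in>C. of_int (c v) *\<^sub>R v)"
    using lattice.basis_exists by blast
  have "card C = dim (UNIV :: 'n euc set)"
    using dim_eq_card[of C UNIV] C lattice_spans by simp
  then show ?thesis using Z_basis_of_set[OF lattice_discrete C(1-3) _ C(5)] by (auto simp: dim_UNIV)
qed

end

section \<open>Fourier coefficients of lattice-periodic functions\<close>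

lemma bounded_bilinear_cscale: "bounded_bilinear ((*s) :: complex \<Rightarrow> complex^'d \<Rightarrow> complex^'d)"
  unfolding bilinear_conv_bounded_bilinear[symmetric] bilinear_def
  by (auto intro!: linearI simp: vec_eq_iff algebra_simps)

lemmas cscale_bounded_linear = bounded_bilinear.bounded_linear_right[OF bounded_bilinear_cscale]

lemma continuous_on_cscale [continuous_intros]:
  "continuous_on S a \<Longrightarrow> continuous_on S g \<Longrightarrow> continuous_on S (\<lambda>x. a x *s (g x :: complex^'d))"
  by (rule bounded_bilinear.continuous_on[OF bounded_bilinear_cscale])

lemma of_real_cscale: "complex_of_real r *s v = r *\<^sub>R v"
  by (simp add: vec_eq_iff) (simp add: scaleR_conv_of_real)

section \<open>Characters and means over a fundamental cell\<close>

definition ch :: "'a::real_inner \<Rightarrow> 'a \<Rightarrow> complex" where "ch u x = cis (2 * pi * (u \<bullet> x))"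

lemma ch_add_right: "ch u (x + y) = ch u x * ch u y"
  and ch_add_left: "ch (u + v) x = ch u x * ch v x"
  and ch_zero [simp]: "ch 0 x = 1" "ch u 0 = 1"
  by (simp_all add: ch_def cis_mult inner_add_right inner_add_left distrib_left)

lemma ch_minus_mult [simp]: "ch (- u) x * ch u x = 1" "ch u x * ch (- u) x = 1"
  by (simp_all flip: ch_add_left)

lemma ch_nonzero [simp]: "ch u x \<noteq> 0"
  by (simp add: ch_def)

lemma continuous_on_ch [continuous_intros]: "continuous_on S (ch u)"
  unfolding ch_def[abs_def] cis_conv_exp by (intro continuous_intros)

lemma cis_eq_1_iff: "cis (2 * pi * r) = 1 \<longleftrightarrow> r \<in> \<int>"
proof
  assume "cis (2 * pi * r) = 1"
  then have "cos (2 * pi * r) = 1" by (metis Re_complex_of_real cis.simps(1) of_real_1)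
  then obtain n :: int where "2 * pi * r = of_int n * 2 * pi" using cos_one_2pi_int by blast
  then show "r \<in> \<int>" by simp
next
  assume "r \<in> \<int>"
  then obtain n :: int where "r = of_int n" by (auto elim: Ints_cases)
  then show "cis (2 * pi * r) = 1" by (simp add: cis_multiple_2pi[of n] Ints_def)
qed

lemma ch_eq_1_iff: "ch u x = 1 \<longleftrightarrow> u \<bullet> x \<in> \<int>"
  by (simp add: ch_def cis_eq_1_iff)

locale lattice_cell =
  fixes f :: "'n::finite \<Rightarrow> 'n euc"
  assumes inj_f: "inj f" and span_f: "span (range f) = UNIV"
begin

definition T :: "'n euc \<Rightarrow> 'n euc" where "T y = (\<Sum>i\<in>UNIV. y $ i *\<^sub>R f i)"

lemma linear_T: "linear T"
  by (rule linearI) (simp_all add: T_def scaleR_add_left sum.distrib scaleR_sum_right)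

lemma T_axis: "T (axis i 1) = f i"
proof -
  have "T (axis i 1) = (\<Sum>j\<in>UNIV. if j = i then f j else 0)"
    unfolding T_def by (intro sum.cong) (auto simp: axis_def)
  then show ?thesis by simp
qed

lemma surj_T: "surj T"
proof -
  have "range f \<subseteq> range T" using T_axis by (metis image_subsetI rangeI)
  then have "span (range f) \<subseteq> range T"
    by (rule span_minimal) (simp add: linear_T subspace_UNIV linear_subspace_image)
  then show ?thesis using span_f by blast
qed

lemma bij_T: "bij T"
  using linear_surjective_imp_injective[OF linear_T surj_T] surj_T by (simp add: bij_def)

definition dual :: "'n \<Rightarrow> 'n euc" where
  "dual i = adjoint (inv_into UNIV T) (axis i 1)"

lemma dual_T: "dual i \<bullet> T y = y $ i"
proof -
  have "linear (inv_into UNIV T)"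
    by (metis bij_T bij_def linear_T linear_injective_left_inverse o_inv_distrib linear_inj_imp_surj inj_linear_imp_inv_linear)
  then have "T y \<bullet> dual i = inv_into UNIV T (T y) \<bullet> axis i 1"
    unfolding dual_def by (rule adjoint_works)
  then show ?thesis using bij_T by (simp add: bij_def inner_commute inner_axis)
qed

lemma dual_f: "dual i \<bullet> f j = (if i = j then 1 else 0)"
proof -
  have "dual i \<bullet> f j = axis j 1 $ i" using dual_T[of i "axis j 1"] by (simp only: T_axis)
  then show ?thesis by (simp add: axis_def)
qed

definition periodic :: "('n euc \<Rightarrow> 'b) \<Rightarrow> bool" where
  "periodic g \<longleftrightarrow> (\<forall>i x. g (x + f i) = g x)"

text \<open>The mean over a fundamental cell; pulling back along \<open>T\<close> replaces the cell
  by the unit cube, so no volume factor appears.\<close>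

definition M :: "('n euc \<Rightarrow> 'b::euclidean_space) \<Rightarrow> 'b" where
  "M g = integral (cbox 0 1) (\<lambda>y. g (T y))"

lemma periodicD: "periodic g \<Longrightarrow> g (x + f i) = g x" by (simp add: periodic_def)

lemma periodic_int:
  assumes "periodic g" shows "g (x + of_int z *\<^sub>R f i) = g x"
proof -
  have n: "g (x + of_nat n *\<^sub>R f i) = g x" for n x
  proof (induction n)
    case (Suc n)
    have "g (x + of_nat (Suc n) *\<^sub>R f i) = g ((x + of_nat n *\<^sub>R f i) + f i)"
      by (simp add: algebra_simps)
    then show ?case using periodicD[OF assms] Suc by simp
  qed simp
  show ?thesis
  proof (cases "z \<ge> 0")
    case True then show ?thesis using n[of x "nat z"] by simp
  next
    case False then show ?thesis using n[of "x + of_int z *\<^sub>R f i" "nat (- z)"] by simp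
  qed
qed

lemma periodic_int_sum:
  assumes "periodic g" shows "g (x + (\<Sum>i\<in>UNIV. of_int (z i) *\<^sub>R f i)) = g x"
proof -
  have "g (x + (\<Sum>i\<in>I. of_int (z i) *\<^sub>R f i)) = g x" if "finite I" for I
    using that
  proof (induction I arbitrary: x rule: finite_induct)
    case (insert i I)
    then show ?case
      using periodic_int[OF assms, of "x + (\<Sum>i\<in>I. of_int (z i) *\<^sub>R f i)" "z i" i]
      by (simp add: algebra_simps)
  qed simp
  then show ?thesis by simp
qed

lemma continuous_on_T: "continuous_on S T"
  using linear_T by (simp add: linear_continuous_on linear_conv_bounded_linear)

lemma continuous_compose_T: "continuous_on UNIV g \<Longrightarrow> continuous_on S (\<lambda>y. g (T y))"
  by (rule continuous_on_compose2[OF _ continuous_on_T]) auto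

lemma integrable_T:
  fixes g :: "'n euc \<Rightarrow> 'b::euclidean_space"
  shows "continuous_on UNIV g \<Longrightarrow> (\<lambda>y. g (T y)) integrable_on cbox a b"
  by (intro integrable_continuous continuous_compose_T)

lemma M_add: "continuous_on UNIV g \<Longrightarrow> continuous_on UNIV h \<Longrightarrow> M (\<lambda>x. g x + h x) = M g + M h"
  unfolding M_def by (intro integral_add integrable_T)

lemma M_bounded_linear:
  "bounded_linear A \<Longrightarrow> continuous_on UNIV g \<Longrightarrow> M (\<lambda>x. A (g x)) = A (M g)"
  unfolding M_def by (rule integral_linear[OF integrable_T, unfolded o_def])

lemma M_sum: "finite I \<Longrightarrow> (\<And>i. i \<in> I \<Longrightarrow> continuous_on UNIV (g i)) \<Longrightarrow>
    M (\<lambda>x. \<Sum>i\<in>I. g i x) = (\<Sum>i\<in>I. M (g i))"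
  unfolding M_def by (intro integral_sum integrable_T)

lemma M_const: "M (\<lambda>x. c) = c"
proof -
  have "measure lborel (cbox 0 (1 :: 'n euc)) = 1"
    by (subst content_cbox_cart) (auto simp: interval_ne_empty_cart)
  then show ?thesis by (simp add: M_def)
qed

text \<open>The part of the shifted cube beyond the face where coordinate \<open>i\<close> is 1 is
  moved back by one period and refills the unit cube.\<close>

lemma M_shift_unit:
  fixes g :: "'n euc \<Rightarrow> 'b::euclidean_space"
  assumes g: "continuous_on UNIV g" "periodic g" and s: "0 \<le> s" "s \<le> 1"
  shows "M (\<lambda>x. g (x + s *\<^sub>R f i)) = M g"
proof -
  let ?e = "axis i 1 :: 'n euc"
  define G where "G y = g (T y)" for y
  have G: "G integrable_on cbox a b" for a b unfolding G_def by (rule integrable_T[OF g(1)])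
  have Gs: "g (T y + s *\<^sub>R f i) = G (y + s *\<^sub>R ?e)" for y s
    by (simp add: G_def linear_add[OF linear_T] linear_scale[OF linear_T] T_axis)
  have Gp: "G (y + ?e) = G y" for y
    using periodicD[OF g(2), of "T y" i] by (simp add: G_def linear_add[OF linear_T] T_axis)
  have shift: "integral (cbox a b) (\<lambda>x. G (x + w)) = integral (cbox (a + w) (b + w)) G" for a b w
    using integral_shift_cbox_plus[of a b G w] by (simp add: o_def add.commute)
  have ax: "c * (if P then 1 else 0) = (if P then c else 0)" "axis i 1 $ j = (if j = i then 1 else 0 :: real)"
    for c :: real and j P by (auto simp: axis_def)
  let ?P = "cbox 0 (1 + (s - 1) *\<^sub>R ?e)" and ?Q = "cbox (s *\<^sub>R ?e) 1"
  have e: "?e \<in> Basis" by (auto simp: Basis_vec_def)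
  have "M (\<lambda>x. g (x + s *\<^sub>R f i)) = integral (cbox (s *\<^sub>R ?e) (1 + s *\<^sub>R ?e)) G"
    unfolding M_def Gs using shift[of 0 1 "s *\<^sub>R ?e"] by simp
  also have "\<dots> = integral (cbox (s *\<^sub>R ?e) (1 + s *\<^sub>R ?e) \<inter> {x. x \<bullet> ?e \<le> 1}) G
      + integral (cbox (s *\<^sub>R ?e) (1 + s *\<^sub>R ?e) \<inter> {x. 1 \<le> x \<bullet> ?e}) G"
    by (rule integral_split[OF G e])
  also have "cbox (s *\<^sub>R ?e) (1 + s *\<^sub>R ?e) \<inter> {x. x \<bullet> ?e \<le> 1} = ?Q"
    using s by (auto simp: mem_box_cart inner_axis ax) (smt (verit))+
  also have "cbox (s *\<^sub>R ?e) (1 + s *\<^sub>R ?e) \<inter> {x. 1 \<le> x \<bullet> ?e} = cbox (0 + ?e) (1 + (s - 1) *\<^sub>R ?e + ?e)"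
    using s by (auto simp: mem_box_cart inner_axis ax) (smt (verit))+
  also have "integral (cbox (0 + ?e) (1 + (s - 1) *\<^sub>R ?e + ?e)) G = integral ?P G"
    using shift[of 0 "1 + (s - 1) *\<^sub>R ?e" ?e] by (simp add: Gp)
  also have "integral ?Q G + integral ?P G = integral ?P G + integral ?Q G" by simp
  also have "?P = cbox 0 1 \<inter> {x. x \<bullet> ?e \<le> s}"
    using s by (auto simp: mem_box_cart inner_axis ax) (smt (verit))+
  also have "?Q = cbox 0 1 \<inter> {x. s \<le> x \<bullet> ?e}"
    using s by (auto simp: mem_box_cart inner_axis ax) (smt (verit))+
  also have "integral (cbox 0 1 \<inter> {x. x \<bullet> ?e \<le> s}) G + integral (cbox 0 1 \<inter> {x. s \<le> x \<bullet> ?e}) G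
      = integral (cbox 0 1) G"
    by (rule integral_split[OF G e, symmetric])
  finally show ?thesis by (simp add: M_def G_def[abs_def])
qed

lemma periodic_shift: "periodic g \<Longrightarrow> periodic (\<lambda>x. g (x + w))"
  by (auto simp: periodic_def) (metis add.assoc add.commute)

lemma continuous_shift: "continuous_on UNIV g \<Longrightarrow> continuous_on UNIV (\<lambda>x. g (x + w :: 'n euc))"
  by (rule continuous_on_compose2[of UNIV g]) (auto intro: continuous_intros)

text \<open>Periodicity absorbs the integer part of a shift along one \<open>f i\<close>, and a
  general shift is built up coordinate by coordinate.\<close>

lemma M_shift:
  fixes g :: "'n euc \<Rightarrow> 'b::euclidean_space"
  assumes g: "continuous_on UNIV g" "periodic g"
  shows "M (\<lambda>x. g (x + w)) = M g"
proof -
  have 1: "M (\<lambda>x. g (x + s *\<^sub>R f i)) = M g" if g: "continuous_on UNIV g" "periodic g"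
    for s i and g :: "'n euc \<Rightarrow> 'b"
  proof -
    have "g (x + s *\<^sub>R f i) = g (x + frac s *\<^sub>R f i)" for x
      using periodic_int[OF g(2), of "x + frac s *\<^sub>R f i" "\<lfloor>s\<rfloor>" i]
      by (simp add: frac_def algebra_simps)
    then show ?thesis using M_shift_unit[OF g, of "frac s" i] by (simp add: frac_lt_1 less_imp_le)
  qed
  obtain z where z: "w = T z" using surj_T by (metis surjD)
  have "M (\<lambda>x. g (x + (\<Sum>i\<in>I. z $ i *\<^sub>R f i))) = M g" if "finite I" for I
    using that
  proof (induction I rule: finite_induct)
    case (insert i I)
    have "M (\<lambda>x. g (x + (\<Sum>i\<in>insert i I. z $ i *\<^sub>R f i)))
       = M (\<lambda>x. g (x + z $ i *\<^sub>R f i + (\<Sum>i\<in>I. z $ i *\<^sub>R f i)))"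
      using insert by (simp add: add.assoc)
    also have "\<dots> = M (\<lambda>x. g (x + (\<Sum>i\<in>I. z $ i *\<^sub>R f i)))"
      by (rule 1[OF continuous_shift[OF g(1)] periodic_shift[OF g(2)]])
    finally show ?case using insert by simp
  qed simp
  then show ?thesis by (simp add: z T_def)
qed

text \<open>By translation invariance the mean of \<open>g\<close> shifted by \<open>s v\<close>
  does not depend on \<open>s\<close>; differentiating under the integral at 0 replaces integration
  by parts.\<close>

lemma M_derivative:
  fixes g :: "'n euc \<Rightarrow> 'b::euclidean_space"
  assumes diff: "\<And>x. g differentiable (at x)" and per: "periodic g"
    and cont: "continuous_on UNIV (\<lambda>x. frechet_derivative g (at x) v)"
  shows "M (\<lambda>x. frechet_derivative g (at x) v) = 0"
proof -
  let ?D = "\<lambda>x. frechet_derivative g (at x) v"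
  have gc: "continuous_on UNIV g"
    using diff by (simp add: continuous_on_eq_continuous_at differentiable_imp_continuous_within)
  have der: "((\<lambda>s. g (T y + s *\<^sub>R v)) has_vector_derivative ?D (T y + s *\<^sub>R v)) (at s within UNIV)" for s y
  proof -
    have 1: "((\<lambda>s. T y + s *\<^sub>R v) has_derivative (\<lambda>s. s *\<^sub>R v)) (at s within UNIV)"
      by (auto intro!: derivative_eq_intros)
    have 2: "(g has_derivative frechet_derivative g (at (T y + s *\<^sub>R v))) (at (T y + s *\<^sub>R v))"
      using diff frechet_derivative_works by blast
    have "linear (frechet_derivative g (at (T y + s *\<^sub>R v)))"
      using diff by (rule linear_frechet_derivative)
    then show ?thesis
      using has_derivative_compose[OF 1 2]
      by (simp add: has_vector_derivative_def linear_scale)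
  qed
  have "((\<lambda>s. integral (cbox 0 1) (\<lambda>y. g (T y + s *\<^sub>R v))) has_vector_derivative
      integral (cbox 0 1) (\<lambda>y. ?D (T y + 0 *\<^sub>R v))) (at 0 within UNIV)"
  proof (rule leibniz_rule_vector_derivative)
    show "(\<lambda>y. g (T y + s *\<^sub>R v)) integrable_on cbox 0 1" for s
      by (rule integrable_T[OF continuous_shift[OF gc]])
    show "continuous_on (UNIV \<times> cbox 0 1) (\<lambda>(s, y). ?D (T y + s *\<^sub>R v))"
      unfolding split_beta
      by (rule continuous_on_compose2[OF cont])
        (auto intro!: continuous_intros continuous_on_compose2[OF continuous_on_T])
  qed (use der in auto)
  moreover have "(\<lambda>s. integral (cbox 0 1) (\<lambda>y. g (T y + s *\<^sub>R v))) = (\<lambda>s. M g)"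
    using M_shift[OF gc per] by (auto simp: M_def)
  ultimately have "((\<lambda>s :: real. M g) has_vector_derivative M ?D) (at 0)"
    by (simp add: M_def)
  moreover have "((\<lambda>s :: real. M g) has_vector_derivative 0) (at 0)" by simp
  ultimately show ?thesis using vector_derivative_unique_at by blast
qed

section \<open>The dual lattice and completeness of its characters\<close>

definition dual_lattice :: "'n euc set" where "dual_lattice = {v. \<forall>i. v \<bullet> f i \<in> \<int>}"

lemma dual_mem: "dual i \<in> dual_lattice"
  by (auto simp: dual_lattice_def dual_f)

lemma dual_lattice_add: "u \<in> dual_lattice \<Longrightarrow> v \<in> dual_lattice \<Longrightarrow> u + v \<in> dual_lattice"
  and dual_lattice_neg: "u \<in> dual_lattice \<Longrightarrow> - u \<in> dual_lattice"
  by (auto simp: dual_lattice_def inner_add_left)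

lemma periodic_ch: "v \<in> dual_lattice \<Longrightarrow> periodic (ch v)"
  using ch_eq_1_iff by (auto simp: periodic_def dual_lattice_def ch_add_right)

text \<open>For nonzero \<open>v\<close> the shift by \<open>?z\<close>, where
  \<open>v \<bullet> ?z = 1/2\<close>, multiplies the character by -1 but preserves the
  mean.\<close>

lemma M_char:
  fixes w :: "complex^'d"
  assumes "v \<in> dual_lattice"
  shows "M (\<lambda>x. ch v x *s w) = (if v = 0 then w else 0)"
proof (cases "v = 0")
  case False
  let ?z = "(1 / (2 * (v \<bullet> v))) *\<^sub>R v"
  have per: "periodic (\<lambda>x. ch v x *s w)" using periodic_ch[OF assms] by (simp add: periodic_def)
  have cont: "continuous_on UNIV (\<lambda>x. ch v x *s w)" by (intro continuous_intros)
  have "ch v ?z = -1" using False by (simp add: ch_def)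
  then have "ch v (x + ?z) *s w = - (ch v x *s w)" for x
    by (simp add: ch_add_right vec_eq_iff)
  then have "M (\<lambda>x. ch v x *s w) = M (\<lambda>x. - (ch v x *s w))"
    using M_shift[OF cont per, of ?z] by (simp only:)
  also have "\<dots> = - M (\<lambda>x. ch v x *s w)" by (simp add: M_def)
  finally have "2 *\<^sub>R M (\<lambda>x. ch v x *s w) = 0" by (simp add: scaleR_2)
  then show ?thesis using False by simp
qed (simp add: M_const)

text \<open>The kernel \<open>K\<close> below is a trigonometric polynomial with values in \<open>[0, 1]\<close> that equals \<open>1\<close> only on
  the lattice translates of a point where \<open>h \<noteq> 0\<close>.  Orthogonality to all \<open>K\<^sup>N\<close> forces
  \<open>\<integral> K\<^sup>N = O(q\<^sup>N)\<close> for some \<open>q < 1\<close>, and by Bernoulli's inequality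
  \<open>N \<integral> max (K / q - 1) 0 \<le> \<integral> (K / q)\<^sup>N\<close>, so that \<open>K \<le> q\<close> everywhere.\<close>

lemma completeness:
  fixes h :: "'n euc \<Rightarrow> complex^'d"
  assumes h: "continuous_on UNIV h" "periodic h"
    and zero: "\<And>v. v \<in> dual_lattice \<Longrightarrow> M (\<lambda>x. ch v x *s h x) = 0"
  shows "h x = 0"
proof (rule ccontr)
  assume "h x \<noteq> 0"
  obtain y1 where y1: "x = T y1" using surj_T by (metis surjD)
  define y0 :: "'n euc" where "y0 = (\<chi> i. frac (y1 $ i))"
  have "T y1 = T y0 + (\<Sum>i\<in>UNIV. of_int \<lfloor>y1 $ i\<rfloor> *\<^sub>R f i)"
    by (simp add: T_def y0_def frac_def algebra_simps sum_subtractf)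
  then have hy0: "h (T y0) \<noteq> 0" using periodic_int_sum[OF h(2)] \<open>h x \<noteq> 0\<close> y1 by simp
  have y0: "y0 \<in> cbox 0 1"
    by (auto simp: y0_def mem_box_cart frac_lt_1 less_imp_le)
  \<comment> \<open>Each factor is a combination of three dual characters and reaches its maximum 1
    exactly where coordinate \<open>i\<close> differs from that of \<open>y0\<close> by an
    integer.\<close>
  define \<kappa> where "\<kappa> i x = (1 + cos (2 * pi * (dual i \<bullet> (x - T y0)))) / 2" for i x
  define K where "K x = (\<Prod>i\<in>UNIV. \<kappa> i x)" for x
  have \<kappa>_cont: "continuous_on S (\<kappa> i)" for i S unfolding \<kappa>_def by (intro continuous_intros) auto
  have K_cont: "continuous_on S K" for S unfolding K_def by (intro continuous_intros \<kappa>_cont)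
  have cos01: "0 \<le> (1 + cos t) / 2" "(1 + cos t) / 2 \<le> 1" for t :: real
    using cos_ge_minus_one[of t] cos_le_one[of t] by (simp_all only: field_simps)
  have \<kappa>01: "0 \<le> \<kappa> i x" "\<kappa> i x \<le> 1" for i x
    unfolding \<kappa>_def by (rule cos01)+
  have K01: "0 \<le> K x" "K x \<le> 1" for x
    unfolding K_def by (auto intro!: prod_nonneg prod_le_1 simp: \<kappa>01)
  have K0: "K (T y0) = 1" by (simp add: K_def \<kappa>_def)
  \<comment> \<open>The class of multipliers \<open>p\<close> whose product with every dual
    character integrates to zero against \<open>h\<close>. It is closed under sums and under dual
    characters, so the kernel and its powers can be built inside it.\<close>
  define good where "good p \<longleftrightarrow> continuous_on UNIV p \<and> (\<forall>v\<in>dual_lattice. M (\<lambda>x. (p x * ch v x) *s h x) = 0)"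
    for p :: "'n euc \<Rightarrow> complex"
  have good_ch: "good (\<lambda>x. c * ch w x * p x)" if "good p" "w \<in> dual_lattice" for c w p
  proof -
    have cp: "continuous_on UNIV p" using that(1) by (simp add: good_def)
    have "M (\<lambda>x. (c * ch w x * p x * ch v x) *s h x) = 0" if v: "v \<in> dual_lattice" for v
    proof -
      have "M (\<lambda>x. (c * ch w x * p x * ch v x) *s h x) = M (\<lambda>x. c *s ((p x * ch (w + v) x) *s h x))"
        by (simp add: ch_add_left mult_ac)
      also have "\<dots> = c *s M (\<lambda>x. (p x * ch (w + v) x) *s h x)"
        by (rule M_bounded_linear[OF cscale_bounded_linear]) (intro continuous_intros cp h(1))
      also have "\<dots> = 0" using \<open>good p\<close> dual_lattice_add[OF \<open>w \<in> dual_lattice\<close> v] by (simp add: good_def)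
      finally show ?thesis .
    qed
    then show ?thesis unfolding good_def by (auto intro!: continuous_intros cp)
  qed
  have good_add: "good (\<lambda>x. p x + q x)" if "good p" "good q" for p q
  proof -
    have c: "continuous_on UNIV p" "continuous_on UNIV q" using that by (auto simp: good_def)
    have "M (\<lambda>x. ((p x + q x) * ch v x) *s h x) = 0" if v: "v \<in> dual_lattice" for v
    proof -
      have "M (\<lambda>x. ((p x + q x) * ch v x) *s h x) = M (\<lambda>x. (p x * ch v x) *s h x + (q x * ch v x) *s h x)"
        by (simp add: distrib_right vector_sadd_rdistrib)
      also have "\<dots> = M (\<lambda>x. (p x * ch v x) *s h x) + M (\<lambda>x. (q x * ch v x) *s h x)"
        by (rule M_add) (intro continuous_intros c h(1))+
      finally show ?thesis using \<open>good p\<close> \<open>good q\<close> v by (simp add: good_def)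
    qed
    then show ?thesis unfolding good_def by (auto intro!: continuous_intros c)
  qed
  have good_\<kappa>: "good (\<lambda>x. of_real (\<kappa> i x) * p x)" if "good p" for i p
  proof -
    have "good (\<lambda>x. (1/2) * ch 0 x * p x + ((ch (dual i) (- T y0) / 4) * ch (dual i) x * p x
        + (ch (- dual i) (- T y0) / 4) * ch (- dual i) x * p x))"
      by (intro good_add good_ch that dual_mem dual_lattice_neg) (simp add: dual_lattice_def)
    moreover have "of_real (\<kappa> i x) * p x = (1/2) * ch 0 x * p x + ((ch (dual i) (- T y0) / 4) * ch (dual i) x * p x
        + (ch (- dual i) (- T y0) / 4) * ch (- dual i) x * p x)" for x
    proof -
      let ?t = "2 * pi * (dual i \<bullet> (x - T y0))"
      have "of_real (\<kappa> i x) = (1/2 + (cis ?t + cis (- ?t)) / 4 :: complex)"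
        by (simp add: \<kappa>_def complex_eq_iff)
      also have "cis ?t = ch (dual i) (- T y0) * ch (dual i) x"
        by (simp add: ch_def cis_mult inner_diff_right algebra_simps)
      also have "cis (- ?t) = ch (- dual i) (- T y0) * ch (- dual i) x"
        by (simp add: ch_def cis_mult inner_diff_right algebra_simps)
      finally show ?thesis by (simp add: algebra_simps)
    qed
    ultimately show ?thesis by simp
  qed
  have good_K: "good (\<lambda>x. of_real (K x) * p x)" if "good p" for p
  proof -
    have "good (\<lambda>x. of_real (\<Prod>i\<in>I. \<kappa> i x) * p x)" if "finite I" for I
      using that
    proof (induction I rule: finite_induct)
      case (insert i I)
      then show ?case using good_\<kappa>[OF insert.IH, of i] by (simp add: mult.assoc)
    qed (use \<open>good p\<close> in simp)
    then show ?thesis by (simp add: K_def)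
  qed
  have "good (\<lambda>x. 1)" using zero by (auto simp: good_def)
  have good_KN: "good (\<lambda>x. of_real (K x ^ N))" for N
  proof (induction N)
    case (Suc N)
    then show ?case using good_K[OF Suc] by simp
  qed (use \<open>good (\<lambda>x. 1)\<close> in simp)
  \<comment> \<open>The real inner product with a fixed value of \<open>h\<close> turns the
    vector-valued integrals into real ones; at \<open>y0\<close> it takes the value
    \<open>c > 0\<close>.\<close>
  define r where "r y = h (T y) \<bullet> h (T y0)" for y
  have r_cont: "continuous_on S r" for S unfolding r_def
    by (intro continuous_intros continuous_compose_T h(1))
  have int0: "integral (cbox 0 1) (\<lambda>y. K (T y) ^ N * r y) = 0" for N
  proof -
    have "M (\<lambda>x. (of_real (K x ^ N) * ch 0 x) *s h x) = 0"
    proof -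
      have "0 \<in> dual_lattice" by (simp add: dual_lattice_def)
      then show ?thesis using good_KN[of N] unfolding good_def by blast
    qed
    then have "M (\<lambda>x. K x ^ N *\<^sub>R h x) = 0" by (simp only: ch_zero mult_1_right of_real_cscale)
    then have "M (\<lambda>x. (K x ^ N *\<^sub>R h x) \<bullet> h (T y0)) = 0"
      by (subst M_bounded_linear[OF bounded_linear_inner_left])
        (auto intro!: continuous_intros K_cont h(1))
    then show ?thesis by (simp add: M_def r_def)
  qed
  define c where "c = (norm (h (T y0)))\<^sup>2"
  have c: "c > 0" using hy0 by (simp add: c_def)
  have KT: "continuous_on S (\<lambda>y. K (T y))" for S by (rule continuous_compose_T[OF K_cont])
  \<comment> \<open>Off \<open>A\<close> the function \<open>r\<close> exceeds \<open>c / 2\<close>;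
    on the compact set \<open>A\<close> the kernel stays below 1, which yields
    \<open>q\<close>.\<close>
  define A where "A = {y \<in> cbox 0 1. r y \<le> c / 2}"
  have A: "compact A"
  proof -
    have "closed {y. r y \<le> c / 2}" by (intro closed_Collect_le r_cont continuous_intros)
    then have "compact (cbox 0 1 \<inter> {y. r y \<le> c / 2})" by (rule compact_Int_closed[OF compact_cbox])
    then show ?thesis by (simp add: A_def Int_def)
  qed
  have KA: "K (T y) < 1" if "y \<in> A" for y
  proof (rule ccontr)
    assume "\<not> K (T y) < 1"
    then have K1: "K (T y) = 1" using K01[of "T y"] by linarith
    have "\<kappa> i (T y) = 1" for i
    proof -
      have "K (T y) = \<kappa> i (T y) * (\<Prod>j\<in>UNIV - {i}. \<kappa> j (T y))"
        unfolding K_def by (simp add: prod.remove)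
      also have "\<dots> \<le> \<kappa> i (T y) * 1"
        by (intro mult_left_mono prod_le_1) (auto simp: \<kappa>01)
      finally show ?thesis using K1 \<kappa>01(2)[of i "T y"] by simp
    qed
    then have "cos (2 * pi * (y $ i - y0 $ i)) = 1" for i
      by (simp add: \<kappa>_def inner_diff_right dual_T)
    then have "\<exists>n::int. 2 * pi * (y $ i - y0 $ i) = of_int n * 2 * pi" for i
      using cos_one_2pi_int by blast
    then have "\<exists>n::int. y $ i = y0 $ i + of_int n" for i
      by (metis (no_types, opaque_lifting) add.commute diff_add_cancel mult.assoc mult.commute mult_cancel_left mult_eq_0_iff pi_neq_zero zero_neq_numeral)
    then obtain n :: "'n \<Rightarrow> int" where "\<And>i. y $ i = y0 $ i + of_int (n i)" by metis
    then have "T y = T y0 + (\<Sum>i\<in>UNIV. of_int (n i) *\<^sub>R f i)"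
      by (simp add: T_def algebra_simps sum.distrib)
    then have "h (T y) = h (T y0)" using periodic_int_sum[OF h(2)] by simp
    then have "r y = c" by (simp add: r_def c_def power2_norm_eq_inner)
    then show False using that c by (simp add: A_def)
  qed
  \<comment> \<open>The lower bound 1/2 keeps \<open>q\<close> positive for the later divisions,
    also when \<open>A\<close> is empty.\<close>
  obtain q where q: "1/2 \<le> q" "q < 1" "\<And>y. y \<in> A \<Longrightarrow> K (T y) \<le> q"
  proof (cases "A = {}")
    case True then show thesis by (intro that[of "1/2"]) auto
  next
    case False
    then obtain y where "y \<in> A" "\<forall>y'\<in>A. K (T y') \<le> K (T y)"
      using continuous_attains_sup[OF A False KT] by blast
    then show thesis using KA by (intro that[of "max (1/2) (K (T y))"]) (auto simp: le_max_iff_disj)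
  qed
  obtain C where C: "\<And>y. y \<in> cbox 0 1 \<Longrightarrow> \<bar>r y\<bar> \<le> C" "C > 0"
  proof -
    have "bounded (r ` cbox 0 1)"
      by (intro compact_imp_bounded compact_continuous_image r_cont compact_cbox)
    then show thesis using that by (auto simp: bounded_pos)
  qed
  define J where "J = integral (cbox 0 1) (\<lambda>y. max (K (T y) / q - 1) 0)"
  have J_int: "(\<lambda>y. max (K (T y) / q - 1) 0) integrable_on cbox 0 1"
    using q(1) by (intro integrable_continuous continuous_intros KT) auto
  have KN_int: "(\<lambda>y. K (T y) ^ N) integrable_on cbox 0 1" for N
    by (intro integrable_continuous continuous_intros KT)
  have KNr_int: "(\<lambda>y. K (T y) ^ N * r y) integrable_on cbox 0 1" for N
    by (intro integrable_continuous continuous_intros KT r_cont)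
  have bound: "real N * J \<le> 2 * (C + c) / c" for N
  proof -
    \<comment> \<open>On \<open>A\<close> the right-hand side is at least \<open>- C q^N\<close>,
      off \<open>A\<close> it is at least \<open>c / 2\<close> times the kernel power; the constant
      \<open>C + c\<close> lets one inequality cover both cases.\<close>
    have pt: "(c / 2) * K (T y) ^ N - (C + c) * q ^ N \<le> K (T y) ^ N * r y" if y: "y \<in> cbox 0 1" for y
    proof (cases "y \<in> A")
      case True
      have KN: "0 \<le> K (T y) ^ N" "K (T y) ^ N \<le> q ^ N"
        using K01 q(3)[OF True] by (auto intro: power_mono)
      have "- (C * K (T y) ^ N) \<le> K (T y) ^ N * r y"
        using mult_left_mono[of "- C" "r y" "K (T y) ^ N"] C(1)[OF y] KN by (simp add: mult.commute)
      moreover have "C * K (T y) ^ N \<le> C * q ^ N" "(c/2) * K (T y) ^ N \<le> (c/2) * q ^ N"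
        using KN C(2) c by (auto intro: mult_left_mono)
      moreover have "0 \<le> c * q ^ N" using c q(1) by simp
      ultimately show ?thesis by (simp add: algebra_simps)
    next
      case False
      then have "c / 2 \<le> r y" using y by (simp add: A_def)
      then have "K (T y) ^ N * (c / 2) \<le> K (T y) ^ N * r y" using K01 by (intro mult_left_mono) auto
      moreover have "0 \<le> (C + c) * q ^ N" using c C q(1) by simp
      ultimately show ?thesis by (simp add: algebra_simps)
    qed
    have "integral (cbox 0 1) (\<lambda>y. (c / 2) * K (T y) ^ N - (C + c) * q ^ N)
        \<le> integral (cbox 0 1) (\<lambda>y. K (T y) ^ N * r y)"
      by (intro integral_le KNr_int pt integrable_continuous continuous_intros KT)
    moreover have "integral (cbox 0 1) (\<lambda>y. (c / 2) * K (T y) ^ N - (C + c) * q ^ N)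
        = (c / 2) * integral (cbox 0 1) (\<lambda>y. K (T y) ^ N) - (C + c) * q ^ N"
      using M_const[of "(C + c) * q ^ N"]
      by (subst integral_diff) (auto intro!: integrable_continuous continuous_intros KT simp: M_def)
    ultimately have 1: "(c / 2) * integral (cbox 0 1) (\<lambda>y. K (T y) ^ N) \<le> (C + c) * q ^ N"
      using int0[of N] by simp
    have "real N * max (K (T y) / q - 1) 0 \<le> K (T y) ^ N * (1 / q ^ N)" for y
    proof -
      have "- 1 \<le> K (T y) / q - 1" using K01[of "T y"] q(1) by simp
      from Bernoulli_inequality[OF this, of N] have "real N * (K (T y) / q - 1) \<le> (K (T y) / q) ^ N" by simp
      moreover have "0 \<le> (K (T y) / q) ^ N" using K01[of "T y"] q(1) by simp
      ultimately show ?thesis by (simp add: max_def power_divide)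
    qed
    then have "integral (cbox 0 1) (\<lambda>y. real N * max (K (T y) / q - 1) 0)
        \<le> integral (cbox 0 1) (\<lambda>y. K (T y) ^ N * (1 / q ^ N))"
      using q(1) by (intro integral_le integrable_continuous continuous_intros KT) auto
    then have "real N * J \<le> integral (cbox 0 1) (\<lambda>y. K (T y) ^ N) * (1 / q ^ N)"
      by (simp add: J_def)
    also have "\<dots> \<le> (2 * (C + c) / c * q ^ N) * (1 / q ^ N)"
      using 1 c q(1) by (intro mult_right_mono) (auto simp: field_simps)
    finally show ?thesis using q(1) by simp
  qed
  have "J \<le> 0"
  proof (rule ccontr)
    assume "\<not> J \<le> 0"
    then obtain N where "2 * (C + c) / c < real N * J"
      using reals_Archimedean3[of J] by (auto simp: not_le)
    with bound[of N] show False by simp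
  qed
  moreover have "0 \<le> J" unfolding J_def by (rule integral_nonneg[OF J_int]) simp
  ultimately have "integral (cbox 0 1) (\<lambda>y. max (K (T y) / q - 1) 0) = 0" by (simp add: J_def)
  moreover have "box 0 (1 :: 'n euc) \<noteq> {}" by (simp add: interval_ne_empty_cart)
  moreover have "continuous_on (cbox 0 1) (\<lambda>y. max (K (T y) / q - 1) 0)"
    using q(1) by (intro continuous_intros KT) auto
  ultimately have "\<forall>y\<in>cbox 0 1. max (K (T y) / q - 1) 0 = 0"
    by (subst (asm) integral_cbox_eq_0_iff) auto
  with y0 have "K (T y0) / q \<le> 1" by fastforce
  then show False using q K0 by (simp add: field_simps)
qed

end

section \<open>The dimension of a space with a frame\<close>

text \<open>The right-hand side is the trace of the identity of \<open>W\<close>, computed in a frame.\<close>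

lemma (in vector_space) dim_eq_frame_trace:
  assumes X: "finite X" and W: "subspace W" and b: "\<And>x. x \<in> X \<Longrightarrow> b x \<in> W"
    and add: "\<And>x v w. x \<in> X \<Longrightarrow> v \<in> W \<Longrightarrow> w \<in> W \<Longrightarrow> l x (v + w) = l x v + l x w"
    and scl: "\<And>x c v. x \<in> X \<Longrightarrow> v \<in> W \<Longrightarrow> l x (scale c v) = c * l x v"
    and expand: "\<And>w. w \<in> W \<Longrightarrow> w = (\<Sum>x\<in>X. scale (l x w) (b x))"
  shows "of_nat (dim W) = (\<Sum>x\<in>X. l x (b x))"
proof -
  obtain C where C: "C \<subseteq> W" "independent C" "W \<subseteq> span C"
    using maximal_independent_subset[of W] by blast
  have Wb: "W \<subseteq> span (b ` X)"
  proof
    fix w assume "w \<in> W"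
    then have "w = (\<Sum>x\<in>X. scale (l x w) (b x))" by (rule expand)
    also have "\<dots> \<in> span (b ` X)" by (intro span_sum span_scale span_base) auto
    finally show "w \<in> span (b ` X)" .
  qed
  have fC: "finite C"
    using independent_span_bound[OF finite_imageI[OF X, of b] C(2)] C(1) Wb by blast
  have card: "dim W = card C" using basis_card_eq_dim[OF C(1,3,2)] by simp
  let ?r = "representation C"
  have inC: "w \<in> span C" if "w \<in> W" for w using C(3) that by blast
  \<comment> \<open>The functionals are linear on \<open>W\<close> only, so the partial sums must
    stay inside \<open>W\<close>.\<close>
  have l_sum: "l x (\<Sum>c\<in>D. scale (a c) c) = (\<Sum>c\<in>D. a c * l x c)" if "x \<in> X" "finite D" "D \<subseteq> W" for x a D
    using that(2,3)
  proof (induction D rule: finite_induct)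
    case empty
    have "l x (scale 0 0) = 0 * l x 0" using scl[OF that(1) subspace_0[OF W]] by blast
    then show ?case by simp
  next
    case (insert d D)
    then have "(\<Sum>c\<in>D. scale (a c) c) \<in> W" "scale (a d) d \<in> W"
      using W by (auto intro!: subspace_sum subspace_scale)
    then show ?case using insert that(1) by (simp add: add scl)
  qed
  have "of_nat (card C) = (\<Sum>c\<in>C. ?r c c)"
    using representation_basis[OF C(2)] by simp
  \<comment> \<open>Each basis vector is expanded in the frame; contracting the basis index after
    the exchange of sums leaves \<open>l x (b x)\<close>.\<close>
  also have "\<dots> = (\<Sum>c\<in>C. \<Sum>x\<in>X. l x c * ?r (b x) c)"
  proof (intro sum.cong refl)
    fix c assume c: "c \<in> C"
    then have "?r c c = ?r (\<Sum>x\<in>X. scale (l x c) (b x)) c" using expand[of c] C(1) by auto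
    also have "\<dots> = (\<Sum>x\<in>X. ?r (scale (l x c) (b x)) c)"
      using representation_sum[OF C(2), of X "\<lambda>x. scale (l x c) (b x)"] inC b by (simp add: span_scale)
    also have "\<dots> = (\<Sum>x\<in>X. l x c * ?r (b x) c)"
      using representation_scale[OF C(2)] inC b by (intro sum.cong) auto
    finally show "?r c c = (\<Sum>x\<in>X. l x c * ?r (b x) c)" .
  qed
  also have "\<dots> = (\<Sum>x\<in>X. \<Sum>c\<in>C. ?r (b x) c * l x c)"
    by (subst sum.swap) (simp add: mult.commute)
  also have "\<dots> = (\<Sum>x\<in>X. l x (b x))"
  proof (intro sum.cong refl)
    fix x assume x: "x \<in> X"
    have "(\<Sum>c\<in>C. ?r (b x) c * l x c) = l x (\<Sum>c\<in>C. scale (?r (b x) c) c)"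
      using l_sum[OF x fC C(1)] by simp
    also have "(\<Sum>c\<in>C. scale (?r (b x) c) c) = b x"
      using sum_representation_eq[OF C(2) inC[OF b[OF x]] fC] by simp
    finally show "(\<Sum>c\<in>C. ?r (b x) c * l x c) = l x (b x)" .
  qed
  finally show ?thesis by (simp add: card)
qed

section \<open>Smooth fields and the Dirac operator\<close>

lemma Ck_add: "Ck k f \<Longrightarrow> Ck k g \<Longrightarrow> Ck k (\<lambda>x. f x + g x)"
proof (induction k arbitrary: f g)
  case (Suc k)
  have "frechet_derivative (\<lambda>x. f x + g x) (at x) = (\<lambda>h. frechet_derivative f (at x) h + frechet_derivative g (at x) h)" for x
    by (rule frechet_derivative_at[symmetric])
      (use Suc.prems in \<open>auto intro!: has_derivative_add simp flip: frechet_derivative_works\<close>)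
  then show ?case using Suc by auto
qed (auto intro: continuous_on_add)

lemma Ck_linear: "bounded_linear A \<Longrightarrow> Ck k f \<Longrightarrow> Ck k (\<lambda>x. A (f x))"
proof (induction k arbitrary: f)
  case (Suc k)
  have d: "((\<lambda>x. A (f x)) has_derivative (\<lambda>h. A (frechet_derivative f (at x) h))) (at x)" for x
    by (rule bounded_linear.has_derivative[OF Suc.prems(1)])
      (use Suc.prems in \<open>auto simp flip: frechet_derivative_works\<close>)
  then have "frechet_derivative (\<lambda>x. A (f x)) (at x) = (\<lambda>h. A (frechet_derivative f (at x) h))" for x
    by (rule frechet_derivative_at[symmetric])
  then show ?case using Suc d by (auto simp: differentiable_def)
qed (auto intro: bounded_linear.continuous_on)

lemma Ck_const: "Ck k (\<lambda>x. c)"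
  by (induction k arbitrary: c) auto

lemma smooth_add: "smooth f \<Longrightarrow> smooth g \<Longrightarrow> smooth (\<lambda>x. f x + g x)"
  and smooth_linear: "bounded_linear A \<Longrightarrow> smooth f \<Longrightarrow> smooth (\<lambda>x. A (f x))"
  and smooth_const: "smooth (\<lambda>x. c)"
  by (simp_all add: smooth_def Ck_add Ck_linear Ck_const)

lemma smooth_continuous: "smooth f \<Longrightarrow> continuous_on UNIV f"
  unfolding smooth_def by (metis Ck.simps(1))

lemma smooth_differentiable: "smooth f \<Longrightarrow> f differentiable (at x)"
  unfolding smooth_def by (metis Ck.simps(2))

lemma smooth_derivative_continuous:
  "smooth f \<Longrightarrow> i \<in> Basis \<Longrightarrow> continuous_on UNIV (\<lambda>x. frechet_derivative f (at x) i)"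
  unfolding smooth_def by (metis Ck.simps(1,2))

lemma ch_has_derivative:
  "(ch u has_derivative (\<lambda>h. (2 * pi * \<i> * of_real (u \<bullet> h)) * ch u x)) (at (x :: 'n::finite euc))"
proof -
  have "((\<lambda>x. \<i> * of_real (2 * pi * (u \<bullet> x))) has_derivative (\<lambda>h. \<i> * of_real (2 * pi * (u \<bullet> h)))) (at x)"
    by (auto intro!: derivative_eq_intros)
  from has_derivative_compose[OF this DERIV_exp[unfolded has_field_derivative_def]]
  show ?thesis
    unfolding ch_def[abs_def] cis_conv_exp by (rule has_derivative_eq_rhs) (simp add: fun_eq_iff)
qed

lemma ch_cscale_derivative:
  fixes w :: "complex^'d"
  shows "((\<lambda>x. ch u x *s w) has_derivative (\<lambda>h. ch u x *s ((2 * pi * \<i> * of_real (u \<bullet> h)) *s w))) (at (x :: 'n::finite euc))"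
  by (rule has_derivative_eq_rhs[OF bounded_linear.has_derivative[OF
        bounded_bilinear.bounded_linear_left[OF bounded_bilinear_cscale] ch_has_derivative]])
    (simp add: fun_eq_iff vec_eq_iff)

lemma smooth_ch: "smooth (\<lambda>x :: 'n::finite euc. ch u x *s (w :: complex^'d))"
proof -
  have "Ck k (\<lambda>x :: 'n euc. ch u x *s (w :: complex^'d))" for k
  proof (induction k arbitrary: w)
    case (Suc k)
    have "frechet_derivative (\<lambda>x. ch u x *s w) (at x) = (\<lambda>h. ch u x *s ((2 * pi * \<i> * of_real (u \<bullet> h)) *s w))" for x :: "'n euc"
      by (rule frechet_derivative_at[OF ch_cscale_derivative, symmetric])
    then have "Ck k (\<lambda>x :: 'n euc. frechet_derivative (\<lambda>x. ch u x *s w) (at x) i)" for i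
      using Suc.IH[of "(2 * pi * \<i> * of_real (u \<bullet> i)) *s w"] by (simp only:)
    moreover have "(\<lambda>x. ch u x *s w) differentiable (at x)" for x :: "'n euc"
      using ch_cscale_derivative unfolding differentiable_def by blast
    ultimately show ?case unfolding Ck.simps by blast
  qed (auto intro!: continuous_intros)
  then show ?thesis by (simp add: smooth_def)
qed

section \<open>Kronecker products and Clifford multiplication on twisted spinors\<close>

lemma kron_mult: "kron A B ** kron C D = kron (A ** C) (B ** D)"
  by (simp add: kron_def matrix_matrix_mult_def vec_eq_iff sum_product UNIV_Times_UNIV[symmetric]
      sum.cartesian_product split_beta mult_ac del: UNIV_Times_UNIV)

lemma kron_one: "kron (mat c) (mat 1) = mat c"
  by (auto simp: kron_def mat_def vec_eq_iff prod_eq_iff)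

lemma trace_kron: "trace (kron A B) = trace A * trace B"
  by (simp add: trace_def kron_def sum_product UNIV_Times_UNIV[symmetric] sum.cartesian_product
      split_beta del: UNIV_Times_UNIV)

lemma mat_vector_mult: "mat c *v w = (c :: complex) *s w"
  by (simp add: vec_eq_iff matrix_vector_mult_def mat_def if_distrib if_distribR cong: if_cong)

lemma bounded_linear_mult_vec: "bounded_linear ((*v) (A :: complex^'a^'b))"
proof -
  have "linear ((*v) A)"
    by (rule linearI) (simp_all add: matrix_vector_right_distrib flip: of_real_cscale add: vec.scale)
  then show ?thesis by (simp add: linear_conv_bounded_linear)
qed

lemma sum_component_trace: "(\<Sum>p\<in>UNIV. (A *v axis p 1) $ p) = trace (A :: complex^'a^'a)"
  by (simp add: trace_def matrix_vector_mult_def axis_def if_distrib cong: if_cong)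

context spinor_rep
begin

definition cliff :: "'n euc \<Rightarrow> complex^('s \<times> 'v::finite)^('s \<times> 'v)" where
  "cliff u = kron (L (cl_vec u)) (mat 1)"

lemma cliff_square: "cliff u *v (cliff u *v w) = of_real (- (u \<bullet> u)) *s w"
  by (simp add: cliff_def matrix_vector_mul_assoc kron_mult cl_vec_square L_of_real kron_one
      mat_vector_mult flip: L_mult del: of_real_minus)

lemma cliff_sum: "cliff u *v w = (\<Sum>i\<in>UNIV. of_real (u $ i) *s (cliff (axis i 1) *v w))"
proof -
  have "L (cl_vec u) = (\<Sum>i\<in>UNIV. u $ i *\<^sub>R L (cl_gen i))"
    by (simp add: cl_vec_def linear_sum[OF L_linear] L_simps)
  then show ?thesis
    by (simp add: cliff_def vec_eq_iff matrix_vector_mult_def kron_def sum_distrib_left sum_distrib_right)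
      (subst sum.swap, simp add: scaleR_conv_of_real mult_ac)
qed

text \<open>The differential half of \<open>eigenspace\<close>. The summands of an average are not
  equivariant one by one, but each of them already lies here.\<close>

definition cfield :: "real \<Rightarrow> ('n euc \<Rightarrow> complex^('s \<times> 'v::finite)) set" where
  "cfield t = {\<psi>. smooth \<psi> \<and> (\<forall>x. dirac L \<psi> x = complex_of_real t *s \<psi> x)}"

lemma dirac_cliff: "dirac L \<psi> x = (\<Sum>i\<in>UNIV. cliff (axis i 1) *v frechet_derivative \<psi> (at x) (axis i 1))"
  by (simp add: dirac_def cliff_def)

lemma dirac_add:
  assumes "smooth \<psi>" "smooth \<phi>"
  shows "dirac L (\<lambda>x. \<psi> x + \<phi> x) x = dirac L \<psi> x + dirac L \<phi> x"
proof -
  have "frechet_derivative (\<lambda>x. \<psi> x + \<phi> x) (at x) = (\<lambda>h. frechet_derivative \<psi> (at x) h + frechet_derivative \<phi> (at x) h)"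
    by (rule frechet_derivative_at[symmetric])
      (use assms in \<open>auto intro!: has_derivative_add simp: smooth_differentiable simp flip: frechet_derivative_works\<close>)
  then show ?thesis by (simp add: dirac_cliff matrix_vector_right_distrib sum.distrib)
qed

lemma dirac_scale:
  assumes "smooth \<psi>"
  shows "dirac L (\<lambda>x. c *s \<psi> x) x = c *s dirac L \<psi> x"
proof -
  have "frechet_derivative (\<lambda>x. c *s \<psi> x) (at x) = (\<lambda>h. c *s frechet_derivative \<psi> (at x) h)"
    by (rule frechet_derivative_at[symmetric], rule bounded_linear.has_derivative[OF cscale_bounded_linear])
      (use assms in \<open>auto simp: smooth_differentiable simp flip: frechet_derivative_works\<close>)
  then show ?thesis by (simp add: dirac_cliff vec.scale) (simp add: vec_eq_iff sum_distrib_left)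
qed

lemma cfield_subspace: "field.subspace (cfield t)"
proof -
  have 0: "(\<lambda>x. 0) \<in> cfield t"
    by (simp add: cfield_def smooth_const dirac_cliff)
  have add: "\<psi> + \<phi> \<in> cfield t" if "\<psi> \<in> cfield t" "\<phi> \<in> cfield t" for \<psi> \<phi>
    using that unfolding cfield_def plus_fun_def
    by (auto simp: smooth_add dirac_add vector_add_ldistrib)
  have scale: "field_scale c \<psi> \<in> cfield t" if "\<psi> \<in> cfield t" for c \<psi>
    using that unfolding cfield_def field_scale_def
    by (auto simp: dirac_scale vector_smult_assoc mult.commute intro!: smooth_linear[OF cscale_bounded_linear])
  show ?thesis
    using 0 add scale by (auto simp: field.subspace_def zero_fun_def)
qed

text \<open>Differentiating a plane wave brings down \<open>2 pi i\<close> times the symbol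
  \<open>cliff u\<close>, so the eigenvalue equation becomes algebraic in \<open>w\<close>.\<close>

lemma ch_cfield:
  assumes "(2 * pi * \<i>) *s (cliff u *v w) = of_real t *s w"
  shows "(\<lambda>x. ch u x *s w) \<in> cfield t"
proof -
  have "dirac L (\<lambda>x. ch u x *s w) x = of_real t *s (ch u x *s w)" for x
  proof -
    have "frechet_derivative (\<lambda>x. ch u x *s w) (at x) = (\<lambda>h. ch u x *s ((2 * pi * \<i> * of_real (u \<bullet> h)) *s w))"
      by (rule frechet_derivative_at[OF ch_cscale_derivative, symmetric])
    then have "dirac L (\<lambda>x. ch u x *s w) x =
        ch u x *s ((2 * pi * \<i>) *s (\<Sum>i\<in>UNIV. of_real (u $ i) *s (cliff (axis i 1) *v w)))"
      by (simp add: dirac_cliff vec.scale inner_axis) (simp add: vec_eq_iff sum_distrib_left mult_ac)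
    also have "\<dots> = ch u x *s (of_real t *s w)" by (simp only: assms flip: cliff_sum)
    also have "\<dots> = of_real t *s (ch u x *s w)" by (simp add: vec_eq_iff mult_ac)
    finally show ?thesis .
  qed
  then show ?thesis by (simp add: cfield_def smooth_ch)
qed

end

section \<open>Twisted spinor fields on a flat manifold\<close>

lemma sum_fun_apply: "(\<Sum>i\<in>I. f i) x = (\<Sum>i\<in>I. (f i x :: 'b::comm_monoid_add))"
  by (induction I rule: infinite_finite_induct) (auto simp: zero_fun_def plus_fun_def)

lemma cscale_hom_sum:
  fixes f :: "complex^'a \<Rightarrow> complex^'b"
  assumes "\<And>v w. f (v + w) = f v + f w" "\<And>c v. f (c *s v) = c *s f v"
  shows "f (\<Sum>i\<in>I. g i) = (\<Sum>i\<in>I. f (g i))"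
proof -
  have "f 0 = 0" using assms(2)[of 0 0] by simp
  then show ?thesis by (induction I rule: infinite_finite_induct) (auto simp: assms(1))
qed

lemma cscale_hom_expand:
  fixes f :: "complex^'a \<Rightarrow> complex^'b"
  assumes "\<And>v w. f (v + w) = f v + f w" "\<And>c v. f (c *s v) = c *s f v"
  shows "f w = (\<Sum>p\<in>UNIV. w $ p *s f (axis p 1))"
proof -
  have "f w = f (\<Sum>p\<in>UNIV. w $ p *s axis p 1)" by (simp only: basis_expansion)
  then show ?thesis by (simp add: cscale_hom_sum[OF assms] assms(2))
qed

lemma mult_vec_sum: "A *v (\<Sum>i\<in>I. g i) = (\<Sum>i\<in>I. A *v (g i :: complex^'a))"
  by (rule cscale_hom_sum) (simp_all add: matrix_vector_right_distrib vec.scale)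

lemma cscale_sum_right: "c *s (\<Sum>i\<in>I. g i) = (\<Sum>i\<in>I. c *s (g i :: complex^'a))"
  by (rule cscale_hom_sum) (simp_all add: vec_eq_iff algebra_simps)

context bieberbach
begin

section \<open>Sign homomorphisms on the lattice and lifts of holonomy elements\<close>

definition fb :: "'n \<Rightarrow> 'n euc" where "fb = (SOME f. Z_basis f \<Lambda>)"

lemma fb: "Z_basis fb \<Lambda>" unfolding fb_def by (rule someI_ex[OF Z_basis_exists])

sublocale cell: lattice_cell fb
  by unfold_locales (use Z_basis_independent[OF fb lattice_spans] in auto)

text \<open>Stated for an abstract \<phi> so that one computation serves both
  \<open>delta \<epsilon>\<close> and \<open>ch u\<close>, which \<open>chars_iff\<close>
  compares.\<close>

lemma sign_hom_int:
  fixes \<phi> :: "'n euc \<Rightarrow> complex"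
  assumes add: "\<And>x y. x \<in> \<Lambda> \<Longrightarrow> y \<in> \<Lambda> \<Longrightarrow> \<phi> (x + y) = \<phi> x * \<phi> y" and zero: "\<phi> 0 = 1"
    and x: "x \<in> \<Lambda>" "\<phi> x * \<phi> x = 1"
  shows "\<phi> (of_int z *\<^sub>R x) = (if even z then 1 else \<phi> x)"
proof -
  have n: "\<phi> (of_nat n *\<^sub>R x) = (if even n then 1 else \<phi> x)" for n
  proof (induction n)
    case (Suc n)
    have "\<phi> (of_nat (Suc n) *\<^sub>R x) = \<phi> (of_nat n *\<^sub>R x + x)" by (simp add: algebra_simps)
    also have "\<dots> = \<phi> (of_nat n *\<^sub>R x) * \<phi> x" by (intro add lattice.nat_mem x)
    finally show ?case using Suc x by simp
  qed (simp add: zero)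
  show ?thesis
  proof (cases "z \<ge> 0")
    case True then show ?thesis using n[of "nat z"] by (simp add: even_nat_iff)
  next
    case False
    then have "\<phi> (of_int z *\<^sub>R x) * \<phi> (of_nat (nat (- z)) *\<^sub>R x) = 1"
      using add[OF lattice.int_mem[OF x(1)] lattice.nat_mem[OF x(1)], of z "nat (- z)"] by (simp add: zero)
    moreover have "even (nat (- z)) \<longleftrightarrow> even z" using False by (simp add: even_nat_iff)
    ultimately have e: "\<phi> (of_int z *\<^sub>R x) * (if even z then 1 else \<phi> x) = 1" by (simp only: n)
    show ?thesis
    proof (cases "even z")
      case False
      with e have "\<phi> (of_int z *\<^sub>R x) * \<phi> x * \<phi> x = \<phi> x" by simp
      then show ?thesis using False x(2) by (simp add: mult.assoc)
    qed (use e in simp)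
  qed
qed

lemma sign_hom_sum:
  fixes \<phi> :: "'n euc \<Rightarrow> complex"
  assumes add: "\<And>x y. x \<in> \<Lambda> \<Longrightarrow> y \<in> \<Lambda> \<Longrightarrow> \<phi> (x + y) = \<phi> x * \<phi> y" and zero: "\<phi> 0 = 1"
    and f: "\<And>i. f i \<in> \<Lambda>" "\<And>i. \<phi> (f i) * \<phi> (f i) = 1" and I: "finite I"
  shows "\<phi> (\<Sum>i\<in>I. of_int (c i) *\<^sub>R f i) = (\<Prod>i\<in>I. if even (c i) then 1 else \<phi> (f i))"
  using I
proof (induction I rule: finite_induct)
  case (insert i I)
  then have "\<phi> (\<Sum>i\<in>insert i I. of_int (c i) *\<^sub>R f i) =
      \<phi> (of_int (c i) *\<^sub>R f i) * \<phi> (\<Sum>i\<in>I. of_int (c i) *\<^sub>R f i)"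
    unfolding sum.insert[OF insert(1,2)]
    by (intro add lattice.int_mem lattice.int_sum_mem f insert(1))
  then show ?case using insert sign_hom_int[OF add zero f] by simp
qed (simp add: zero)

lemma bij_mem: assumes "\<gamma> \<in> \<Gamma>" shows "bij \<gamma>"
  using inv_mem[OF assms] by (metis o_bij)

lemma inv_apply: "\<gamma> \<in> \<Gamma> \<Longrightarrow> \<gamma> (inv_into UNIV \<gamma> x) = x"
  by (simp add: bij_mem bij_is_surj surj_f_inv_f)

lemma inv_eq: "\<gamma> \<in> \<Gamma> \<Longrightarrow> \<gamma> y = x \<Longrightarrow> inv_into UNIV \<gamma> x = y"
  using bij_mem bij_is_inj inv_f_eq by metis

text \<open>An arbitrary lift; \<open>wave_rot\<close> and \<open>rep_change\<close> show that
  nothing depends on the choice.\<close>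

definition rep :: "'n emat \<Rightarrow> 'n emap" where "rep B = (SOME \<gamma>. \<gamma> \<in> \<Gamma> \<and> rot \<gamma> = B)"

definition shift :: "'n emat \<Rightarrow> 'n euc" where "shift B = (SOME b. rep B = BL B b)"

lemma rep: assumes "B \<in> F" shows "rep B \<in> \<Gamma>" "rot (rep B) = B"
  using someI_ex[of "\<lambda>\<gamma>. \<gamma> \<in> \<Gamma> \<and> rot \<gamma> = B"] assms unfolding rep_def by auto

lemma rep_BL: assumes "B \<in> F" shows "rep B = BL B (shift B)"
proof -
  have "\<exists>b. rep B = BL B b" using rep[OF assms] by (auto elim!: \<Gamma>_cases)
  then show ?thesis unfolding shift_def by (rule someI_ex)
qed

lemma F_symmetric:
  assumes "B \<in> F" shows "x v* B = B *v x"
proof -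
  have "x v* B = (B *v (B *v x)) v* B"
    by (simp add: matrix_vector_mul_assoc F_facts(3)[OF assms])
  also have "\<dots> = B *v x" by (rule orth_inv[OF rot_orth[OF assms]])
  finally show ?thesis .
qed

lemma F_inner: "B \<in> F \<Longrightarrow> (B *v x) \<bullet> y = x \<bullet> (B *v y)"
  by (metis F_symmetric dot_lmul_matrix)

end

locale flat_spin = bieberbach \<Gamma> k + spinor_rep L
  for \<Gamma> :: "'n::{finite,linorder} emap set" and k and L :: "'n clifford \<Rightarrow> complex^'s^'s" +
  fixes \<epsilon> :: "'n emap \<Rightarrow> 'n clifford" and \<rho> :: "'n emap \<Rightarrow> complex^'v^'v"
  assumes spin: "spin_structure \<Gamma> \<epsilon>" and twist: "twisting_rep \<Gamma> \<rho>"
begin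

section \<open>Signs on the lattice and admissible frequencies\<close>

lemma \<epsilon>_Spin: "\<gamma> \<in> \<Gamma> \<Longrightarrow> \<epsilon> \<gamma> \<in> Spin"
  and \<epsilon>_comp: "\<gamma> \<in> \<Gamma> \<Longrightarrow> \<eta> \<in> \<Gamma> \<Longrightarrow> \<epsilon> (\<gamma> \<circ> \<eta>) = \<epsilon> \<gamma> * \<epsilon> \<eta>"
  and \<rho>_comp: "\<gamma> \<in> \<Gamma> \<Longrightarrow> \<eta> \<in> \<Gamma> \<Longrightarrow> \<rho> (\<gamma> \<circ> \<eta>) = \<rho> \<gamma> ** \<rho> \<eta>"
  and \<rho>_transl: "v \<in> \<Lambda> \<Longrightarrow> \<rho> (transl v) = mat 1"
  using spin twist
  by (auto simp: spin_structure_def twisting_rep_def hom_def isometry_group_def spin_group_def unitary_group_def)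

lemma \<epsilon>_vec:
  assumes "\<gamma> \<in> \<Gamma>" shows "cl_vec (rot \<gamma> *v x) * \<epsilon> \<gamma> = \<epsilon> \<gamma> * cl_vec x"
proof -
  have "spin_cover (\<epsilon> \<gamma>) x = rot \<gamma> *v x" using spin assms by (simp add: spin_structure_def)
  then show ?thesis using spin_cover_mult[OF \<epsilon>_Spin[OF assms], of x] by simp
qed

text \<open>A translation has trivial rotation part, so its spin lift commutes with all vectors and
  is a sign; this makes the definite description in \<open>delta\<close> denote.\<close>

lemma \<epsilon>_lattice:
  assumes "v \<in> \<Lambda>"
  shows "\<epsilon> (transl v) = of_real (delta \<epsilon> v)" "delta \<epsilon> v = 1 \<or> delta \<epsilon> v = -1"
proof -
  let ?g = "\<epsilon> (transl v)"
  have "cl_gen i * ?g = ?g * cl_gen i" for i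
    using \<epsilon>_vec[OF latticeD[OF assms], of "axis i 1"] by (simp add: rot_transl)
  then have "?g = 1 \<or> ?g = - 1" by (rule Spin_scalar[OF \<epsilon>_Spin[OF latticeD[OF assms]]])
  then obtain c :: real where c: "?g = of_real c" "c = 1 \<or> c = -1"
    by (metis of_real_1 of_real_minus)
  then have "delta \<epsilon> v = c" unfolding delta_def by auto
  with c show "\<epsilon> (transl v) = of_real (delta \<epsilon> v)" "delta \<epsilon> v = 1 \<or> delta \<epsilon> v = -1" by auto
qed

lemma delta_add:
  assumes "v \<in> \<Lambda>" "w \<in> \<Lambda>" shows "delta \<epsilon> (v + w) = delta \<epsilon> v * delta \<epsilon> w"
proof -
  have "of_real (delta \<epsilon> (v + w)) = (of_real (delta \<epsilon> v * delta \<epsilon> w) :: 'n clifford)"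
    using \<epsilon>_comp[OF latticeD latticeD, OF assms]
    by (simp add: transl_comp \<epsilon>_lattice assms lattice.add_mem)
  then show ?thesis by (simp only: of_real_eq_iff)
qed

lemma delta_square: "v \<in> \<Lambda> \<Longrightarrow> delta \<epsilon> v * delta \<epsilon> v = 1"
  using \<epsilon>_lattice(2) by fastforce

lemma delta_zero: "delta \<epsilon> 0 = 1"
  using delta_add[OF lattice.zero_mem lattice.zero_mem] \<epsilon>_lattice(2)[OF lattice.zero_mem] by auto

text \<open>A lift of \<open>B\<close> conjugates \<open>transl v\<close> into
  \<open>transl (B v)\<close>, and conjugation does not change a real scalar.\<close>

lemma delta_rot:
  assumes "B \<in> F" "v \<in> \<Lambda>" shows "delta \<epsilon> (B *v v) = delta \<epsilon> v"
proof -
  let ?g = "rep B"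
  note g = rep[OF assms(1)]
  have Bv: "B *v v \<in> \<Lambda>" by (rule F_lattice[OF assms])
  have "?g \<circ> transl v = transl (B *v v) \<circ> ?g"
    by (simp add: rep_BL[OF assms(1)] BL_def fun_eq_iff matrix_vector_right_distrib add_ac)
  then have "\<epsilon> ?g * \<epsilon> (transl v) = \<epsilon> (transl (B *v v)) * \<epsilon> ?g"
    using \<epsilon>_comp[OF g(1) latticeD[OF assms(2)]] \<epsilon>_comp[OF latticeD[OF Bv] g(1)] by simp
  then have "delta \<epsilon> v *\<^sub>R \<epsilon> ?g = delta \<epsilon> (B *v v) *\<^sub>R \<epsilon> ?g"
    by (simp add: \<epsilon>_lattice assms Bv) (simp add: of_real_def)
  moreover have "\<epsilon> ?g \<noteq> 0" using spin_inv(2)[OF \<epsilon>_Spin[OF g(1)]] by auto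
  ultimately show ?thesis by simp
qed

definition K :: "'n emap \<Rightarrow> complex^('s \<times> 'v)^('s \<times> 'v)" where
  "K \<gamma> = kron (L (\<epsilon> \<gamma>)) (\<rho> \<gamma>)"

lemma K_comp: "\<gamma> \<in> \<Gamma> \<Longrightarrow> \<eta> \<in> \<Gamma> \<Longrightarrow> K (\<gamma> \<circ> \<eta>) = K \<gamma> ** K \<eta>"
  by (simp add: K_def kron_mult \<epsilon>_comp \<rho>_comp L_mult)

lemma K_transl: "v \<in> \<Lambda> \<Longrightarrow> K (transl v) = mat (of_real (delta \<epsilon> v))"
  by (simp add: K_def \<epsilon>_lattice \<rho>_transl L_of_real kron_one)

lemma K_cliff: "\<gamma> \<in> \<Gamma> \<Longrightarrow> cliff (rot \<gamma> *v u) *v (K \<gamma> *v w) = K \<gamma> *v (cliff u *v w)"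
  by (simp add: cliff_def K_def matrix_vector_mul_assoc kron_mult \<epsilon>_vec flip: L_mult)

lemma trace_K: "trace (K \<gamma>) = trace (L (\<epsilon> \<gamma>)) * trace (\<rho> \<gamma>)"
  and trace_K_cliff: "trace (K \<gamma> ** cliff u) = trace (L (\<epsilon> \<gamma> * cl_vec u)) * trace (\<rho> \<gamma>)"
  by (simp_all add: K_def cliff_def kron_mult trace_kron L_mult)

text \<open>The frequencies that can occur in an equivariant field. They form a coset of the dual
  lattice, by \<open>chars_diff\<close>, \<open>chars_add_dual\<close> and
  \<open>chars_nonempty\<close>.\<close>

definition chars :: "'n euc set" where
  "chars = {u. \<forall>v\<in>\<Lambda>. complex_of_real (delta \<epsilon> v) = ch u v}"

lemma dual_shell_chars: "dual_shell \<Gamma> \<epsilon> \<mu> = {u \<in> chars. norm u = \<mu>}"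
  by (auto simp: dual_shell_def chars_def ch_def cis_conv_exp mult_ac)

lemma charsD: "u \<in> chars \<Longrightarrow> v \<in> \<Lambda> \<Longrightarrow> ch u v = of_real (delta \<epsilon> v)"
  by (simp add: chars_def)

text \<open>Both sides are homomorphisms on the lattice with square 1 on the basis (for
  \<open>ch u\<close> by the assumed agreement), so both depend only on the parities of the
  coordinates.\<close>

lemma chars_iff: "u \<in> chars \<longleftrightarrow> (\<forall>i. complex_of_real (delta \<epsilon> (fb i)) = ch u (fb i))"
proof
  assume *: "\<forall>i. complex_of_real (delta \<epsilon> (fb i)) = ch u (fb i)"
  have fbm: "fb i \<in> \<Lambda>" for i by (rule Z_basis_mem[OF fb])
  have sq: "complex_of_real (delta \<epsilon> (fb i)) * complex_of_real (delta \<epsilon> (fb i)) = 1" for i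
    using delta_square[OF fbm, of i] by (simp flip: of_real_mult)
  have "complex_of_real (delta \<epsilon> v) = ch u v" if v: "v \<in> \<Lambda>" for v
  proof -
    obtain c where c: "v = (\<Sum>i\<in>UNIV. of_int (c i) *\<^sub>R fb i)" by (rule Z_basis_expand[OF fb v])
    have "complex_of_real (delta \<epsilon> v) = (\<Prod>i\<in>UNIV. if even (c i) then 1 else complex_of_real (delta \<epsilon> (fb i)))"
      unfolding c by (rule sign_hom_sum[of "\<lambda>v. complex_of_real (delta \<epsilon> v)"])
        (auto simp: delta_add delta_zero fbm sq)
    also have "\<dots> = (\<Prod>i\<in>UNIV. if even (c i) then 1 else ch u (fb i))"
      by (simp only: *[rule_format])
    also have "\<dots> = ch u v"
      unfolding c by (rule sign_hom_sum[of "ch u", symmetric])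
        (use * sq in \<open>auto simp: ch_add_right fbm\<close>)
    finally show ?thesis .
  qed
  then show "u \<in> chars" by (simp add: chars_def)
qed (auto simp: chars_def Z_basis_mem[OF fb])

lemma chars_diff:
  assumes "u \<in> chars" "u' \<in> chars" shows "u - u' \<in> cell.dual_lattice"
proof -
  have "ch (u - u') (fb i) = 1" for i
  proof -
    have "ch (u - u') (fb i) * ch u' (fb i) = ch u (fb i)" by (simp flip: ch_add_left)
    then have "ch (u - u') (fb i) * ch u' (fb i) = 1 * ch u' (fb i)"
      using assms chars_iff by simp
    then show ?thesis by (simp only: mult_cancel_right ch_nonzero) simp
  qed
  then show ?thesis by (simp add: cell.dual_lattice_def ch_eq_1_iff)
qed

lemma chars_add_dual: "u \<in> chars \<Longrightarrow> v \<in> cell.dual_lattice \<Longrightarrow> u + v \<in> chars"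
  unfolding chars_iff cell.dual_lattice_def using ch_eq_1_iff by (auto simp: ch_add_left)

text \<open>Half the sum of those dual basis vectors whose basis vector has \<delta> = -1 has the
  required phases, since a half turn gives -1.\<close>

lemma chars_nonempty: "\<exists>u. u \<in> chars"
proof -
  define u where "u = (\<Sum>i\<in>UNIV. (if delta \<epsilon> (fb i) = 1 then 0 else 1/2) *\<^sub>R cell.dual i)"
  have "u \<bullet> fb j = (if delta \<epsilon> (fb j) = 1 then 0 else 1/2)" for j
  proof -
    have "u \<bullet> fb j = (\<Sum>i\<in>UNIV. if i = j then (if delta \<epsilon> (fb i) = 1 then 0 else 1/2) else 0)"
      unfolding u_def inner_sum_left by (intro sum.cong) (auto simp: cell.dual_f)
    then show ?thesis by simp
  qed
  then have "ch u (fb j) = of_real (delta \<epsilon> (fb j))" for j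
    using \<epsilon>_lattice(2)[OF Z_basis_mem[OF fb], of j] by (auto simp: ch_def)
  then show ?thesis unfolding chars_iff by metis
qed

lemma chars_uminus: assumes "u \<in> chars" shows "- u \<in> chars"
proof -
  have "ch (- u) v = of_real (delta \<epsilon> v)" if "v \<in> \<Lambda>" for v
  proof -
    have "ch (- u) v * of_real (delta \<epsilon> v) = 1"
      using charsD[OF assms that] by (metis ch_minus_mult(1))
    moreover have "complex_of_real (delta \<epsilon> v) * of_real (delta \<epsilon> v) = 1"
      using delta_square[OF that] by (simp flip: of_real_mult)
    ultimately show ?thesis by (metis mult.assoc mult_1_left mult_1_right)
  qed
  then show ?thesis by (simp add: chars_def)
qed

lemma chars_rot: assumes "u \<in> chars" "B \<in> F" shows "B *v u \<in> chars"
proof -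
  have "ch (B *v u) v = of_real (delta \<epsilon> v)" if "v \<in> \<Lambda>" for v
    using charsD[OF assms(1) F_lattice[OF assms(2) that]] F_inner[OF assms(2), of u v]
      delta_rot[OF assms(2) that] by (simp add: ch_def)
  then show ?thesis by (simp add: chars_def)
qed

text \<open>A dual vector shorter than \<open>1 / R\<close> has integer inner products of modulus
  below 1 with the basis and is therefore 0. So the dual lattice is discrete, and the shell lies in
  a bounded part of one of its cosets.\<close>

lemma finite_shell: "finite (dual_shell \<Gamma> \<epsilon> \<mu>)"
proof -
  obtain u0 where u0: "u0 \<in> chars" using chars_nonempty by blast
  interpret D: discrete_subgroup cell.dual_lattice
  proof
    show "0 \<in> cell.dual_lattice" by (simp add: cell.dual_lattice_def)
    show "x - y \<in> cell.dual_lattice" if "x \<in> cell.dual_lattice" "y \<in> cell.dual_lattice" for x y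
      using that by (auto simp: cell.dual_lattice_def inner_diff_left)
    define R where "R = 1 + (\<Sum>i\<in>UNIV. norm (fb i))"
    have R: "R > 0" by (simp add: R_def add_pos_nonneg sum_nonneg)
    have "x = 0" if x: "x \<in> cell.dual_lattice" "norm x < 1 / R" for x
    proof -
      have "x \<bullet> fb i = 0" for i
      proof -
        have "norm (fb i) \<le> R" unfolding R_def
          using member_le_sum[of i UNIV "\<lambda>i. norm (fb i)"] by simp
        then have "\<bar>x \<bullet> fb i\<bar> \<le> norm x * R"
          using Cauchy_Schwarz_ineq2[of x "fb i"] by (meson mult_left_mono norm_ge_zero order_trans)
        also have "\<dots> < 1" using x(2) R by (simp add: field_simps)
        finally show ?thesis using x(1) Ints_nonzero_abs_less1 by (auto simp: cell.dual_lattice_def)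
      qed
      then have "x \<bullet> cell.T y = 0" for y by (simp add: cell.T_def inner_sum_right)
      then have "x \<bullet> x = 0" using cell.surj_T by (metis surjD)
      then show ?thesis by simp
    qed
    then show "\<exists>e>0. \<forall>x\<in>cell.dual_lattice. norm x < e \<longrightarrow> x = 0" using R by (intro exI[of _ "1 / R"]) auto
  qed
  have "dual_shell \<Gamma> \<epsilon> \<mu> \<subseteq> (\<lambda>v. v + u0) ` {v \<in> cell.dual_lattice. norm v \<le> \<mu> + norm u0}"
  proof
    fix u assume "u \<in> dual_shell \<Gamma> \<epsilon> \<mu>"
    then have "u - u0 \<in> cell.dual_lattice" "norm (u - u0) \<le> \<mu> + norm u0"
      using chars_diff[OF _ u0] norm_triangle_ineq4[of u u0] by (auto simp: dual_shell_chars)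
    then show "u \<in> (\<lambda>v. v + u0) ` {v \<in> cell.dual_lattice. norm v \<le> \<mu> + norm u0}"
      by (intro image_eqI[of _ _ "u - u0"]) auto
  qed
  then show ?thesis using finite_surj[OF D.finite_bounded] by blast
qed

subsection \<open>Fourier coefficients of eigenfields\<close>

definition coef :: "'n euc \<Rightarrow> ('n euc \<Rightarrow> complex^('s \<times> 'v)) \<Rightarrow> complex^('s \<times> 'v)" where
  "coef u \<psi> = cell.M (\<lambda>x. ch (- u) x *s \<psi> x)"

definition quasi :: "('n euc \<Rightarrow> complex^('s \<times> 'v)) \<Rightarrow> bool" where
  "quasi \<psi> \<longleftrightarrow> (\<forall>v\<in>\<Lambda>. \<forall>x. \<psi> (x + v) = of_real (delta \<epsilon> v) *s \<psi> x)"

lemma eigenspace_iff: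
  "\<psi> \<in> eigenspace L \<Gamma> \<epsilon> \<rho> t \<longleftrightarrow> \<psi> \<in> cfield t \<and> (\<forall>\<gamma>\<in>\<Gamma>. \<forall>x. \<psi> (\<gamma> x) = K \<gamma> *v \<psi> x)"
  by (auto simp: eigenspace_def spinor_fields_def cfield_def K_def)

lemma eigenspace_quasi:
  assumes "\<psi> \<in> eigenspace L \<Gamma> \<epsilon> \<rho> t" shows "quasi \<psi>"
  unfolding quasi_def
proof (intro ballI allI)
  fix v x assume v: "v \<in> \<Lambda>"
  have "\<psi> (transl v x) = K (transl v) *v \<psi> x"
    using assms latticeD[OF v] by (simp add: eigenspace_iff)
  then show "\<psi> (x + v) = of_real (delta \<epsilon> v) *s \<psi> x"
    using K_transl[OF v] by (simp add: BL_def mat_vector_mult)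
qed

lemma quasi_periodic:
  assumes "quasi \<psi>" "u \<in> chars" shows "cell.periodic (\<lambda>x. ch (- u) x *s \<psi> x)"
  unfolding cell.periodic_def
proof (intro allI)
  fix i x
  note f = Z_basis_mem[OF fb, of i]
  have "ch (- u) (fb i) * of_real (delta \<epsilon> (fb i)) = 1"
    using charsD[OF assms(2) f] by (metis ch_minus_mult(1))
  then show "ch (- u) (x + fb i) *s \<psi> (x + fb i) = ch (- u) x *s \<psi> x"
    using assms(1) f by (simp add: quasi_def ch_add_right mult.assoc)
qed

text \<open>The derivative of \<open>ch (- u)\<close> times \<psi> has mean zero, so a partial
  derivative acts on the coefficient as multiplication by \<open>2 pi i\<close> times a coordinate
  of \<open>u\<close>.\<close>

lemma coef_eigen:
  assumes \<psi>: "\<psi> \<in> cfield t" "quasi \<psi>" and u: "u \<in> chars"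
  shows "(2 * pi * \<i>) *s (cliff u *v coef u \<psi>) = of_real t *s coef u \<psi>"
proof -
  have sm: "smooth \<psi>" and dir: "\<And>x. dirac L \<psi> x = of_real t *s \<psi> x"
    using \<psi>(1) by (auto simp: cfield_def)
  note cont = smooth_continuous[OF sm]
  define g where "g x = ch (- u) x *s \<psi> x" for x
  have gc: "continuous_on UNIV g" unfolding g_def by (intro continuous_intros cont)
  let ?D = "\<lambda>x i. frechet_derivative \<psi> (at x) (axis i 1)"
  have der: "(g has_derivative (\<lambda>h. ch (- u) x *s frechet_derivative \<psi> (at x) h +
      (2 * pi * \<i> * of_real ((- u) \<bullet> h) * ch (- u) x) *s \<psi> x)) (at x)" for x
    unfolding g_def[abs_def]
    by (rule bounded_bilinear.FDERIV[OF bounded_bilinear_cscale ch_has_derivative])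
      (use smooth_differentiable[OF sm] frechet_derivative_works in blast)
  have fd: "frechet_derivative g (at x) (axis i 1) = ch (- u) x *s ?D x i + (- (2 * pi * \<i> * of_real (u $ i))) *s g x" for x i
    unfolding frechet_derivative_at[OF der, symmetric] by (simp add: g_def inner_axis vec_eq_iff)
  have Dc: "continuous_on UNIV (\<lambda>x. ?D x i)" for i
    by (rule smooth_derivative_continuous[OF sm]) (auto simp: Basis_vec_def)
  have "cell.M (\<lambda>x. ch (- u) x *s ?D x i) = (2 * pi * \<i> * of_real (u $ i)) *s coef u \<psi>" for i
  proof -
    have "0 = cell.M (\<lambda>x. frechet_derivative g (at x) (axis i 1))"
    proof (rule cell.M_derivative[symmetric])
      show "g differentiable at x" for x using der by (auto simp: differentiable_def)
      show "cell.periodic g" unfolding g_def[abs_def] by (rule quasi_periodic[OF \<psi>(2) u])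
      show "continuous_on UNIV (\<lambda>x. frechet_derivative g (at x) (axis i 1))"
        unfolding fd by (intro continuous_intros Dc gc)
    qed
    also have "\<dots> = cell.M (\<lambda>x. ch (- u) x *s ?D x i) + cell.M (\<lambda>x. (- (2 * pi * \<i> * of_real (u $ i))) *s g x)"
      unfolding fd by (rule cell.M_add) (intro continuous_intros Dc gc)+
    also have "cell.M (\<lambda>x. (- (2 * pi * \<i> * of_real (u $ i))) *s g x) = (- (2 * pi * \<i> * of_real (u $ i))) *s cell.M g"
      by (rule cell.M_bounded_linear[OF cscale_bounded_linear gc])
    finally show ?thesis unfolding coef_def g_def[abs_def]
      by (simp add: vec_eq_iff add_eq_0_iff)
  qed
  note MD = this
  have "of_real t *s coef u \<psi> = cell.M (\<lambda>x. of_real t *s g x)"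
    unfolding coef_def g_def[abs_def, symmetric]
    by (rule cell.M_bounded_linear[OF cscale_bounded_linear gc, symmetric])
  also have "\<dots> = cell.M (\<lambda>x. \<Sum>i\<in>UNIV. cliff (axis i 1) *v (ch (- u) x *s ?D x i))"
  proof -
    have "of_real t *s g x = (\<Sum>i\<in>UNIV. cliff (axis i 1) *v (ch (- u) x *s ?D x i))" for x
    proof -
      have "of_real t *s g x = ch (- u) x *s dirac L \<psi> x" by (simp add: dir g_def vec_eq_iff mult_ac)
      then show ?thesis by (simp add: dirac_cliff cscale_sum_right vec.scale)
    qed
    then show ?thesis by simp
  qed
  also have "\<dots> = (\<Sum>i\<in>UNIV. cell.M (\<lambda>x. cliff (axis i 1) *v (ch (- u) x *s ?D x i)))"
    by (rule cell.M_sum)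
      (auto intro!: bounded_linear.continuous_on[OF bounded_linear_mult_vec] continuous_intros Dc)
  also have "\<dots> = (\<Sum>i\<in>UNIV. cliff (axis i 1) *v ((2 * pi * \<i> * of_real (u $ i)) *s coef u \<psi>))"
    by (subst cell.M_bounded_linear[OF bounded_linear_mult_vec]) (intro continuous_intros Dc, simp only: MD)
  also have "\<dots> = (2 * pi * \<i>) *s (cliff u *v coef u \<psi>)"
    unfolding cliff_sum[of u] cscale_sum_right by (intro sum.cong) (auto simp: vec.scale)
  finally show ?thesis by simp
qed

text \<open>Applying the symbol twice and using \<open>cliff_square\<close> gives
  \<open>t^2 = (2 pi norm u)^2\<close>.\<close>

lemma eigen_norm:
  fixes a :: "complex^('s \<times> 'v)"
  assumes "(2 * pi * \<i>) *s (cliff u *v a) = of_real t *s a" "a \<noteq> 0"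
  shows "norm u = \<bar>t\<bar> / (2 * pi)"
proof -
  have "(2 * pi * \<i>) *s (cliff u *v ((2 * pi * \<i>) *s (cliff u *v a))) = of_real (t\<^sup>2) *s a"
  proof -
    have "(2 * pi * \<i>) *s (cliff u *v (of_real t *s a)) = of_real t *s ((2 * pi * \<i>) *s (cliff u *v a))"
      unfolding vec.scale by (simp add: vec_eq_iff)
    then show ?thesis unfolding assms(1) by (simp add: power2_eq_square)
  qed
  then have "((2 * pi * \<i>) * ((2 * pi * \<i>) * of_real (- (u \<bullet> u)))) *s a = of_real (t\<^sup>2) *s a"
    by (simp only: vec.scale cliff_square vector_smult_assoc)
  then have "(2 * pi * \<i>) * ((2 * pi * \<i>) * of_real (- (u \<bullet> u))) = of_real (t\<^sup>2)"
    using assms(2) by (simp only: vec.scale_cancel_right) blast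
  also have "(2 * pi * \<i>) * ((2 * pi * \<i>) * of_real (- (u \<bullet> u))) = of_real ((2 * pi * norm u)\<^sup>2)"
    by (simp add: complex_eq_iff power_mult_distrib power2_norm_eq_inner) (simp add: power2_eq_square)
  finally have "(2 * pi * norm u)\<^sup>2 = t\<^sup>2" by (simp only: of_real_eq_iff)
  then have "\<bar>2 * pi * norm u\<bar> = \<bar>t\<bar>" by (simp only: abs_eq_iff power2_eq_iff)
  then show ?thesis by (simp add: field_simps abs_mult)
qed

text \<open>The finite sum \<open>R\<close> has the same Fourier coefficients as \<psi>, so the
  difference vanishes by \<open>completeness\<close>; no convergence question arises.\<close>

lemma fourier_expansion:
  assumes \<psi>: "\<psi> \<in> cfield t" "quasi \<psi>"
  shows "\<psi> x = (\<Sum>u\<in>dual_shell \<Gamma> \<epsilon> (\<bar>t\<bar> / (2 * pi)). ch u x *s coef u \<psi>)"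
proof -
  let ?S = "dual_shell \<Gamma> \<epsilon> (\<bar>t\<bar> / (2 * pi))"
  have cont: "continuous_on UNIV \<psi>" using \<psi>(1) by (simp add: cfield_def smooth_continuous)
  obtain u0 where u0: "u0 \<in> chars" using chars_nonempty by blast
  define R where "R x = (\<Sum>u\<in>?S. ch u x *s coef u \<psi>)" for x
  have Rc: "continuous_on UNIV R" unfolding R_def by (intro continuous_intros)
  have R_quasi: "quasi R"
    unfolding quasi_def
  proof (intro ballI allI)
    fix v x assume v: "v \<in> \<Lambda>"
    have "ch u (x + v) *s coef u \<psi> = of_real (delta \<epsilon> v) *s (ch u x *s coef u \<psi>)" if "u \<in> ?S" for u
      using that charsD[OF _ v, of u] by (simp add: dual_shell_chars ch_add_right mult.commute)
    then show "R (x + v) = of_real (delta \<epsilon> v) *s R x"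
      unfolding R_def cscale_sum_right by (intro sum.cong) auto
  qed
  define h where "h x = ch (- u0) x *s (\<psi> x - R x)" for x
  have q: "quasi (\<lambda>x. \<psi> x - R x)" using \<psi>(2) R_quasi by (simp add: quasi_def vector_ssub_ldistrib)
  have "h x = 0"
  proof (rule cell.completeness)
    show "continuous_on UNIV h" unfolding h_def by (intro continuous_intros cont Rc)
    show "cell.periodic h" unfolding h_def[abs_def] by (rule quasi_periodic[OF q u0])
    fix v assume v: "v \<in> cell.dual_lattice"
    \<comment> \<open>The factor \<open>ch (- u0)\<close> only serves to make \<open>h\<close>
      periodic. Testing \<open>h\<close> against the dual vector \<open>v\<close> tests the
      difference at frequency \<open>u0 - v\<close>.\<close>
    define u1 where "u1 = u0 - v"
    have u1: "u1 \<in> chars"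
      using chars_add_dual[OF u0 cell.dual_lattice_neg[OF v]] by (simp add: u1_def)
    have "ch v x *s h x = ch (- u1) x *s \<psi> x + - (\<Sum>u\<in>?S. ch (u - u1) x *s coef u \<psi>)" for x
    proof -
      have "ch v x *s h x = ch (- u1) x *s (\<psi> x - R x)"
        by (simp add: h_def u1_def flip: ch_add_left)
      also have "\<dots> = ch (- u1) x *s \<psi> x + - (ch (- u1) x *s R x)"
        by (simp add: vector_ssub_ldistrib)
      also have "ch (- u1) x *s R x = (\<Sum>u\<in>?S. ch (u - u1) x *s coef u \<psi>)"
        unfolding R_def cscale_sum_right by (simp flip: ch_add_left)
      finally show ?thesis .
    qed
    then have "cell.M (\<lambda>x. ch v x *s h x) = coef u1 \<psi> + cell.M (\<lambda>x. - (\<Sum>u\<in>?S. ch (u - u1) x *s coef u \<psi>))"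
      unfolding coef_def by (simp only:) (rule cell.M_add; intro continuous_intros cont)
    also have "cell.M (\<lambda>x. - (\<Sum>u\<in>?S. ch (u - u1) x *s coef u \<psi>)) =
        - (\<Sum>u\<in>?S. cell.M (\<lambda>x. ch (u - u1) x *s coef u \<psi>))"
      by (subst cell.M_sum[symmetric, OF finite_shell])
        (auto intro!: continuous_intros simp: cell.M_def)
    also have "(\<Sum>u\<in>?S. cell.M (\<lambda>x. ch (u - u1) x *s coef u \<psi>)) = (\<Sum>u\<in>?S. if u = u1 then coef u \<psi> else 0)"
      by (intro sum.cong refl) (subst cell.M_char, auto simp: dual_shell_chars intro: chars_diff u1)
    \<comment> \<open>For \<open>u1\<close> outside the shell both sides are zero by
      \<open>eigen_norm\<close>, so the truncation loses nothing.\<close>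
    also have "\<dots> = coef u1 \<psi>"
      using eigen_norm[OF coef_eigen[OF \<psi> u1]] u1 finite_shell by (auto simp: dual_shell_chars)
    finally show "cell.M (\<lambda>x. ch v x *s h x) = 0" by simp
  qed
  then show ?thesis by (simp add: h_def R_def)
qed

end

section \<open>Averaging over the holonomy group and the multiplicity formula\<close>

context flat_spin
begin

text \<open>The plane wave transported by \<gamma>: its value at the preimage of \<open>x\<close>,
  acted on by \<open>K \<gamma>\<close>.\<close>

definition wave :: "'n euc \<Rightarrow> complex^('s \<times> 'v) \<Rightarrow> 'n emap \<Rightarrow> 'n euc \<Rightarrow> complex^('s \<times> 'v)" where
  "wave u w \<gamma> x = ch u (inv_into UNIV \<gamma> x) *s (K \<gamma> *v w)"

definition avg :: "'n euc \<Rightarrow> complex^('s \<times> 'v) \<Rightarrow> 'n euc \<Rightarrow> complex^('s \<times> 'v)" where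
  "avg u w x = (\<Sum>B\<in>F. (1 / 2 ^ k) *s wave u w (rep B) x)"

lemma wave_comp:
  assumes "\<eta> \<in> \<Gamma>" "\<gamma> \<in> \<Gamma>"
  shows "wave u w (\<eta> \<circ> \<gamma>) (\<eta> x) = K \<eta> *v wave u w \<gamma> x"
proof -
  have "inv_into UNIV (\<eta> \<circ> \<gamma>) (\<eta> x) = inv_into UNIV \<gamma> x"
    by (rule inv_eq[OF comp_mem[OF assms]]) (simp add: inv_apply assms)
  then show ?thesis
    by (simp add: wave_def K_comp assms vec.scale flip: matrix_vector_mul_assoc)
qed

text \<open>Composing \<gamma> with \<open>transl v\<close> changes the phase and \<open>K\<close>
  by the same sign \<open>delta \<epsilon> v\<close>. Hence averaging over the finite group
  \<open>F\<close> makes sense.\<close>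

lemma wave_rot:
  assumes "u \<in> chars" "\<gamma> \<in> \<Gamma>" "\<eta> \<in> \<Gamma>" "rot \<gamma> = rot \<eta>"
  shows "wave u w \<gamma> x = wave u w \<eta> x"
proof -
  obtain v where v: "v \<in> \<Lambda>" "\<eta> = \<gamma> \<circ> transl v" by (rule same_rot[OF assms(2-4)])
  define y where "y = inv_into UNIV \<eta> x"
  have "\<eta> y = x" unfolding y_def by (rule inv_apply[OF assms(3)])
  then have "\<gamma> (y + v) = x" by (simp add: v(2) BL_def)
  then have "inv_into UNIV \<gamma> x = y + v" by (rule inv_eq[OF assms(2)])
  then have "wave u w \<gamma> x = (ch u y * of_real (delta \<epsilon> v)) *s (K \<gamma> *v w)"
    by (simp add: wave_def ch_add_right charsD[OF assms(1) v(1)])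
  also have "\<dots> = ch u y *s (K \<eta> *v w)"
    by (simp add: v(2) K_comp[OF assms(2) latticeD[OF v(1)]] K_transl[OF v(1)] mat_vector_mult vec.scale
        flip: matrix_vector_mul_assoc)
  finally show ?thesis by (simp add: wave_def y_def)
qed

lemma wave_rep:
  assumes "B \<in> F"
  shows "wave u w (rep B) x = ch (B *v u) x *s (ch u (- shift B) *s (K (rep B) *v w))"
proof -
  have "inv_into UNIV (rep B) x = B *v x - shift B"
  proof (rule inv_eq[OF rep(1)[OF assms]])
    show "rep B (B *v x - shift B) = x"
      by (subst rep_BL[OF assms]) (simp add: BL_def matrix_vector_mul_assoc F_facts(3)[OF assms])
  qed
  then have "ch u (inv_into UNIV (rep B) x) = ch u (B *v x) * ch u (- shift B)"
    by (simp flip: ch_add_right)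
  also have "ch u (B *v x) = ch (B *v u) x" by (simp add: ch_def F_inner[OF assms])
  finally show ?thesis by (simp add: wave_def)
qed

text \<open>Left multiplication by \<open>rot \<eta>\<close> permutes \<open>F\<close>, and by
  \<open>wave_rot\<close> the product of two lifts may be replaced by the chosen lift.\<close>

lemma avg_equivariant:
  assumes "u \<in> chars" "\<eta> \<in> \<Gamma>"
  shows "avg u w (\<eta> x) = K \<eta> *v avg u w x"
proof -
  let ?C = "rot \<eta>"
  have C: "?C \<in> F" using assms(2) by simp
  have bij: "bij_betw ((**) ?C) F F"
    by (rule bij_betwI[where g = "(**) ?C"])
      (use C F_facts(3)[OF C] in \<open>auto simp: matrix_mul_assoc intro!: mult_F\<close>)
  have "K \<eta> *v avg u w x = (\<Sum>B\<in>F. (1 / 2 ^ k) *s wave u w (\<eta> \<circ> rep B) (\<eta> x))"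
    unfolding avg_def mult_vec_sum by (intro sum.cong refl) (simp only: vec.scale wave_comp[OF assms(2) rep(1)])
  also have "\<dots> = (\<Sum>B\<in>F. (1 / 2 ^ k) *s wave u w (rep (?C ** B)) (\<eta> x))"
  proof (intro sum.cong refl)
    fix B assume B: "B \<in> F"
    note CB = mult_F[OF C B]
    have "wave u w (\<eta> \<circ> rep B) (\<eta> x) = wave u w (rep (?C ** B)) (\<eta> x)"
      by (rule wave_rot[OF assms(1) comp_mem[OF assms(2) rep(1)[OF B]] rep(1)[OF CB]])
        (simp add: rep[OF CB] rot_comp assms rep[OF B])
    then show "(1 / 2 ^ k) *s wave u w (\<eta> \<circ> rep B) (\<eta> x) = (1 / 2 ^ k) *s wave u w (rep (?C ** B)) (\<eta> x)"
      by simp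
  qed
  also have "\<dots> = avg u w (\<eta> x)"
    unfolding avg_def by (rule sum.reindex_bij_betw[OF bij])
  finally show ?thesis by simp
qed

lemma avg_eigen:
  assumes "u \<in> chars" "(2 * pi * \<i>) *s (cliff u *v w) = of_real t *s w"
  shows "avg u w \<in> eigenspace L \<Gamma> \<epsilon> \<rho> t"
proof -
  have "(\<lambda>x. ch (B *v u) x *s ((1 / 2 ^ k * ch u (- shift B)) *s (K (rep B) *v w))) \<in> cfield t" if B: "B \<in> F" for B
  proof (rule ch_cfield)
    let ?c = "1 / 2 ^ k * ch u (- shift B)"
    have "cliff (B *v u) *v (K (rep B) *v w) = K (rep B) *v (cliff u *v w)"
      using K_cliff[OF rep(1)[OF B], of u w] by (simp add: rep[OF B])
    then have "(2 * pi * \<i>) *s (cliff (B *v u) *v (?c *s (K (rep B) *v w))) =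
        ?c *s (K (rep B) *v ((2 * pi * \<i>) *s (cliff u *v w)))"
      unfolding vec.scale by (simp add: vec_eq_iff)
    also have "\<dots> = of_real t *s (?c *s (K (rep B) *v w))"
      unfolding assms(2) vec.scale by (simp add: vec_eq_iff)
    finally show "(2 * pi * \<i>) *s (cliff (B *v u) *v (?c *s (K (rep B) *v w))) = of_real t *s (?c *s (K (rep B) *v w))" .
  qed
  then have "(\<Sum>B\<in>F. (\<lambda>x. ch (B *v u) x *s ((1 / 2 ^ k * ch u (- shift B)) *s (K (rep B) *v w)))) \<in> cfield t"
    by (rule field.subspace_sum[OF cfield_subspace])
  moreover have "(\<Sum>B\<in>F. (\<lambda>x. ch (B *v u) x *s ((1 / 2 ^ k * ch u (- shift B)) *s (K (rep B) *v w)))) = avg u w"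
    unfolding fun_eq_iff sum_fun_apply avg_def
    by (intro allI sum.cong refl, simp only: wave_rep) (simp add: vec_eq_iff mult_ac)
  ultimately show ?thesis by (simp add: eigenspace_iff avg_equivariant assms(1))
qed

lemma avg_fixed:
  assumes "\<psi> \<in> eigenspace L \<Gamma> \<epsilon> \<rho> t"
  shows "\<psi> x = (\<Sum>B\<in>F. (1 / 2 ^ k) *s (K (rep B) *v \<psi> (inv_into UNIV (rep B) x)))"
proof -
  have "K (rep B) *v \<psi> (inv_into UNIV (rep B) x) = \<psi> x" if "B \<in> F" for B
  proof -
    have "\<psi> (rep B (inv_into UNIV (rep B) x)) = K (rep B) *v \<psi> (inv_into UNIV (rep B) x)"
      using assms rep(1)[OF that] by (simp add: eigenspace_iff)
    then show ?thesis by (simp add: inv_apply rep[OF that])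
  qed
  then have "(\<Sum>B\<in>F. (1 / 2 ^ k) *s (K (rep B) *v \<psi> (inv_into UNIV (rep B) x))) = (\<Sum>B\<in>F. (1 / 2 ^ k) *s \<psi> x)"
    by (intro sum.cong) auto
  also have "\<dots> = (\<Sum>B\<in>F. 1 / 2 ^ k) *s \<psi> x" by (rule vec.scale_sum_left[symmetric])
  also have "\<dots> = \<psi> x" by (simp add: F_facts(2))
  finally show ?thesis by simp
qed

lemma avg_add: "avg u (v + w) x = avg u v x + avg u w x"
  by (simp add: avg_def wave_def matrix_vector_right_distrib vector_add_ldistrib sum.distrib)

lemma avg_scale: "avg u (c *s w) x = c *s avg u w x"
  unfolding avg_def wave_def cscale_sum_right vec.scale by (simp add: vec_eq_iff mult_ac)

text \<open>The summand of \<open>B\<close> is a wave of frequency \<open>B u\<close>, so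
  orthogonality of characters keeps the stabiliser of \<open>u\<close> only.\<close>

lemma coef_avg:
  assumes "u \<in> chars"
  shows "coef u (avg u w) = (\<Sum>B\<in>{B\<in>F. B *v u = u}. (1 / 2 ^ k * ch u (- shift B)) *s (K (rep B) *v w))"
proof -
  let ?w = "\<lambda>B. (1 / 2 ^ k * ch u (- shift B)) *s (K (rep B) *v w)"
  have "ch (- u) x *s avg u w x = (\<Sum>B\<in>F. ch (B *v u - u) x *s ?w B)" for x
  proof -
    have "ch (- u) x *s ((1 / 2 ^ k) *s wave u w (rep B) x) = ch (B *v u - u) x *s ?w B" if "B \<in> F" for B
    proof -
      have "ch (B *v u - u) x = ch (- u) x * ch (B *v u) x" by (simp flip: ch_add_left)
      then show ?thesis unfolding wave_rep[OF that] by (simp add: vec_eq_iff mult_ac)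
    qed
    then show ?thesis unfolding avg_def cscale_sum_right by (rule sum.cong[OF refl])
  qed
  then have "coef u (avg u w) = (\<Sum>B\<in>F. cell.M (\<lambda>x. ch (B *v u - u) x *s ?w B))"
    unfolding coef_def by (simp only:) (rule cell.M_sum[OF F_facts(1)]; intro continuous_intros)
  also have "\<dots> = (\<Sum>B\<in>F. if B *v u = u then ?w B else 0)"
    by (intro sum.cong refl) (subst cell.M_char, auto intro!: chars_diff chars_rot assms)
  also have "\<dots> = (\<Sum>B\<in>{B\<in>F. B *v u = u}. ?w B)"
    by (rule sum.inter_filter[OF F_facts(1), symmetric])
  finally show ?thesis .
qed

lemma coef_add:
  "continuous_on UNIV \<psi> \<Longrightarrow> continuous_on UNIV \<phi> \<Longrightarrow> coef u (\<lambda>x. \<psi> x + \<phi> x) = coef u \<psi> + coef u \<phi>"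
  unfolding coef_def vector_add_ldistrib by (rule cell.M_add) (intro continuous_intros; assumption)+

lemma coef_scale:
  assumes "continuous_on UNIV \<psi>" shows "coef u (\<lambda>x. c *s \<psi> x) = c *s coef u \<psi>"
proof -
  have "coef u (\<lambda>x. c *s \<psi> x) = cell.M (\<lambda>x. c *s (ch (- u) x *s \<psi> x))"
    unfolding coef_def by (simp add: mult.commute)
  also have "\<dots> = c *s coef u \<psi>"
    unfolding coef_def by (rule cell.M_bounded_linear[OF cscale_bounded_linear]) (intro continuous_intros assms)
  finally show ?thesis .
qed

lemma eigenspace_subspace: "field.subspace (eigenspace L \<Gamma> \<epsilon> \<rho> t)"
proof -
  have "(\<lambda>x. 0) \<in> eigenspace L \<Gamma> \<epsilon> \<rho> t"
    using field.subspace_0[OF cfield_subspace, of t] by (simp add: eigenspace_iff zero_fun_def)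
  moreover have "\<psi> + \<phi> \<in> eigenspace L \<Gamma> \<epsilon> \<rho> t"
    if "\<psi> \<in> eigenspace L \<Gamma> \<epsilon> \<rho> t" "\<phi> \<in> eigenspace L \<Gamma> \<epsilon> \<rho> t" for \<psi> \<phi>
    using that field.subspace_add[OF cfield_subspace, of \<psi> t \<phi>]
    by (auto simp: eigenspace_iff matrix_vector_right_distrib)
  moreover have "field_scale c \<psi> \<in> eigenspace L \<Gamma> \<epsilon> \<rho> t" if "\<psi> \<in> eigenspace L \<Gamma> \<epsilon> \<rho> t" for c \<psi>
    using that field.subspace_scale[OF cfield_subspace, of \<psi> t c]
    by (auto simp: eigenspace_iff field_scale_def vec.scale)
  ultimately show ?thesis by (auto simp: field.subspace_def zero_fun_def)
qed

text \<open>\<open>Q u\<close> projects onto the solutions of the eigenvalue equation at frequency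
  \<open>u\<close>. The averages of its columns form a frame with the components of the Fourier
  coefficients as functionals, and \<open>coef_avg\<close> evaluates the frame trace. Leaving
  \<alpha> and \<beta> open covers the kernel and the nonzero eigenvalues alike.\<close>

lemma dimension_formula:
  fixes t :: real and \<alpha> \<beta> :: complex
  defines "S \<equiv> dual_shell \<Gamma> \<epsilon> (\<bar>t\<bar> / (2 * pi))"
    and "W \<equiv> eigenspace L \<Gamma> \<epsilon> \<rho> t"
    and "Q \<equiv> (\<lambda>u (w :: complex^('s \<times> 'v)). \<alpha> *s w + \<beta> *s (cliff u *v w))"
  assumes Q1: "\<And>u w. u \<in> S \<Longrightarrow> (2 * pi * \<i>) *s (cliff u *v Q u w) = of_real t *s Q u w"
    and Q2: "\<And>u w. u \<in> S \<Longrightarrow> (2 * pi * \<i>) *s (cliff u *v w) = of_real t *s w \<Longrightarrow> Q u w = w"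
  shows "finite_mult L \<Gamma> \<epsilon> \<rho> t"
    and "of_nat (dirac_mult L \<Gamma> \<epsilon> \<rho> t) = (\<Sum>u\<in>S. \<Sum>B\<in>{B\<in>F. B *v u = u}. (1 / 2 ^ k * ch u (- shift B)) *
      ((\<alpha> * trace (L (\<epsilon> (rep B))) + \<beta> * trace (L (\<epsilon> (rep B) * cl_vec u))) * trace (\<rho> (rep B))))"
proof -
  have S: "finite S" "\<And>u. u \<in> S \<Longrightarrow> u \<in> chars"
    unfolding S_def using finite_shell by (auto simp: dual_shell_chars)
  let ?X = "S \<times> (UNIV :: ('s \<times> 'v) set)"
  define b where "b x = avg (fst x) (Q (fst x) (axis (snd x) 1))" for x
  define l where "l x \<psi> = coef (fst x) \<psi> $ snd x" for x \<psi>
  have bW: "b x \<in> W" if "x \<in> ?X" for x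
    using that unfolding b_def W_def by (auto intro!: avg_eigen S Q1)
  have Wc: "continuous_on UNIV \<psi>" if "\<psi> \<in> W" for \<psi>
    using that by (auto simp: W_def eigenspace_iff cfield_def smooth_continuous)
  have ladd: "l x (\<psi> + \<phi>) = l x \<psi> + l x \<phi>" if "\<psi> \<in> W" "\<phi> \<in> W" for x \<psi> \<phi>
    using coef_add[OF Wc[OF that(1)] Wc[OF that(2)]] by (auto simp: l_def plus_fun_def)
  have lscale: "l x (field_scale c \<psi>) = c * l x \<psi>" if "\<psi> \<in> W" for x c \<psi>
    using coef_scale[OF Wc[OF that]] by (auto simp: l_def field_scale_def)
  have expand: "\<psi> = (\<Sum>x\<in>?X. field_scale (l x \<psi>) (b x))" if \<psi>: "\<psi> \<in> W" for \<psi>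
  proof
    fix x
    have c\<psi>: "\<psi> \<in> cfield t" "quasi \<psi>"
      using \<psi> eigenspace_quasi by (auto simp: W_def eigenspace_iff)
    have "(\<Sum>x\<in>?X. field_scale (l x \<psi>) (b x)) x = (\<Sum>u\<in>S. \<Sum>p\<in>UNIV. coef u \<psi> $ p *s avg u (Q u (axis p 1)) x)"
      by (simp add: sum_fun_apply field_scale_def l_def b_def split_beta sum.cartesian_product)
    also have "\<dots> = (\<Sum>u\<in>S. avg u (Q u (coef u \<psi>)) x)"
    proof (intro sum.cong refl)
      fix u
      have "avg u (Q u (v + w)) x = avg u (Q u v) x + avg u (Q u w) x" for v w
      proof -
        have "Q u (v + w) = Q u v + Q u w"
          by (simp add: Q_def matrix_vector_right_distrib vector_add_ldistrib)
        then show ?thesis by (simp add: avg_add)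
      qed
      moreover have "avg u (Q u (c *s w)) x = c *s avg u (Q u w) x" for c w
      proof -
        have "Q u (c *s w) = c *s Q u w" by (simp add: Q_def vec.scale) (simp add: vec_eq_iff algebra_simps)
        then show ?thesis by (simp add: avg_scale)
      qed
      ultimately show "(\<Sum>p\<in>UNIV. coef u \<psi> $ p *s avg u (Q u (axis p 1)) x) = avg u (Q u (coef u \<psi>)) x"
        by (rule cscale_hom_expand[symmetric])
    qed
    also have "\<dots> = (\<Sum>u\<in>S. avg u (coef u \<psi>) x)"
      by (intro sum.cong refl arg_cong[where f = "\<lambda>w. avg _ w x"] Q2 coef_eigen[OF c\<psi>] S)
    \<comment> \<open>Exchanging the sums turns the sum of averaged waves into the average of
      \<psi>, which is \<psi> by equivariance.\<close>
    also have "\<dots> = (\<Sum>B\<in>F. (1 / 2 ^ k) *s (K (rep B) *v (\<Sum>u\<in>S. ch u (inv_into UNIV (rep B) x) *s coef u \<psi>)))"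
      unfolding avg_def wave_def
      by (subst sum.swap) (simp only: mult_vec_sum cscale_sum_right vec.scale)
    also have "\<dots> = \<psi> x"
      unfolding avg_fixed[OF \<psi>[unfolded W_def], of x] S_def
      by (simp only: fourier_expansion[OF c\<psi>, symmetric])
    finally show "\<psi> x = (\<Sum>x\<in>?X. field_scale (l x \<psi>) (b x)) x" by simp
  qed
  have fX: "finite ?X" using S(1) by simp
  have "W \<subseteq> field.span (b ` ?X)"
  proof
    fix \<psi> assume "\<psi> \<in> W"
    then have "\<psi> = (\<Sum>x\<in>?X. field_scale (l x \<psi>) (b x))" by (rule expand)
    also have "\<dots> \<in> field.span (b ` ?X)"
      by (intro field.span_sum field.span_scale field.span_base imageI)
    finally show "\<psi> \<in> field.span (b ` ?X)" .
  qed
  then show "finite_mult L \<Gamma> \<epsilon> \<rho> t"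
    unfolding finite_mult_def W_def using fX by blast
  have "of_nat (dirac_mult L \<Gamma> \<epsilon> \<rho> t) = (\<Sum>x\<in>?X. l x (b x))"
    unfolding dirac_mult_def W_def[symmetric]
    by (rule field.dim_eq_frame_trace[OF fX _ bW ladd lscale expand])
      (auto simp: W_def eigenspace_subspace)
  also have "\<dots> = (\<Sum>u\<in>S. \<Sum>p\<in>UNIV. coef u (avg u (Q u (axis p 1))) $ p)"
    by (simp add: l_def b_def split_beta sum.cartesian_product)
  also have "\<dots> = (\<Sum>u\<in>S. \<Sum>B\<in>{B\<in>F. B *v u = u}. (1 / 2 ^ k * ch u (- shift B)) *
      ((\<alpha> * trace (L (\<epsilon> (rep B))) + \<beta> * trace (L (\<epsilon> (rep B) * cl_vec u))) * trace (\<rho> (rep B))))"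
  proof (intro sum.cong refl)
    fix u assume u: "u \<in> S"
    have tr: "(\<Sum>p\<in>UNIV. (K \<gamma> *v Q u (axis p 1)) $ p) =
        (\<alpha> * trace (L (\<epsilon> \<gamma>)) + \<beta> * trace (L (\<epsilon> \<gamma> * cl_vec u))) * trace (\<rho> \<gamma>)" for \<gamma>
    proof -
      have "(\<Sum>p\<in>UNIV. (K \<gamma> *v Q u (axis p 1)) $ p) =
          \<alpha> * (\<Sum>p\<in>UNIV. (K \<gamma> *v axis p 1) $ p) + \<beta> * (\<Sum>p\<in>UNIV. ((K \<gamma> ** cliff u) *v axis p 1) $ p)"
        unfolding Q_def matrix_vector_right_distrib vec.scale
        by (simp add: sum.distrib sum_distrib_left matrix_vector_mul_assoc)
      then show ?thesis
        unfolding sum_component_trace trace_K trace_K_cliff by (simp add: algebra_simps)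
    qed
    have "(\<Sum>p\<in>UNIV. coef u (avg u (Q u (axis p 1))) $ p) =
       (\<Sum>p\<in>UNIV. \<Sum>B\<in>{B\<in>F. B *v u = u}. (1 / 2 ^ k * ch u (- shift B)) * (K (rep B) *v Q u (axis p 1)) $ p)"
      by (simp only: coef_avg[OF S(2)[OF u]] sum_component vector_smult_component)
    also have "\<dots> = (\<Sum>B\<in>{B\<in>F. B *v u = u}. (1 / 2 ^ k * ch u (- shift B)) * (\<Sum>p\<in>UNIV. (K (rep B) *v Q u (axis p 1)) $ p))"
      by (subst sum.swap) (simp only: sum_distrib_left)
    finally show "(\<Sum>p\<in>UNIV. coef u (avg u (Q u (axis p 1))) $ p) =
      (\<Sum>B\<in>{B\<in>F. B *v u = u}. (1 / 2 ^ k * ch u (- shift B)) *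
      ((\<alpha> * trace (L (\<epsilon> (rep B))) + \<beta> * trace (L (\<epsilon> (rep B) * cl_vec u))) * trace (\<rho> (rep B))))"
      by (simp only: tr)
  qed
  finally show "of_nat (dirac_mult L \<Gamma> \<epsilon> \<rho> t) = (\<Sum>u\<in>S. \<Sum>B\<in>{B\<in>F. B *v u = u}. (1 / 2 ^ k * ch u (- shift B)) *
      ((\<alpha> * trace (L (\<epsilon> (rep B))) + \<beta> * trace (L (\<epsilon> (rep B) * cl_vec u))) * trace (\<rho> (rep B))))" .
qed

end

section \<open>Multiplicities\<close>

context spinor_rep
begin

lemma trace_L_scale: "trace (L (r *\<^sub>R x)) = of_real r * trace (L x)"
  by (simp add: L_simps trace_def sum_distrib_left) (simp add: scaleR_conv_of_real)

lemma trace_L_one: "trace (L 1) = 2 ^ (CARD('n) div 2)"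
  by (simp add: L_one trace_def mat_def card_s)

end

text \<open>\<open>fixdim_one\<close> only provides some fixed unit vector; a prescribed one differs
  from it by a sign.\<close>

lemma orth_fixed_unit:
  fixes B :: "'n::finite emat"
  assumes "orthogonal_matrix B" "B ** B = mat 1" "fixdim B = 1" and w: "norm w = 1" "B *v w = w"
  shows "v \<bullet> w = 0 \<Longrightarrow> B *v v = - v" and "B *v x = x \<Longrightarrow> x = (x \<bullet> w) *\<^sub>R w"
    and "B *v x = (2 * (x \<bullet> w)) *\<^sub>R w - x"
proof -
  obtain w0 where w0: "norm w0 = 1" "B *v w0 = w0" "\<And>v. v \<bullet> w0 = 0 \<Longrightarrow> B *v v = - v"
    "\<And>x. B *v x = x \<Longrightarrow> x = (x \<bullet> w0) *\<^sub>R w0"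
    using fixdim_one[OF assms(1-3)] by metis
  have ww0: "w = (w \<bullet> w0) *\<^sub>R w0" by (rule w0(4)[OF w(2)])
  then have "\<bar>w \<bullet> w0\<bar> = 1" using w(1) w0(1) by (metis mult_1_right norm_scaleR)
  then have "w = w0 \<or> w = - w0" using ww0 by (cases "w \<bullet> w0 \<ge> 0") auto
  then have pm: "(v \<bullet> w = 0) = (v \<bullet> w0 = 0)" "(v \<bullet> w) *\<^sub>R w = (v \<bullet> w0) *\<^sub>R w0" for v by auto
  show 1: "B *v v = - v" if "v \<bullet> w = 0" for v using w0(3) pm that by simp
  show "x = (x \<bullet> w) *\<^sub>R w" if "B *v x = x" using w0(4)[OF that] pm by simp
  have "(x - (x \<bullet> w) *\<^sub>R w) \<bullet> w = 0" using w(1) by (simp add: inner_diff_left norm_eq_1)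
  then have "B *v (x - (x \<bullet> w) *\<^sub>R w) = - (x - (x \<bullet> w) *\<^sub>R w)" by (rule 1)
  then have "B *v x - (x \<bullet> w) *\<^sub>R w = (x \<bullet> w) *\<^sub>R w - x"
    by (simp add: matrix_vector_mult_diff_distrib matrix_vector_mult_scaleR w(2))
  then have "B *v x = (x \<bullet> w) *\<^sub>R w + (x \<bullet> w) *\<^sub>R w - x" by (simp add: algebra_simps)
  then show "B *v x = (2 * (x \<bullet> w)) *\<^sub>R w - x" by (simp only: mult_2 scaleR_add_left)
qed

lemma fixdim_mat_1: "fixdim (mat 1 :: 'n::finite emat) = CARD('n)"
  by (simp add: fixdim_def dim_UNIV)

context flat_spin
begin

text \<open>If the lifts differ by \<open>transl v\<close>, both the phase and the spin element
  change by \<open>delta \<epsilon> v\<close>, and its square is 1. The twist ignores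
  translations.\<close>

lemma rep_change:
  assumes "BL B b \<in> \<Gamma>" "B \<in> F" "u \<in> chars"
  shows "ch u (- b) * trace (L (\<epsilon> (BL B b) * x)) = ch u (- shift B) * trace (L (\<epsilon> (rep B) * x))"
    and "trace (\<rho> (BL B b)) = trace (\<rho> (rep B))"
proof -
  note r = rep[OF assms(2)]
  have orth: "orthogonal_matrix B" by (rule rot_orth[OF assms(2)])
  have "rot (rep B) = rot (BL B b)" by (simp add: r rot_BL[OF orth])
  then obtain v where v: "v \<in> \<Lambda>" "BL B b = rep B \<circ> transl v" by (rule same_rot[OF r(1) assms(1)])
  have "BL B b = BL B (shift B + v)"
    unfolding v(2) by (subst rep_BL[OF assms(2)]) (simp add: BL_def fun_eq_iff add_ac)
  then have b: "b = shift B + v" by (rule BL_inject(2)[OF orth])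
  have \<epsilon>: "\<epsilon> (BL B b) = delta \<epsilon> v *\<^sub>R \<epsilon> (rep B)"
    unfolding v(2) by (simp add: \<epsilon>_comp r latticeD v(1) \<epsilon>_lattice) (simp add: of_real_def)
  have "ch u (- b) = ch u (- shift B) * ch (- u) v"
    by (simp add: b ch_def cis_mult inner_add_right inner_diff_right algebra_simps)
  also have "ch (- u) v = of_real (delta \<epsilon> v)" by (rule charsD[OF chars_uminus[OF assms(3)] v(1)])
  finally have "ch u (- b) * trace (L (\<epsilon> (BL B b) * x)) =
      ch u (- shift B) * (of_real (delta \<epsilon> v) * of_real (delta \<epsilon> v)) * trace (L (\<epsilon> (rep B) * x))"
    by (simp add: \<epsilon> trace_L_scale)
  then show "ch u (- b) * trace (L (\<epsilon> (BL B b) * x)) = ch u (- shift B) * trace (L (\<epsilon> (rep B) * x))"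
    by (simp add: delta_square[OF v(1)] flip: of_real_mult)
  show "trace (\<rho> (BL B b)) = trace (\<rho> (rep B))"
    unfolding v(2) by (simp add: \<rho>_comp r latticeD v(1) \<rho>_transl)
qed

text \<open>The anticommuting vector is one that \<open>B\<close> negates.\<close>

lemma trace_rep_zero:
  assumes "B \<in> F" "B \<noteq> mat 1" shows "trace (L (\<epsilon> (rep B))) = 0"
proof -
  obtain v where v: "norm v = 1" "B *v v = - v"
    by (rule involution_neg_vector[OF F_facts(3)[OF assms(1)] assms(2)])
  have "cl_vec (B *v v) * \<epsilon> (rep B) = \<epsilon> (rep B) * cl_vec v"
    using \<epsilon>_vec[OF rep(1)[OF assms(1)], of v] by (simp add: rep[OF assms(1)])
  then have "- (cl_vec v * \<epsilon> (rep B)) = \<epsilon> (rep B) * cl_vec v"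
    by (simp add: v(2) cl_vec_simps)
  then have "cl_vec v * \<epsilon> (rep B) = - (\<epsilon> (rep B) * cl_vec v)" by (metis minus_minus)
  then show ?thesis by (rule trace_anticommute_zero[OF v(1)])
qed

text \<open>The anticommuting vector is a fixed one orthogonal to \<open>u\<close>: it commutes with
  the spin element and anticommutes with \<open>u\<close>.\<close>

lemma trace_rep_vec_zero:
  assumes "B \<in> F" "fixdim B \<noteq> 1" "B *v u = u" "u \<noteq> 0"
  shows "trace (L (\<epsilon> (rep B) * cl_vec u)) = 0"
proof -
  obtain v where v: "norm v = 1" "v \<bullet> u = 0" "B *v v = v"
    by (rule fixdim_not_one[OF assms(3,4,2)])
  have "cl_vec v * \<epsilon> (rep B) = \<epsilon> (rep B) * cl_vec v"
    using \<epsilon>_vec[OF rep(1)[OF assms(1)], of v] by (simp add: rep[OF assms(1)] v(3))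
  then have "cl_vec v * (\<epsilon> (rep B) * cl_vec u) = \<epsilon> (rep B) * (cl_vec v * cl_vec u)"
    by (simp flip: mult.assoc)
  also have "\<dots> = - (\<epsilon> (rep B) * cl_vec u * cl_vec v)"
    by (simp add: cl_vec_orthogonal[OF v(2)] mult.assoc)
  finally show ?thesis by (rule trace_anticommute_zero[OF v(1)])
qed

text \<open>\<open>rep (mat 1)\<close> may be any lattice translation, so the identity is brought in
  through \<open>rep_change\<close>.\<close>

lemma term_one:
  assumes "u \<in> chars"
  shows "ch u (- shift (mat 1)) * trace (L (\<epsilon> (rep (mat 1)) * x)) = trace (L x)"
    and "trace (\<rho> (rep (mat 1))) = of_nat CARD('v)"
proof -
  have 0: "BL (mat 1) 0 \<in> \<Gamma>" by (simp add: BL_id id_mem)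
  have "\<epsilon> (BL (mat 1) 0) = 1" "\<rho> (BL (mat 1) 0) = mat 1"
    using \<epsilon>_lattice(1)[OF lattice.zero_mem] \<rho>_transl[OF lattice.zero_mem] by (simp_all add: delta_zero)
  then show "ch u (- shift (mat 1)) * trace (L (\<epsilon> (rep (mat 1)) * x)) = trace (L x)"
    "trace (\<rho> (rep (mat 1))) = of_nat CARD('v)"
    using rep_change(1)[OF 0 one_F assms, of x] rep_change(2)[OF 0 one_F assms] by (simp_all add: trace_def mat_def)
qed

lemma spin_trivial_iff: "spin_trivial \<Gamma> \<epsilon> \<longleftrightarrow> 0 \<in> chars"
proof -
  have "\<epsilon> (transl v) = 1 \<longleftrightarrow> complex_of_real (delta \<epsilon> v) = 1" if "v \<in> \<Lambda>" for v
    using \<epsilon>_lattice(1)[OF that] by simp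
  then show ?thesis by (auto simp: spin_trivial_def chars_def)
qed

text \<open>The only possible frequency is 0, where Clifford multiplication vanishes and the
  projector is the identity (\<alpha> = 1, \<beta> = 0). Every \<open>B\<close> fixes it, and all
  traces but that of \<open>mat 1\<close> are zero.\<close>

lemma harmonic:
  "finite_mult L \<Gamma> \<epsilon> \<rho> 0"
  "of_nat (dirac_mult L \<Gamma> \<epsilon> \<rho> 0) =
     (if spin_trivial \<Gamma> \<epsilon> then 2 ^ (CARD('n) div 2) * of_nat CARD('v) / 2 ^ k else (0 :: complex))"
proof -
  have S: "dual_shell \<Gamma> \<epsilon> (\<bar>0\<bar> / (2 * pi)) = (if spin_trivial \<Gamma> \<epsilon> then {0} else {})"
    by (auto simp: dual_shell_chars spin_trivial_iff)
  have c0: "cliff 0 *v (w :: complex^('s \<times> 'v)) = 0" for w by (subst cliff_sum) simp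
  have Q1: "(2 * pi * \<i>) *s (cliff u *v (1 *s w + 0 *s (cliff u *v w))) = of_real 0 *s (1 *s w + 0 *s (cliff u *v w))"
    if "u \<in> dual_shell \<Gamma> \<epsilon> (\<bar>0\<bar> / (2 * pi))" for u and w :: "complex^('s \<times> 'v)"
  proof -
    have "u = 0" using that by (simp add: dual_shell_chars)
    then show ?thesis by (simp add: c0)
  qed
  note df = dimension_formula[of 0 1 0, OF Q1]
  show "finite_mult L \<Gamma> \<epsilon> \<rho> 0" by (rule df(1)) auto
  have "of_nat (dirac_mult L \<Gamma> \<epsilon> \<rho> 0) = (\<Sum>u\<in>dual_shell \<Gamma> \<epsilon> (\<bar>0\<bar> / (2 * pi)). \<Sum>B\<in>{B\<in>F. B *v u = u}.
     (1 / 2 ^ k * ch u (- shift B)) * ((1 * trace (L (\<epsilon> (rep B))) + 0 * trace (L (\<epsilon> (rep B) * cl_vec u))) * trace (\<rho> (rep B))))"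
    by (rule df(2)) auto
  also have "\<dots> = (if spin_trivial \<Gamma> \<epsilon> then (\<Sum>B\<in>F. (1 / 2 ^ k) * trace (L (\<epsilon> (rep B))) * trace (\<rho> (rep B))) else 0)"
    unfolding S by simp
  also have "\<dots> = (if spin_trivial \<Gamma> \<epsilon> then 2 ^ (CARD('n) div 2) * of_nat CARD('v) / 2 ^ k else 0)"
  proof (cases "spin_trivial \<Gamma> \<epsilon>")
    case True
    then have 0: "0 \<in> chars" by (simp add: spin_trivial_iff)
    have "(\<Sum>B\<in>F. (1 / 2 ^ k) * trace (L (\<epsilon> (rep B))) * trace (\<rho> (rep B))) =
        (\<Sum>B\<in>F. if B = mat 1 then (1 / 2 ^ k) * trace (L (\<epsilon> (rep (mat 1)))) * trace (\<rho> (rep (mat 1))) else 0)"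
      by (intro sum.cong) (auto simp: trace_rep_zero)
    also have "\<dots> = (1 / 2 ^ k) * trace (L (\<epsilon> (rep (mat 1)))) * trace (\<rho> (rep (mat 1)))"
      using F_facts(1) one_F by simp
    also have "\<dots> = 2 ^ (CARD('n) div 2) * of_nat CARD('v) / 2 ^ k"
      using term_one(1)[OF 0, of 1] term_one(2)[OF 0] by (simp add: trace_L_one)
    finally show ?thesis using True by simp
  qed simp
  finally show "of_nat (dirac_mult L \<Gamma> \<epsilon> \<rho> 0) =
     (if spin_trivial \<Gamma> \<epsilon> then 2 ^ (CARD('n) div 2) * of_nat CARD('v) / 2 ^ k else (0 :: complex))" .
qed

text \<open>The identity is left out because for \<open>n = 1\<close> it also has a one-dimensional
  fixed space, while \<open>multiplicity\<close> counts it in the generic term.\<close>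

definition F1 :: "'n emat set" where "F1 = {B \<in> F. B \<noteq> mat 1 \<and> fixdim B = 1}"

text \<open>The odd part of the trace at \<open>B\<close>. The factor with \<i> comes from the
  projector in \<open>multiplicity\<close>; the sign of the eigenvalue and the group order are split
  off.\<close>

definition contrib :: "real \<Rightarrow> 'n emat \<Rightarrow> complex" where
  "contrib \<mu> B = (\<Sum>u\<in>{u\<in>dual_shell \<Gamma> \<epsilon> \<mu>. B *v u = u}.
     \<i> / (2 * of_real \<mu>) * (ch u (- shift B) * trace (L (\<epsilon> (rep B) * cl_vec u))) * trace (\<rho> (rep B)))"

text \<open>As \<open>cliff u\<close> squares to \<open>- \<mu>^2\<close>, multiplication by
  \<open>s i / \<mu>\<close> makes it an involution whose +1 eigenvectors solve the eigenvalue
  equation; the projector is half the sum of the identity and this involution.\<close>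

lemma multiplicity:
  assumes \<mu>: "\<mu> > 0" and s: "s \<in> {1, -1}"
  shows "finite_mult L \<Gamma> \<epsilon> \<rho> (s * (2 * pi * \<mu>))"
    and "of_nat (dirac_mult L \<Gamma> \<epsilon> \<rho> (s * (2 * pi * \<mu>))) =
      (2 ^ (CARD('n) div 2) / 2 * of_nat CARD('v) * of_nat (card (dual_shell \<Gamma> \<epsilon> \<mu>)) +
        of_real s * (\<Sum>B\<in>F1. contrib \<mu> B)) / 2 ^ k"
proof -
  let ?t = "s * (2 * pi * \<mu>)" and ?\<beta> = "of_real s * \<i> / (2 * of_real \<mu>) :: complex"
  let ?S = "dual_shell \<Gamma> \<epsilon> \<mu>" and ?m = "CARD('n) div 2"
  have t: "\<bar>?t\<bar> / (2 * pi) = \<mu>" using \<mu> s by (auto simp: abs_mult)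
  have ss: "complex_of_real s * of_real s = 1" using s by auto
  have sq: "cliff u *v (cliff u *v w) = (- (of_real \<mu> * of_real \<mu>)) *s w"
    if "u \<in> ?S" for u and w :: "complex^('s \<times> 'v)"
    using that by (simp add: dual_shell_chars cliff_square power2_norm_eq_inner[symmetric] power2_eq_square)
  have Q1: "(2 * pi * \<i>) *s (cliff u *v ((1/2) *s w + ?\<beta> *s (cliff u *v w))) =
      of_real ?t *s ((1/2) *s w + ?\<beta> *s (cliff u *v w))"
    if "u \<in> dual_shell \<Gamma> \<epsilon> (\<bar>?t\<bar> / (2 * pi))" for u and w :: "complex^('s \<times> 'v)"
  proof -
    have u: "u \<in> ?S" using that t by simp
    have "(2 * pi * \<i>) *s (cliff u *v ((1/2) *s w + ?\<beta> *s (cliff u *v w))) =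
        (pi * \<i>) *s (cliff u *v w) + (2 * pi * \<i> * ?\<beta> * (- (of_real \<mu> * of_real \<mu>))) *s w"
      unfolding matrix_vector_right_distrib vec.scale sq[OF u] by (simp add: vec_eq_iff algebra_simps)
    also have "2 * pi * \<i> * ?\<beta> * (- (of_real \<mu> * of_real \<mu>)) = of_real ?t * (1/2)"
      using \<mu> by (simp add: field_simps)
    also have "pi * \<i> = of_real ?t * ?\<beta>" using \<mu> ss by (simp add: field_simps)
    finally show ?thesis by (simp add: vec_eq_iff algebra_simps)
  qed
  have Q2: "(1/2) *s w + ?\<beta> *s (cliff u *v w) = w"
    if "(2 * pi * \<i>) *s (cliff u *v w) = of_real ?t *s w" for u and w :: "complex^('s \<times> 'v)"
  proof -
    have "?\<beta> *s (cliff u *v w) = (?\<beta> / (2 * pi * \<i>)) *s ((2 * pi * \<i>) *s (cliff u *v w))"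
      by (simp add: vec_eq_iff)
    also have "\<dots> = (?\<beta> / (2 * pi * \<i>) * of_real ?t) *s w" unfolding that by (simp add: vec_eq_iff)
    also have "?\<beta> / (2 * pi * \<i>) * of_real ?t = 1/2" using \<mu> ss by (simp add: field_simps)
    finally have 3: "?\<beta> *s (cliff u *v w) = (1/2) *s w" .
    show ?thesis unfolding 3 by (simp add: vec_eq_iff)
  qed
  note df = dimension_formula[of ?t "1/2" ?\<beta>, OF Q1 Q2, unfolded t]
  show "finite_mult L \<Gamma> \<epsilon> \<rho> ?t" by (rule df(1)) auto
  let ?g = "\<lambda>u B. (1 / 2 ^ k * ch u (- shift B)) * ((1/2 * trace (L (\<epsilon> (rep B))) +
      ?\<beta> * trace (L (\<epsilon> (rep B) * cl_vec u))) * trace (\<rho> (rep B)))"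
  have "of_nat (dirac_mult L \<Gamma> \<epsilon> \<rho> ?t) = (\<Sum>u\<in>?S. \<Sum>B\<in>{B\<in>F. B *v u = u}. ?g u B)"
    by (rule df(2)) auto
  also have "\<dots> = (\<Sum>u\<in>?S. \<Sum>B\<in>F. if B *v u = u then ?g u B else 0)"
    by (simp only: sum.inter_filter[OF F_facts(1)])
  also have "\<dots> = (\<Sum>B\<in>F. \<Sum>u\<in>?S. if B *v u = u then ?g u B else 0)" by (rule sum.swap)
  also have "\<dots> = (\<Sum>B\<in>F. \<Sum>u\<in>{u\<in>?S. B *v u = u}. ?g u B)"
    by (simp only: sum.inter_filter[OF finite_shell])
  also have "\<dots> = (\<Sum>B\<in>F. (if B = mat 1 then 2 ^ ?m / 2 * of_nat CARD('v) * of_nat (card ?S) / 2 ^ k else 0)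
      + (if B \<in> F1 then of_real s * contrib \<mu> B / 2 ^ k else 0))"
  proof (rule sum.cong[OF refl])
    fix B assume B: "B \<in> F"
    show "(\<Sum>u\<in>{u\<in>?S. B *v u = u}. ?g u B) = (if B = mat 1 then 2 ^ ?m / 2 * of_nat CARD('v) * of_nat (card ?S) / 2 ^ k else 0)
      + (if B \<in> F1 then of_real s * contrib \<mu> B / 2 ^ k else 0)"
    proof (cases "B = mat 1")
      case True
      \<comment> \<open>The shell is symmetric under negation and the trace of Clifford
        multiplication is odd, so the identity contributes no odd part.\<close>
      have tr0: "(\<Sum>u\<in>?S. trace (L (cl_vec u))) = 0"
      proof -
        have "bij_betw uminus ?S ?S"
          by (rule bij_betwI[where g = uminus]) (auto simp: dual_shell_chars chars_uminus)
        then have "(\<Sum>u\<in>?S. trace (L (cl_vec (- u)))) = (\<Sum>u\<in>?S. trace (L (cl_vec u)))"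
          by (rule sum.reindex_bij_betw)
        then show ?thesis by (simp add: cl_vec_simps L_simps trace_uminus sum_negf)
      qed
      have "?g u (mat 1) = (1 / 2 ^ k) * of_nat CARD('v) * (2 ^ ?m / 2 + ?\<beta> * trace (L (cl_vec u)))" if "u \<in> ?S" for u
      proof -
        have u: "u \<in> chars" using that by (simp add: dual_shell_chars)
        have "?g u (mat 1) = (1 / 2 ^ k) * (1/2 * (ch u (- shift (mat 1)) * trace (L (\<epsilon> (rep (mat 1)) * 1))) +
           ?\<beta> * (ch u (- shift (mat 1)) * trace (L (\<epsilon> (rep (mat 1)) * cl_vec u)))) * trace (\<rho> (rep (mat 1)))"
          by (simp add: algebra_simps)
        then show ?thesis unfolding term_one[OF u] trace_L_one by (simp add: algebra_simps)
      qed
      then have "(\<Sum>u\<in>{u\<in>?S. B *v u = u}. ?g u B) = (\<Sum>u\<in>?S. (1 / 2 ^ k) * of_nat CARD('v) * (2 ^ ?m / 2 + ?\<beta> * trace (L (cl_vec u))))"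
        unfolding True by (intro sum.cong) auto
      also have "\<dots> = (1 / 2 ^ k) * of_nat CARD('v) * (2 ^ ?m / 2 * of_nat (card ?S) + ?\<beta> * (\<Sum>u\<in>?S. trace (L (cl_vec u))))"
        by (simp only: sum_distrib_left[symmetric] sum.distrib) (simp add: mult.commute)
      finally show ?thesis using True by (simp add: tr0 F1_def mult_ac)
    next
      case False
      have "(\<Sum>u\<in>{u\<in>?S. B *v u = u}. ?g u B) =
          (\<Sum>u\<in>{u\<in>?S. B *v u = u}. of_real s / 2 ^ k * (\<i> / (2 * of_real \<mu>) * (ch u (- shift B) * trace (L (\<epsilon> (rep B) * cl_vec u))) * trace (\<rho> (rep B))))"
        by (intro sum.cong refl) (simp add: trace_rep_zero[OF B False] mult_ac)
      also have "\<dots> = of_real s * contrib \<mu> B / 2 ^ k"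
        by (simp only: contrib_def sum_distrib_left[symmetric]) simp
      finally have 1: "(\<Sum>u\<in>{u\<in>?S. B *v u = u}. ?g u B) = of_real s * contrib \<mu> B / 2 ^ k" .
      show ?thesis
      proof (cases "B \<in> F1")
        case True
        then show ?thesis using False 1 by simp
      next
        case nF: False
        then have "fixdim B \<noteq> 1" using B False by (simp add: F1_def)
        then have "contrib \<mu> B = 0"
          unfolding contrib_def using trace_rep_vec_zero[OF B] \<mu>
          by (intro sum.neutral) (auto simp: dual_shell_chars)
        then show ?thesis unfolding 1 using False nF by simp
      qed
    qed
  qed
  also have "\<dots> = 2 ^ ?m / 2 * of_nat CARD('v) * of_nat (card ?S) / 2 ^ k + (\<Sum>B\<in>F1. of_real s * contrib \<mu> B / 2 ^ k)"
  proof -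
    have "(\<Sum>B\<in>F1. of_real s * contrib \<mu> B / 2 ^ k) = (\<Sum>B\<in>F. if B \<in> F1 then of_real s * contrib \<mu> B / 2 ^ k else 0)"
      using F_facts(1) by (subst sum.inter_restrict[symmetric]) (auto intro!: sum.cong simp: F1_def)
    then show ?thesis using F_facts(1) one_F by (simp add: sum.distrib)
  qed
  finally show "of_nat (dirac_mult L \<Gamma> \<epsilon> \<rho> ?t) =
      (2 ^ ?m / 2 * of_nat CARD('v) * of_nat (card ?S) + of_real s * (\<Sum>B\<in>F1. contrib \<mu> B)) / 2 ^ k"
    by (simp add: add_divide_distrib sum_distrib_left sum_divide_distrib)
qed

text \<open>The fixed unit vector may be either of the two, and \<kappa> and the sine change sign
  together with it. The sign \<kappa> is chosen before \<mu>, so it is common to all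
  frequencies.\<close>

lemma contrib_formula:
  assumes B: "B \<in> F1" and b: "BL B b \<in> \<Gamma>" and w: "norm w = 1" "B *v w = w"
  shows "odd CARD('n)" "(2 * (b \<bullet> w)) *\<^sub>R w \<in> \<Lambda>"
    "delta \<epsilon> ((2 * (b \<bullet> w)) *\<^sub>R w) = (-1) ^ (CARD('n) div 2)"
    "\<exists>\<kappa>\<in>{1, -1}. (CARD('n) \<ge> 2 \<longrightarrow> (\<forall>c>0. spin_sigma (\<epsilon> (BL B b)) (c *\<^sub>R w) = \<kappa>)) \<and>
      (\<forall>\<mu>>0. contrib \<mu> B = (if \<mu> *\<^sub>R w \<in> chars then of_real \<kappa> * (- (\<i> ^ Suc (CARD('n) div 2))) *
         2 ^ (CARD('n) div 2) * trace (\<rho> (BL B b)) * of_real (sin (2 * pi * \<mu> * (b \<bullet> w))) else 0))"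
proof -
  let ?m = "CARD('n) div 2" and ?g = "\<epsilon> (BL B b)"
  have BF: "B \<in> F" "fixdim B = 1" using B by (auto simp: F1_def)
  have orth: "orthogonal_matrix B" by (rule rot_orth[OF BF(1)])
  have rotb: "rot (BL B b) = B" by (rule rot_BL[OF orth])
  note fix1 = orth_fixed_unit[OF orth F_facts(3)[OF BF(1)] BF(2) w]
  have gv: "cl_vec (B *v x) * ?g = ?g * cl_vec x" for x
    using \<epsilon>_vec[OF b, of x] by (simp add: rotb)
  have com: "cl_vec w * ?g = ?g * cl_vec w" using gv[of w] by (simp add: w(2))
  have anti: "cl_vec v * ?g = - (?g * cl_vec v)" if "v \<bullet> w = 0" for v
  proof -
    have "- (cl_vec v * ?g) = ?g * cl_vec v" using gv[of v] fix1(1)[OF that] by (simp add: cl_vec_simps)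
    then show ?thesis by (metis minus_minus)
  qed
  note line = spin_fixed_line[OF \<epsilon>_Spin[OF b] w(1) com anti]
  show odd: "odd CARD('n)" by (rule line(1))
  \<comment> \<open>The square is the translation by \<open>b + B b\<close>, twice the projection of
    \<open>b\<close> to the fixed line.\<close>
  have sq: "BL B b \<circ> BL B b = transl ((2 * (b \<bullet> w)) *\<^sub>R w)"
    using BL_comp[OF orth, of B b b] by (simp add: F_facts(3)[OF BF(1)] F_symmetric[OF BF(1)] fix1(3))
  then show lat: "(2 * (b \<bullet> w)) *\<^sub>R w \<in> \<Lambda>" using comp_mem[OF b b] by (simp add: lattice_of_def)
  have "of_real (delta \<epsilon> ((2 * (b \<bullet> w)) *\<^sub>R w)) = (of_real ((-1) ^ ?m) :: 'n clifford)"
    using \<epsilon>_comp[OF b b] by (simp only: sq \<epsilon>_lattice(1)[OF lat] line(3))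
  then show "delta \<epsilon> ((2 * (b \<bullet> w)) *\<^sub>R w) = (-1) ^ ?m" by (simp only: of_real_eq_iff)
  obtain \<kappa> where \<kappa>: "\<kappa> \<in> {1, -1}" "?g * cl_vec w = \<kappa> *\<^sub>R cl_volume"
    "CARD('n) \<ge> 2 \<longrightarrow> (\<forall>c>0. spin_sigma ?g (c *\<^sub>R w) = \<kappa>)"
    using line(2) by blast
  let ?z = "of_real \<kappa> * (- (\<i> ^ Suc ?m)) * 2 ^ ?m :: complex"
  have "trace (L cl_volume) = - (\<i> ^ Suc ?m) * 2 ^ ?m"
    by (simp add: L_volume[OF odd] trace_def mat_def card_s)
  then have trw: "trace (L (?g * cl_vec w)) = ?z"
    by (simp add: \<kappa>(2) trace_L_scale)
  have contr: "contrib \<mu> B = (if \<mu> *\<^sub>R w \<in> chars then ?z * trace (\<rho> (BL B b)) * of_real (sin (2 * pi * \<mu> * (b \<bullet> w))) else 0)"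
    if \<mu>: "\<mu> > 0" for \<mu>
  proof -
    have set: "{u \<in> dual_shell \<Gamma> \<epsilon> \<mu>. B *v u = u} = (if \<mu> *\<^sub>R w \<in> chars then {\<mu> *\<^sub>R w, - (\<mu> *\<^sub>R w)} else {})"
    proof -
      have "u = \<mu> *\<^sub>R w \<or> u = - (\<mu> *\<^sub>R w)" if "norm u = \<mu>" "B *v u = u" for u
      proof -
        have u: "u = (u \<bullet> w) *\<^sub>R w" by (rule fix1(2)[OF that(2)])
        then have "\<bar>u \<bullet> w\<bar> = \<mu>" using that(1) w(1) by (metis mult_1_right norm_scaleR)
        then show ?thesis using u by (cases "u \<bullet> w \<ge> 0") auto
      qed
      note pm = this
      have neg: "- (\<mu> *\<^sub>R w) \<in> chars \<longleftrightarrow> \<mu> *\<^sub>R w \<in> chars" using chars_uminus by fastforce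
      have Bm: "B *v (\<mu> *\<^sub>R w) = \<mu> *\<^sub>R w" "B *v (- (\<mu> *\<^sub>R w)) = - (\<mu> *\<^sub>R w)"
        using matrix_vector_mult_scaleR[of B \<mu> w] matrix_vector_mult_scaleR[of B "- \<mu>" w] by (simp_all add: w(2))
      have "u \<in> {u \<in> dual_shell \<Gamma> \<epsilon> \<mu>. B *v u = u} \<longleftrightarrow> \<mu> *\<^sub>R w \<in> chars \<and> (u = \<mu> *\<^sub>R w \<or> u = - (\<mu> *\<^sub>R w))" for u
      proof
        assume "u \<in> {u \<in> dual_shell \<Gamma> \<epsilon> \<mu>. B *v u = u}"
        then have u: "u \<in> chars" "norm u = \<mu>" "B *v u = u" by (auto simp: dual_shell_chars)
        then show "\<mu> *\<^sub>R w \<in> chars \<and> (u = \<mu> *\<^sub>R w \<or> u = - (\<mu> *\<^sub>R w))"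
          using pm[OF u(2,3)] neg by auto
      qed (use Bm neg w(1) \<mu> in \<open>auto simp: dual_shell_chars\<close>)
      then show ?thesis by auto
    qed
    show ?thesis
    proof (cases "\<mu> *\<^sub>R w \<in> chars")
      case True
      let ?h = "\<lambda>u. \<i> / (2 * of_real \<mu>) * (ch u (- b) * trace (L (?g * cl_vec u))) * trace (\<rho> (BL B b))"
      have "contrib \<mu> B = (\<Sum>u\<in>{u \<in> dual_shell \<Gamma> \<epsilon> \<mu>. B *v u = u}. ?h u)"
        unfolding contrib_def using rep_change(1)[OF b BF(1)] rep_change(2)[OF b BF(1) True]
        by (intro sum.cong refl) (auto simp: dual_shell_chars)
      \<comment> \<open>The two fixed frequencies have conjugate phases and opposite Clifford
        traces, so they combine to \<open>i/2 (e^(-it) - e^(it)) = sin t\<close>.\<close>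
      also have "\<dots> = ?h (\<mu> *\<^sub>R w) + ?h (- (\<mu> *\<^sub>R w))"
      proof -
        have "\<mu> *\<^sub>R w \<noteq> - (\<mu> *\<^sub>R w)"
        proof
          assume "\<mu> *\<^sub>R w = - (\<mu> *\<^sub>R w)"
          then have "(\<mu> *\<^sub>R w) \<bullet> w = - ((\<mu> *\<^sub>R w) \<bullet> w)" by (metis inner_minus_left)
          then show False using w(1) \<mu> by (simp add: norm_eq_1)
        qed
        then show ?thesis unfolding set using True by simp
      qed
      also have "?h (\<mu> *\<^sub>R w) = \<i> / 2 * cis (- (2 * pi * \<mu> * (b \<bullet> w))) * ?z * trace (\<rho> (BL B b))"
        using \<mu> by (simp add: cl_vec_simps trace_L_scale trw ch_def inner_commute mult_ac)
      also have "?h (- (\<mu> *\<^sub>R w)) = - (\<i> / 2 * cis (2 * pi * \<mu> * (b \<bullet> w)) * ?z * trace (\<rho> (BL B b)))"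
      proof -
        have "trace (L (?g * cl_vec (- (\<mu> *\<^sub>R w)))) = - (of_real \<mu> * ?z)"
          using trace_L_scale[of "- \<mu>" "?g * cl_vec w"] by (simp add: cl_vec_simps trw)
        then show ?thesis using \<mu> by (simp add: ch_def inner_commute mult_ac)
      qed
      also have "\<i> / 2 * cis (- (2 * pi * \<mu> * (b \<bullet> w))) * ?z * trace (\<rho> (BL B b))
          + - (\<i> / 2 * cis (2 * pi * \<mu> * (b \<bullet> w)) * ?z * trace (\<rho> (BL B b)))
        = (\<i> / 2 * (cis (- (2 * pi * \<mu> * (b \<bullet> w))) - cis (2 * pi * \<mu> * (b \<bullet> w)))) * ?z * trace (\<rho> (BL B b))"
        by (simp only: left_diff_distrib right_diff_distrib) simp
      also have "\<i> / 2 * (cis (- (2 * pi * \<mu> * (b \<bullet> w))) - cis (2 * pi * \<mu> * (b \<bullet> w))) = of_real (sin (2 * pi * \<mu> * (b \<bullet> w)))"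
        by (simp add: complex_eq_iff)
      finally show ?thesis using True by (simp add: mult_ac)
    next
      case False
      then have "{u \<in> dual_shell \<Gamma> \<epsilon> \<mu>. B *v u = u} = {}" using set by simp
      then show ?thesis using False by (simp only: contrib_def sum.empty if_False)
    qed
  qed
  show "\<exists>\<kappa>\<in>{1, -1}. (CARD('n) \<ge> 2 \<longrightarrow> (\<forall>c>0. spin_sigma ?g (c *\<^sub>R w) = \<kappa>)) \<and>
      (\<forall>\<mu>>0. contrib \<mu> B = (if \<mu> *\<^sub>R w \<in> chars then of_real \<kappa> * (- (\<i> ^ Suc ?m)) *
         2 ^ ?m * trace (\<rho> (BL B b)) * of_real (sin (2 * pi * \<mu> * (b \<bullet> w))) else 0))"
    using \<kappa> contr by blast
qed

end

section \<open>The asymmetric part of the spectrum\<close>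

lemma cis_half: "cis (2 * pi * (x + 1/2)) = - cis (2 * pi * x)"
proof -
  have "2 * pi * (x + 1/2) = 2 * pi * x + pi" by (simp add: algebra_simps)
  then show ?thesis by (simp flip: cis_mult)
qed

lemma cis_eq_minus_1: "cis (2 * pi * x) = -1 \<Longrightarrow> \<exists>j::int. x = of_int j + 1/2"
proof -
  assume "cis (2 * pi * x) = -1"
  then have "cis (2 * pi * (x - 1/2)) = 1" using cis_half[of "x - 1/2"] by simp
  then obtain j :: int where "x - 1/2 = of_int j" by (auto simp: cis_eq_1_iff elim: Ints_cases)
  then show ?thesis by (intro exI[of _ j]) (simp add: algebra_simps)
qed

lemma cis_half_int: "cis (2 * pi * ((of_int j + 1/2) * of_int z)) = (if even z then 1 else -1)"
proof (cases "even z")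
  case True
  then obtain a where "z = 2 * a" by (elim evenE)
  then have "(of_int j + 1/2) * of_int z = (of_int (2 * j * a + a) :: real)" by (simp add: algebra_simps)
  then show ?thesis using True by (simp only: cis_eq_1_iff) simp
next
  case False
  then obtain a where a: "z = 2 * a + 1" by (elim oddE)
  have "(of_int j + 1/2) * of_int z = (of_int (2 * j * a + j + a) + 1/2 :: real)"
    unfolding a by (simp add: algebra_simps)
  moreover have "cis (2 * pi * of_int (2 * j * a + j + a)) = 1" by (simp only: cis_eq_1_iff) simp
  ultimately show ?thesis using False by (simp only: cis_half) simp
qed

context flat_spin
begin

text \<open>This encodes \<open>B|\<^sub>\<Lambda> = -\<delta>\<^sub>\<epsilon> Id\<close> through a generator \<open>f\<close> of \<open>\<Lambda>\<^sup>B\<close>: the lattice is the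
  orthogonal sum of \<open>\<int>f\<close>, on which \<open>\<delta>\<^sub>\<epsilon>\<close> alternates, and a lattice on which \<open>\<delta>\<^sub>\<epsilon> = 1\<close>.\<close>

definition alternating :: "'n euc \<Rightarrow> bool" where
  "alternating f \<longleftrightarrow> f \<in> \<Lambda> \<and> f \<noteq> 0 \<and>
     (\<forall>v\<in>\<Lambda>. \<exists>z::int. v \<bullet> f = of_int z * (f \<bullet> f) \<and> delta \<epsilon> v = (if even z then 1 else -1))"

lemma alternatingD:
  assumes "alternating f" "v \<in> \<Lambda>"
  obtains z :: int where "v \<bullet> f = of_int z * (f \<bullet> f)" "delta \<epsilon> v = (if even z then 1 else -1)"
  using assms unfolding alternating_def by blast

lemma alternating_delta: assumes "alternating f" shows "delta \<epsilon> f = -1"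
proof -
  have f: "f \<in> \<Lambda>" "f \<noteq> 0" using assms by (auto simp: alternating_def)
  obtain z :: int where z: "f \<bullet> f = of_int z * (f \<bullet> f)" "delta \<epsilon> f = (if even z then 1 else -1)"
    by (rule alternatingD[OF assms f(1)])
  then have "z = 1" using f(2) by simp
  with z show ?thesis by simp
qed

lemma delta_int: "v \<in> \<Lambda> \<Longrightarrow> delta \<epsilon> (of_int z *\<^sub>R v) = (if even z then 1 else delta \<epsilon> v)"
proof -
  assume v: "v \<in> \<Lambda>"
  have "complex_of_real (delta \<epsilon> (of_int z *\<^sub>R v)) = (if even z then 1 else complex_of_real (delta \<epsilon> v))"
    by (rule sign_hom_int[of "\<lambda>v. complex_of_real (delta \<epsilon> v)"])
      (auto simp: delta_add delta_zero v delta_square simp flip: of_real_mult)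
  then show ?thesis by (simp split: if_splits)
qed

text \<open>On a vector with \<open>v \<bullet> f = z (f \<bullet> f)\<close> the phase is that of
  \<open>\<mu> norm f z\<close>, which must alternate with the parity of \<open>z\<close>; so
  \<open>\<mu> norm f\<close> is a half-integer, and positivity of \<mu> makes \<open>j\<close> a
  natural number.\<close>

lemma alternating_chars:
  assumes f: "alternating f" and \<mu>: "\<mu> > 0"
  shows "\<mu> *\<^sub>R ((1 / norm f) *\<^sub>R f) \<in> chars \<longleftrightarrow> (\<exists>j::nat. \<mu> = (real j + 1/2) / norm f)"
proof
  let ?u = "\<mu> *\<^sub>R ((1 / norm f) *\<^sub>R f)"
  have f0: "f \<in> \<Lambda>" "f \<noteq> 0" using f by (auto simp: alternating_def)
  have uv: "?u \<bullet> v = \<mu> / norm f * (v \<bullet> f)" for v by (simp add: inner_commute)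
  have ff: "f \<bullet> f = norm f * norm f" by (simp flip: power2_norm_eq_inner add: power2_eq_square)
  {
    assume "?u \<in> chars"
    then have "cis (2 * pi * (\<mu> * norm f)) = -1"
      using charsD[OF _ f0(1), of ?u] alternating_delta[OF f] f0(2) by (simp add: ch_def uv ff)
    then obtain j :: int where j: "\<mu> * norm f = of_int j + 1/2" using cis_eq_minus_1 by blast
    have "0 < \<mu> * norm f" using \<mu> f0(2) by simp
    with j have "0 \<le> j" by linarith
    then have "\<mu> = (real (nat j) + 1/2) / norm f" using j f0(2) by (simp add: field_simps)
    then show "\<exists>j::nat. \<mu> = (real j + 1/2) / norm f" by blast
  next
    assume "\<exists>j::nat. \<mu> = (real j + 1/2) / norm f"
    then obtain j :: nat where j: "\<mu> = (real j + 1/2) / norm f" by blast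
    have "ch ?u v = of_real (delta \<epsilon> v)" if v: "v \<in> \<Lambda>" for v
    proof -
      obtain z :: int where z: "v \<bullet> f = of_int z * (f \<bullet> f)" "delta \<epsilon> v = (if even z then 1 else -1)"
        by (rule alternatingD[OF f v])
      have "?u \<bullet> v = \<mu> / norm f * (of_int z * (f \<bullet> f))" by (simp only: uv z(1))
      also have "\<dots> = (of_int (int j) + 1/2) * of_int z" using f0(2) by (simp add: j ff)
      finally have "?u \<bullet> v = (of_int (int j) + 1/2) * of_int z" .
      then have "ch ?u v = cis (2 * pi * ((of_int (int j) + 1/2) * of_int z))" by (simp only: ch_def)
      then show ?thesis unfolding cis_half_int z(2) by simp
    qed
    then show "?u \<in> chars" by (simp add: chars_def)
  }
qed

lemma F1D: "B \<in> F1 \<Longrightarrow> B \<in> F" "B \<in> F1 \<Longrightarrow> fixdim B = 1" "B \<in> F1 \<Longrightarrow> orthogonal_matrix B"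
  "B \<in> F1 \<Longrightarrow> B ** B = mat 1"
  using rot_orth F_facts(3) by (auto simp: F1_def)

text \<open>The fixed vectors form a line, so the fixed lattice has rank at most one. In rank zero
  \<open>f\<close> is 0, which \<open>alternating\<close> excludes.\<close>

lemma fixed_lattice_generator:
  assumes "B \<in> F1"
  shows "\<exists>f. {v \<in> \<Lambda>. B *v v = v} = {real_of_int z *\<^sub>R f | z. True}"
proof -
  obtain w where w: "norm w = 1" "B *v w = w" "\<And>x. B *v x = x \<Longrightarrow> x = (x \<bullet> w) *\<^sub>R w"
    using fixdim_one[OF F1D(3,4,2), OF assms assms assms] by metis
  have "subspace {v. B *v v = v}"
    by (simp add: subspace_def matrix_vector_right_distrib matrix_vector_mult_scaleR)
  then interpret V: discrete_subgroup "\<Lambda> \<inter> {v. B *v v = v}" by (rule lattice.sublattice)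
  obtain C where C: "finite C" "independent C" "C \<subseteq> \<Lambda> \<inter> {v. B *v v = v}"
    "\<And>x. x \<in> \<Lambda> \<inter> {v. B *v v = v} \<Longrightarrow> \<exists>c::'n euc \<Rightarrow> int. x = (\<Sum>v\<in>C. of_int (c v) *\<^sub>R v)"
    using V.basis_exists by blast
  have "C \<subseteq> span {w}" unfolding span_singleton using C(3) w(3) by blast
  then have "card C \<le> 1" using independent_span_bound[of "{w}" C] C(2) by simp
  have eq: "{v \<in> \<Lambda>. B *v v = v} = \<Lambda> \<inter> {v. B *v v = v}" by auto
  show ?thesis
  proof (cases "C = {}")
    case True
    then have "{v \<in> \<Lambda>. B *v v = v} = {real_of_int z *\<^sub>R 0 | z. True}"
      unfolding eq using C(4) V.zero_mem by auto
    then show ?thesis by blast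
  next
    case False
    then have "card C = 1" using \<open>card C \<le> 1\<close> C(1) by (simp add: le_Suc_eq)
    then obtain f where f: "C = {f}" by (auto simp: card_1_singleton_iff)
    have "{v \<in> \<Lambda>. B *v v = v} = {real_of_int z *\<^sub>R f | z. True}"
      unfolding eq
    proof (intro subset_antisym subsetI)
      fix x assume "x \<in> \<Lambda> \<inter> {v. B *v v = v}"
      then show "x \<in> {real_of_int z *\<^sub>R f | z. True}" using C(4) f by force
    next
      fix x assume "x \<in> {real_of_int z *\<^sub>R f | z. True}"
      then show "x \<in> \<Lambda> \<inter> {v. B *v v = v}" using V.int_mem[of f] C(3) f by blast
    qed
    then show ?thesis by blast
  qed
qed

lemma generator_facts:
  assumes "{v \<in> \<Lambda>. B *v v = v} = {real_of_int z *\<^sub>R f | z. True}"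
  shows "f \<in> \<Lambda>" "B *v f = f"
    "v \<in> \<Lambda> \<Longrightarrow> B *v v = v \<Longrightarrow> \<exists>c::int. v = of_int c *\<^sub>R f"
proof -
  have "f = real_of_int 1 *\<^sub>R f" by simp
  then have "f \<in> {v \<in> \<Lambda>. B *v v = v}" unfolding assms by blast
  then show "f \<in> \<Lambda>" "B *v f = f" by auto
  show "v \<in> \<Lambda> \<Longrightarrow> B *v v = v \<Longrightarrow> \<exists>c::int. v = of_int c *\<^sub>R f" using assms by blast
qed

text \<open>A single nonvanishing contribution determines the shape of the lattice. The sine forces
  \<open>m\<close> odd, hence \<delta> = -1 on \<open>f\<close>; an admissible frequency along
  \<open>f\<close> then makes every lattice vector project to an integer multiple of
  \<open>f\<close>.\<close>

lemma contrib_nonzero: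
  assumes B: "B \<in> F1" and \<mu>: "\<mu> > 0" and nz: "contrib \<mu> B \<noteq> 0"
    and gen: "{v \<in> \<Lambda>. B *v v = v} = {real_of_int z *\<^sub>R f | z. True}"
  shows "odd CARD('n)" "odd (CARD('n) div 2)" "trace (\<rho> (rep B)) \<noteq> 0" "alternating f"
proof -
  let ?m = "CARD('n) div 2" and ?b = "shift B"
  note BF = F1D[OF B]
  have b: "BL B ?b \<in> \<Gamma>" using rep_BL[OF BF(1)] rep(1)[OF BF(1)] by simp
  obtain w0 where w0: "norm w0 = 1" "B *v w0 = w0"
    using fixdim_one[OF BF(3,4,2)] by metis
  note cf0 = contrib_formula[OF B b w0]
  show "odd CARD('n)" by (rule cf0(1))
  from cf0(4) nz \<mu> have c0: "\<mu> *\<^sub>R w0 \<in> chars" "trace (\<rho> (BL B ?b)) \<noteq> 0" "sin (2 * pi * \<mu> * (?b \<bullet> w0)) \<noteq> 0"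
    by (auto split: if_splits)
  show "trace (\<rho> (rep B)) \<noteq> 0" using c0(2) rep_BL[OF BF(1)] by simp
  have cisv: "cis (2 * pi * (2 * \<mu> * (?b \<bullet> w0))) = of_real ((-1) ^ ?m)"
    using charsD[OF c0(1) cf0(2)] w0(1) by (simp add: cf0(3) ch_def norm_eq_1 mult_ac)
  \<comment> \<open>The phase of the frequency on \<gamma>^2 has twice the argument of the sine and
    equals \<open>(-1)^m\<close>; for even \<open>m\<close> the argument is a multiple of
    pi.\<close>
  show oddm: "odd ?m"
  proof
    assume "even ?m"
    then have "cis (2 * pi * (2 * \<mu> * (?b \<bullet> w0))) = 1" unfolding cisv by simp
    then obtain i :: int where "2 * \<mu> * (?b \<bullet> w0) = of_int i"
      unfolding cis_eq_1_iff by (auto elim: Ints_cases)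
    then have "2 * pi * \<mu> * (?b \<bullet> w0) = of_int i * pi" by (simp add: mult_ac)
    then show False using c0(3) by (auto simp: sin_zero_iff_int2)
  qed
  have \<delta>0: "delta \<epsilon> ((2 * (?b \<bullet> w0)) *\<^sub>R w0) = -1" using cf0(3) oddm by simp
  note g = generator_facts[OF gen]
  have "B *v ((2 * (?b \<bullet> w0)) *\<^sub>R w0) = (2 * (?b \<bullet> w0)) *\<^sub>R w0"
    by (simp add: matrix_vector_mult_scaleR w0(2))
  then obtain c0 :: int where c0: "(2 * (?b \<bullet> w0)) *\<^sub>R w0 = of_int c0 *\<^sub>R f" using g(3)[OF cf0(2)] by blast
  have f0: "f \<noteq> 0" using \<delta>0 c0 delta_zero by auto
  have \<delta>f: "delta \<epsilon> f = -1" using \<delta>0 unfolding c0 delta_int[OF g(1)] by (simp split: if_splits)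
  define w where "w = (1 / norm f) *\<^sub>R f"
  have w: "norm w = 1" "B *v w = w" using f0 by (simp_all add: w_def matrix_vector_mult_scaleR g(2))
  have fw: "f = norm f *\<^sub>R w" using f0 by (simp add: w_def)
  have fdw: "f \<bullet> w = norm f" using w(1) by (subst fw) (simp add: norm_eq_1)
  from contrib_formula(4)[OF B b w] nz \<mu> have chw: "\<mu> *\<^sub>R w \<in> chars" by (auto split: if_splits)
  have "cis (2 * pi * (\<mu> * norm f)) = -1"
    using charsD[OF chw g(1)] \<delta>f fdw by (simp add: ch_def inner_commute)
  then obtain j :: int where j: "\<mu> * norm f = of_int j + 1/2" using cis_eq_minus_1 by blast
  \<comment> \<open>Since \<open>v + B v\<close> is fixed, it equals \<open>h f\<close>, which
    allows \<open>v \<bullet> f\<close> to be a half-integer multiple of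
    \<open>f \<bullet> f\<close>. The frequency on \<open>2 v\<close>, where \<delta> is 1, shows
    that \<open>h\<close> is even.\<close>
  have "\<exists>z::int. v \<bullet> f = of_int z * (f \<bullet> f) \<and> delta \<epsilon> v = (if even z then 1 else -1)" if v: "v \<in> \<Lambda>" for v
  proof -
    have Bv: "v + B *v v = (2 * (v \<bullet> w)) *\<^sub>R w"
      using orth_fixed_unit(3)[OF BF(3,4,2) w, of v] by simp
    then have "(2 * (v \<bullet> w)) *\<^sub>R w \<in> \<Lambda>" using lattice.add_mem[OF v F_lattice[OF BF(1) v]] by simp
    moreover have "B *v ((2 * (v \<bullet> w)) *\<^sub>R w) = (2 * (v \<bullet> w)) *\<^sub>R w" by (simp add: matrix_vector_mult_scaleR w(2))
    ultimately obtain h :: int where h: "(2 * (v \<bullet> w)) *\<^sub>R w = of_int h *\<^sub>R f" using g(3) by blast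
    then have "((2 * (v \<bullet> w)) *\<^sub>R w) \<bullet> w = (of_int h *\<^sub>R f) \<bullet> w" by simp
    then have vw: "2 * (v \<bullet> w) = of_int h * norm f" using w(1) fdw by (simp add: norm_eq_1)
    have chv: "ch (\<mu> *\<^sub>R w) v = cis (2 * pi * (\<mu> * (v \<bullet> w)))" by (simp add: ch_def inner_commute)
    have "ch (\<mu> *\<^sub>R w) v * ch (\<mu> *\<^sub>R w) v = cis (2 * pi * (\<mu> * (2 * (v \<bullet> w))))"
      unfolding chv cis_mult by (simp add: algebra_simps)
    also have "\<mu> * (2 * (v \<bullet> w)) = (of_int j + 1/2) * of_int h" unfolding vw j[symmetric] by simp
    finally have "(if even h then 1 else -1) = (1 :: complex)"
      unfolding cis_half_int charsD[OF chw v] using delta_square[OF v] by (simp flip: of_real_mult)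
    then have "even h" by (auto split: if_splits)
    then obtain z where z: "h = 2 * z" by (elim evenE)
    have vwz: "v \<bullet> w = of_int z * norm f" using vw by (simp add: z)
    have "v \<bullet> f = norm f * (v \<bullet> w)" by (subst fw) simp
    then have 1: "v \<bullet> f = of_int z * (f \<bullet> f)"
      by (simp add: vwz power2_eq_square flip: power2_norm_eq_inner)
    have "\<mu> * (v \<bullet> w) = (of_int j + 1/2) * of_int z" unfolding vwz j[symmetric] by simp
    then have "complex_of_real (delta \<epsilon> v) = (if even z then 1 else -1)"
      using chv cis_half_int[of j z] unfolding charsD[OF chw v] by simp
    then have "delta \<epsilon> v = (if even z then 1 else -1)"
      by (metis of_real_1 of_real_eq_iff of_real_minus)
    with 1 show ?thesis by blast
  qed
  then show "alternating f" using g(1) f0 by (simp add: alternating_def)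
qed

text \<open>\<open>B\<close> and \<open>C\<close> commute, so \<open>B\<close> maps the line of
  \<open>g\<close> to itself. If \<open>B\<close> fixes it, the lines and hence the two maps
  coincide. If \<open>B\<close> negates it, \<open>g\<close> is orthogonal to \<open>f\<close>, so
  \<delta> is 1 on \<open>g\<close> by the alternation along \<open>f\<close> but -1 by that along
  \<open>g\<close>.\<close>

lemma alternating_unique:
  assumes B: "B \<in> F1" "B *v f = f" "alternating f" and C: "C \<in> F1" "C *v g = g" "alternating g"
  shows "B = C"
proof -
  have f0: "f \<noteq> 0" "f \<in> \<Lambda>" and g0: "g \<noteq> 0" "g \<in> \<Lambda>" using B C by (auto simp: alternating_def)
  define w where "w = (1 / norm f) *\<^sub>R f"
  define x where "x = (1 / norm g) *\<^sub>R g"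
  have w: "norm w = 1" "B *v w = w" "f = norm f *\<^sub>R w"
    using f0 B(2) by (simp_all add: w_def matrix_vector_mult_scaleR)
  have x: "norm x = 1" "C *v x = x" "g = norm g *\<^sub>R x"
    using g0 C(2) by (simp_all add: x_def matrix_vector_mult_scaleR)
  note oB = orth_fixed_unit[OF F1D(3,4,2)[OF B(1)] w(1,2)]
    and oC = orth_fixed_unit[OF F1D(3,4,2)[OF C(1)] x(1,2)]
  have "C *v (B *v x) = B *v x"
    using F_commute[OF F1D(1)[OF B(1)] F1D(1)[OF C(1)]] x(2) by (metis matrix_vector_mul_assoc)
  then have Bx: "B *v x = ((B *v x) \<bullet> x) *\<^sub>R x" by (rule oC(2))
  define r where "r = (B *v x) \<bullet> x"
  have "\<bar>r\<bar> = 1" using Bx x(1) orth_norm[OF F1D(3)[OF B(1)], of x] unfolding r_def by (metis mult_1_right norm_scaleR)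
  then consider "r = 1" | "r = -1" by linarith
  then show ?thesis
  proof cases
    case 1
    then have "B *v x = x" using Bx by (simp add: r_def)
    then have xw: "x = (x \<bullet> w) *\<^sub>R w" by (rule oB(2))
    then have "\<bar>x \<bullet> w\<bar> = 1" using w(1) x(1) by (metis mult_1_right norm_scaleR)
    then have "x = w \<or> x = - w" using xw by (cases "x \<bullet> w \<ge> 0") auto
    then have "B *v y = C *v y" for y unfolding oB(3) oC(3) by auto
    then show ?thesis by (simp add: matrix_eq)
  next
    case 2
    then have "B *v x = - x" using Bx by (simp add: r_def)
    then have "x \<bullet> w = 0" using orth_inner[OF F1D(3)[OF B(1)], of x w] w(2) by simp
    then have gf: "g \<bullet> f = 0" by (subst x(3), subst w(3)) simp
    obtain z :: int where z: "g \<bullet> f = of_int z * (f \<bullet> f)" "delta \<epsilon> g = (if even z then 1 else -1)"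
      by (rule alternatingD[OF B(3) g0(2)])
    then have "z = 0" using gf f0 by simp
    then show ?thesis using z(2) alternating_delta[OF C(3)] by simp
  qed
qed

text \<open>A second nonzero contribution would come with its own alternating generator, against
  \<open>alternating_unique\<close>.\<close>

lemma contrib_sum:
  assumes "B \<in> F1" "B *v f = f" "alternating f" "\<mu> > 0"
  shows "(\<Sum>C\<in>F1. contrib \<mu> C) = contrib \<mu> B"
proof -
  have fin: "finite F1" using F_facts(1) by (simp add: F1_def)
  have "contrib \<mu> C = 0" if C: "C \<in> F1" "C \<noteq> B" for C
  proof (rule ccontr)
    assume nz: "contrib \<mu> C \<noteq> 0"
    obtain g where g: "{v \<in> \<Lambda>. C *v v = v} = {real_of_int z *\<^sub>R g | z. True}"
      using fixed_lattice_generator[OF C(1)] by blast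
    have "C = B"
      by (rule alternating_unique[OF C(1) generator_facts(2)[OF g] contrib_nonzero(4)[OF C(1) assms(4) nz g] assms(1-3)])
    with C(2) show False by simp
  qed
  then have "(\<Sum>C\<in>F1 - {B}. contrib \<mu> C) = 0" by (intro sum.neutral) auto
  then show ?thesis using sum.remove[OF fin assms(1), of "contrib \<mu>"] by simp
qed

text \<open>Basis vectors with \<delta> = -1 lie on the fixed line and the others are orthogonal to
  it, so independence and spanning leave exactly one of the former. It equals \<open>f\<close> up to
  sign, and the parity of its coordinate computes \<delta>.\<close>

lemma witness_alternating:
  assumes wit: "asymmetry_witness \<Gamma> \<epsilon> \<rho> B b" and n: "CARD('n) \<ge> 2"
    and gen: "{v \<in> \<Lambda>. B *v v = v} = {real_of_int z *\<^sub>R f | z. True}"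
  shows "B \<in> F1" "BL B b \<in> \<Gamma>" "trace (\<rho> (BL B b)) \<noteq> 0" "alternating f"
proof -
  show b: "BL B b \<in> \<Gamma>" and tr: "trace (\<rho> (BL B b)) \<noteq> 0"
    using wit by (auto simp: asymmetry_witness_def)
  have fd: "fixdim B = 1" using wit by (auto simp: asymmetry_witness_def)
  obtain C c where C: "BL B b = BL C c" "orthogonal_matrix C" "rot (BL B b) = C" by (rule \<Gamma>_cases[OF b])
  have "C = B" by (rule BL_inject(1)[OF C(2) C(1)[symmetric]])
  then have "B \<in> F" using imageI[OF b, of rot] C(3) by simp
  moreover have "B \<noteq> mat 1" using fd n by (auto simp: fixdim_mat_1)
  ultimately show BF1: "B \<in> F1" using fd by (simp add: F1_def)
  note BF = F1D[OF BF1]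
  obtain e where e: "Z_basis e \<Lambda>" "\<And>j. B *v e j = - delta \<epsilon> (e j) *\<^sub>R e j"
    using wit by (auto simp: asymmetry_witness_def)
  note ind = Z_basis_independent[OF e(1) lattice_spans]
  have em: "e j \<in> \<Lambda>" for j by (rule Z_basis_mem[OF e(1)])
  note pm = \<epsilon>_lattice(2)[OF em]
  obtain w where w: "norm w = 1" "B *v w = w" using fixdim_one[OF BF(3,4,2)] by metis
  note ow = orth_fixed_unit[OF BF(3,4,2) w]
  have perp: "e j \<bullet> w = 0" if "delta \<epsilon> (e j) \<noteq> -1" for j
  proof -
    have "B *v e j = - e j" using e(2)[of j] pm[of j] that by auto
    then show ?thesis using orth_inner[OF BF(3), of "e j" w] w(2) by simp
  qed
  have par: "B *v e j = e j" if "delta \<epsilon> (e j) = -1" for j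
    using e(2)[of j] that by simp
  have expand: "x \<bullet> w = (\<Sum>i\<in>UNIV. of_int (c i) * (e i \<bullet> w))"
    if "x = (\<Sum>i\<in>UNIV. of_int (c i) *\<^sub>R e i)" for x c
    unfolding that by (simp add: inner_sum_left)
  have "\<exists>j0. delta \<epsilon> (e j0) = -1"
  proof (rule ccontr)
    assume "\<not> ?thesis"
    then have "e j \<bullet> w = 0" for j using perp by blast
    then have "w \<bullet> x = 0" if "x \<in> range e" for x using that by (auto simp: inner_commute)
    then have "w \<bullet> x = 0" if "x \<in> span (range e)" for x
      using orthogonal_to_span[of x "range e" w] that by (auto simp: orthogonal_def)
    then have "w \<bullet> w = 0" using ind(3) by auto
    then show False using w(1) by simp
  qed
  then obtain j0 where j0: "delta \<epsilon> (e j0) = -1" by blast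
  have uniq: "j = j0" if "delta \<epsilon> (e j) = -1" for j
  proof -
    have "e i \<in> span {w}" if "delta \<epsilon> (e i) = -1" for i
      using ow(2)[OF par[OF that]] unfolding span_singleton by blast
    then have "{e j, e j0} \<subseteq> span {w}" using that j0 by auto
    moreover have "independent {e j, e j0}" by (rule independent_mono[OF ind(2)]) auto
    ultimately have "card {e j, e j0} \<le> 1" using independent_span_bound[of "{w}"] by fastforce
    then have "e j = e j0" by (cases "e j = e j0") auto
    then show ?thesis using ind(1) by (simp add: inj_eq)
  qed
  have ej0: "x \<bullet> w = of_int (c j0) * (e j0 \<bullet> w)"
    if "x = (\<Sum>i\<in>UNIV. of_int (c i) *\<^sub>R e i)" for x c
  proof -
    have "x \<bullet> w = (\<Sum>i\<in>UNIV. if i = j0 then of_int (c i) * (e i \<bullet> w) else 0)"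
      unfolding expand[OF that] using perp uniq by (intro sum.cong) auto
    then show ?thesis by simp
  qed
  note g = generator_facts[OF gen]
  obtain z0 :: int where z0: "e j0 = of_int z0 *\<^sub>R f" using g(3)[OF em par[OF j0]] by blast
  have "e j0 \<noteq> 0" using ind(2) dependent_zero by (metis rangeI)
  then have f0: "f \<noteq> 0" using z0 by auto
  have fw: "f = (f \<bullet> w) *\<^sub>R w" by (rule ow(2)[OF g(2)])
  then have fw0: "f \<bullet> w \<noteq> 0" using f0 by auto
  obtain c where c: "f = (\<Sum>i\<in>UNIV. of_int (c i) *\<^sub>R e i)" by (rule Z_basis_expand[OF e(1) g(1)])
  \<comment> \<open>Comparing components along \<open>w\<close> gives \<open>c j0 * z0 = 1\<close>,
    so \<open>z0\<close> is a unit of the integers.\<close>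
  have "f \<bullet> w = of_int (c j0 * z0) * (f \<bullet> w)" using ej0[OF c] by (simp add: z0)
  then have "of_int (c j0 * z0) = (1 :: real)" using fw0 by simp
  then have "c j0 * z0 = 1" by (simp only: of_int_eq_1_iff)
  then have z01: "z0 = 1 \<or> z0 = -1" by (auto simp: zmult_eq_1_iff)
  have "\<exists>z::int. v \<bullet> f = of_int z * (f \<bullet> f) \<and> delta \<epsilon> v = (if even z then 1 else -1)" if v: "v \<in> \<Lambda>" for v
  proof -
    obtain d where d: "v = (\<Sum>i\<in>UNIV. of_int (d i) *\<^sub>R e i)" by (rule Z_basis_expand[OF e(1) v])
    have "v \<bullet> f = (f \<bullet> w) * (v \<bullet> w)" by (subst fw) simp
    also have "\<dots> = of_int (d j0 * z0) * ((f \<bullet> w) * (f \<bullet> w))" using ej0[OF d] by (simp add: z0)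
    also have "(f \<bullet> w) * (f \<bullet> w) = f \<bullet> f" using w(1) by (subst (3 4) fw) (simp add: norm_eq_1)
    finally have 1: "v \<bullet> f = of_int (d j0 * z0) * (f \<bullet> f)" .
    have "complex_of_real (delta \<epsilon> v) = (\<Prod>i\<in>UNIV. if even (d i) then 1 else complex_of_real (delta \<epsilon> (e i)))"
      unfolding d by (rule sign_hom_sum[of "\<lambda>v. complex_of_real (delta \<epsilon> v)"])
        (auto simp: delta_add delta_zero em delta_square simp flip: of_real_mult)
    also have "\<dots> = (\<Prod>i\<in>UNIV. if i = j0 then (if even (d j0) then 1 else -1) else 1)"
    proof (rule prod.cong[OF refl])
      fix i
      show "(if even (d i) then 1 else complex_of_real (delta \<epsilon> (e i))) = (if i = j0 then (if even (d j0) then 1 else -1) else 1)"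
      proof (cases "i = j0")
        case False
        then have "delta \<epsilon> (e i) = 1" using uniq[of i] pm[of i] by blast
        then show ?thesis using False by simp
      qed (simp add: j0)
    qed
    also have "\<dots> = (if even (d j0) then 1 else -1)" by simp
    also have "even (d j0) \<longleftrightarrow> even (d j0 * z0)" using z01 by auto
    finally have "complex_of_real (delta \<epsilon> v) = of_real (if even (d j0 * z0) then 1 else -1)"
      by (simp only: if_distrib[of complex_of_real] of_real_1 of_real_minus)
    then have "delta \<epsilon> v = (if even (d j0 * z0) then 1 else -1)" by (simp only: of_real_eq_iff)
    with 1 show ?thesis by blast
  qed
  then show "alternating f" using g(1) f0 by (simp add: alternating_def)
qed

text \<open>Subtracting \<open>z f\<close> moves any lattice vector into the orthogonal complement
  of \<open>f\<close>, so \<open>f\<close> together with a basis of that sublattice is a lattice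
  basis; \<delta> is 1 and \<open>B\<close> is -1 on the complement.\<close>

lemma alternating_witness:
  assumes BF1: "B \<in> F1" and b: "BL B b \<in> \<Gamma>" "trace (\<rho> (BL B b)) \<noteq> 0"
    and f: "alternating f" "B *v f = f"
  shows "asymmetry_witness \<Gamma> \<epsilon> \<rho> B b"
proof -
  note BF = F1D[OF BF1]
  have f0: "f \<noteq> 0" "f \<in> \<Lambda>" using f by (auto simp: alternating_def)
  define w where "w = (1 / norm f) *\<^sub>R f"
  have w: "norm w = 1" "B *v w = w"
    using f0 f(2) by (simp_all add: w_def matrix_vector_mult_scaleR)
  let ?H = "{v. v \<bullet> f = 0}"
  have H: "subspace ?H" by (simp add: subspace_def inner_add_left)
  interpret V: discrete_subgroup "\<Lambda> \<inter> ?H" by (rule lattice.sublattice[OF H])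
  obtain C where C: "finite C" "independent C" "C \<subseteq> \<Lambda> \<inter> ?H"
    "\<And>x. x \<in> \<Lambda> \<inter> ?H \<Longrightarrow> \<exists>c::'n euc \<Rightarrow> int. x = (\<Sum>v\<in>C. of_int (c v) *\<^sub>R v)"
    using V.basis_exists by blast
  have "span C \<subseteq> ?H" using C(3) H by (intro span_minimal) auto
  then have fC: "f \<notin> span C" using f0 by auto
  then have fC': "f \<notin> C" using span_base by blast
  let ?D = "insert f C"
  have D: "finite ?D" "independent ?D" "?D \<subseteq> \<Lambda>"
    using C f0 independent_insertI[OF fC C(2)] by auto
  have gen: "\<exists>c::'n euc \<Rightarrow> int. x = (\<Sum>v\<in>?D. of_int (c v) *\<^sub>R v)" if x: "x \<in> \<Lambda>" for x
  proof -
    obtain z :: int where z: "x \<bullet> f = of_int z * (f \<bullet> f)" by (rule alternatingD[OF f(1) x])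
    then have "x - of_int z *\<^sub>R f \<in> \<Lambda> \<inter> ?H"
      using lattice.diff_mem[OF x lattice.int_mem[OF f0(2)]] by (simp add: inner_diff_left)
    then obtain c :: "'n euc \<Rightarrow> int" where c: "x - of_int z *\<^sub>R f = (\<Sum>v\<in>C. of_int (c v) *\<^sub>R v)" using C(4) by blast
    have "(\<Sum>v\<in>C. of_int ((c(f := z)) v) *\<^sub>R v) = x - of_int z *\<^sub>R f"
      unfolding c using fC' by (intro sum.cong) auto
    then have "x = (\<Sum>v\<in>?D. of_int ((c(f := z)) v) *\<^sub>R v)" using fC' C(1) by simp
    then show ?thesis by blast
  qed
  have "\<Lambda> \<subseteq> span ?D"
  proof
    fix x assume "x \<in> \<Lambda>"
    then obtain c :: "'n euc \<Rightarrow> int" where "x = (\<Sum>v\<in>?D. of_int (c v) *\<^sub>R v)" using gen by blast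
    then show "x \<in> span ?D" by (simp only:) (intro span_sum span_scale span_base)
  qed
  then have "UNIV \<subseteq> span ?D" using lattice_spans by (metis span_minimal subspace_span)
  then have "card ?D = CARD('n)" using basis_card_eq_dim[of ?D UNIV] D(2) by (simp add: dim_UNIV)
  then obtain e where e: "Z_basis e \<Lambda>" "bij_betw e UNIV ?D"
    using Z_basis_of_set[OF lattice_discrete D _ gen] by blast
  have "B *v e j = - delta \<epsilon> (e j) *\<^sub>R e j" for j
  proof -
    have "e j \<in> ?D" using e(2) by (auto simp: bij_betw_def)
    then consider "e j = f" | "e j \<in> C" by blast
    then show ?thesis
    proof cases
      case 1
      then show ?thesis using f alternating_delta by simp
    next
      case 2
      then have v: "e j \<in> \<Lambda>" "e j \<bullet> f = 0" using C(3) by auto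
      obtain z :: int where z: "e j \<bullet> f = of_int z * (f \<bullet> f)" "delta \<epsilon> (e j) = (if even z then 1 else -1)"
        by (rule alternatingD[OF f(1) v(1)])
      then have "z = 0" using v(2) f0 by simp
      moreover have "B *v e j = - e j"
        by (rule orth_fixed_unit(1)[OF BF(3,4,2) w]) (simp add: w_def v(2))
      ultimately show ?thesis using z(2) by simp
    qed
  qed
  then show ?thesis unfolding asymmetry_witness_def using b BF(2) e(1) by blast
qed

text \<open>The square of \<open>BL B b\<close> is the translation by a fixed lattice vector
  \<open>c f\<close>. For odd \<open>m\<close> its sign is -1, which forces \<open>c\<close> to be
  odd.\<close>

lemma translation_component:
  assumes BF1: "B \<in> F1" and b: "BL B b \<in> \<Gamma>" and f: "alternating f"
    and gen: "{v \<in> \<Lambda>. B *v v = v} = {real_of_int z *\<^sub>R f | z. True}" and m: "odd (CARD('n) div 2)"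
  shows "\<exists>c::int. odd c \<and> f \<bullet> (2 *\<^sub>R b) = of_int c * (norm f)\<^sup>2"
proof -
  note g = generator_facts[OF gen]
  have f0: "f \<noteq> 0" using f by (auto simp: alternating_def)
  define w where "w = (1 / norm f) *\<^sub>R f"
  have w: "norm w = 1" "B *v w = w" using f0 by (simp_all add: w_def matrix_vector_mult_scaleR g(2))
  note cf = contrib_formula[OF BF1 b w]
  have "B *v ((2 * (b \<bullet> w)) *\<^sub>R w) = (2 * (b \<bullet> w)) *\<^sub>R w"
    by (simp add: matrix_vector_mult_scaleR w(2))
  then obtain c :: int where c: "(2 * (b \<bullet> w)) *\<^sub>R w = of_int c *\<^sub>R f" using g(3)[OF cf(2)] by blast
  have "delta \<epsilon> (of_int c *\<^sub>R f) = -1" using cf(3) m unfolding c by simp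
  then have "odd c" unfolding delta_int[OF g(1)] by (auto split: if_splits)
  moreover have "((2 * (b \<bullet> w)) *\<^sub>R w) \<bullet> f = (of_int c *\<^sub>R f) \<bullet> f" by (simp only: c)
  then have "f \<bullet> (2 *\<^sub>R b) = of_int c * (norm f)\<^sup>2"
    using f0 by (simp add: w_def inner_commute power2_norm_eq_inner) (simp add: power2_eq_square flip: power2_norm_eq_inner)
  ultimately show ?thesis by blast
qed

text \<open>The condition \<open>\<bar>c\<bar> = 4 l + 1\<close> fixes the sign of the sine; residue
  3 would reverse it.\<close>

lemma contrib_value:
  assumes BF1: "B \<in> F1" and b: "BL B b \<in> \<Gamma>" and f: "alternating f" "B *v f = f"
    and n: "CARD('n) = 4 * r + 3" and c: "f \<bullet> (2 *\<^sub>R b) = of_int c * (norm f)\<^sup>2" "\<bar>c\<bar> = 4 * int l + 1"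
  shows "contrib ((real j + 1/2) / norm f) B = of_real (spin_sigma (\<epsilon> (BL B b)) ((f \<bullet> (2 *\<^sub>R b)) *\<^sub>R f)) *
    (-1) ^ (r + j) * 2 ^ (CARD('n) div 2) * trace (\<rho> (BL B b))"
proof -
  let ?\<mu> = "(real j + 1/2) / norm f" and ?e = "real_of_int (sgn c)"
  have f0: "f \<noteq> 0" using f by (auto simp: alternating_def)
  have \<mu>: "?\<mu> > 0" using f0 by (simp add: add_nonneg_pos)
  have m: "CARD('n) div 2 = 2 * r + 1" using n by simp
  have e: "?e = 1 \<or> ?e = -1" "?e * of_int c = of_int \<bar>c\<bar>" using c(2) by (auto simp: sgn_if)
  then have ee: "?e * ?e = 1" by auto
  \<comment> \<open>The direction of \<open>w\<close> is that of \<open>(f \<bullet> 2b) f\<close>,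
    so that \<kappa> is the required \<sigma> and \<open>b \<bullet> w\<close> is positive.\<close>
  define w where "w = (?e / norm f) *\<^sub>R f"
  have w: "norm w = 1" "B *v w = w"
    using f0 e(1) by (auto simp: w_def matrix_vector_mult_scaleR f(2))
  obtain \<kappa> where \<kappa>: "CARD('n) \<ge> 2 \<longrightarrow> (\<forall>c>0. spin_sigma (\<epsilon> (BL B b)) (c *\<^sub>R w) = \<kappa>)"
    "contrib ?\<mu> B = (if ?\<mu> *\<^sub>R w \<in> chars then of_real \<kappa> * (- (\<i> ^ Suc (CARD('n) div 2))) *
         2 ^ (CARD('n) div 2) * trace (\<rho> (BL B b)) * of_real (sin (2 * pi * ?\<mu> * (b \<bullet> w))) else 0)"
    using contrib_formula(4)[OF BF1 b w] \<mu> by blast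
  have "(f \<bullet> (2 *\<^sub>R b)) *\<^sub>R f = (of_int \<bar>c\<bar> * (norm f)\<^sup>2 * norm f) *\<^sub>R w"
  proof -
    have "(of_int \<bar>c\<bar> * (norm f)\<^sup>2 * norm f) *\<^sub>R w = (?e * of_int c * ?e * (norm f)\<^sup>2) *\<^sub>R f"
      unfolding e(2) w_def using f0 by simp
    also have "?e * of_int c * ?e * (norm f)\<^sup>2 = of_int c * (norm f)\<^sup>2" using ee by (simp add: mult_ac)
    finally show ?thesis by (simp only: c(1))
  qed
  moreover have "of_int \<bar>c\<bar> * (norm f)\<^sup>2 * norm f > 0" using f0 c(2) by auto
  ultimately have sigma: "spin_sigma (\<epsilon> (BL B b)) ((f \<bullet> (2 *\<^sub>R b)) *\<^sub>R f) = \<kappa>" using \<kappa>(1) n by simp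
  have ch: "?\<mu> *\<^sub>R ((1 / norm f) *\<^sub>R f) \<in> chars" using alternating_chars[OF f(1) \<mu>] by blast
  have "w = (1 / norm f) *\<^sub>R f \<or> w = - ((1 / norm f) *\<^sub>R f)" using e(1) by (auto simp: w_def)
  then have chw: "?\<mu> *\<^sub>R w \<in> chars"
    by (elim disjE) (simp_all only: scaleR_minus_right ch chars_uminus[OF ch])
  have bw: "b \<bullet> w = of_int \<bar>c\<bar> * norm f / 2"
  proof -
    have "b \<bullet> w = ?e / norm f * (f \<bullet> b)" by (simp add: w_def inner_commute)
    also have "f \<bullet> b = of_int c * (norm f)\<^sup>2 / 2" using c(1) by simp
    also have "?e / norm f * (of_int c * (norm f)\<^sup>2 / 2) = ?e * of_int c * norm f / 2"
      using f0 by (simp add: power2_eq_square)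
    finally show ?thesis by (simp only: e(2))
  qed
  \<comment> \<open>The argument is \<open>pi (j + 1/2) (4 l + 1)\<close>, that is pi/2 plus
    \<open>j + 2 l (2 j + 1)\<close> half periods; the even summand drops out of the sign.\<close>
  have "2 * pi * ?\<mu> * (b \<bullet> w) = pi / 2 + real (j + 2 * l * (2 * j + 1)) * pi"
    using f0 by (simp add: bw c(2) field_simps)
  then have "sin (2 * pi * ?\<mu> * (b \<bullet> w)) = cos (real (j + 2 * l * (2 * j + 1)) * pi)"
    by (simp only: sin_add) simp
  also have "\<dots> = (-1) ^ (j + 2 * l * (2 * j + 1))" by (rule cos_npi)
  also have "\<dots> = (-1) ^ j" by (simp add: power_add power_mult)
  finally have sn: "sin (2 * pi * ?\<mu> * (b \<bullet> w)) = (-1) ^ j" .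
  \<comment> \<open>Here \<open>m + 1 = 2 r + 2\<close>, so the scalar of the volume element is real
    and equals \<open>(-1)^r\<close>.\<close>
  have "\<i> ^ Suc (CARD('n) div 2) = (\<i> ^ 2) ^ (r + 1)" unfolding m power_mult[symmetric] by (simp add: algebra_simps)
  then have ii: "- (\<i> ^ Suc (CARD('n) div 2)) = (-1) ^ r" by simp
  show ?thesis unfolding \<kappa>(2) sigma sn ii using chw by (simp add: power_add mult_ac)
qed

text \<open>At an admissible frequency the argument of the sine is the odd multiple
  \<open>(2 j + 1) c\<close> of pi/2, so the sine is nonzero; every odd \<open>c\<close> will do,
  whatever its residue modulo 4.\<close>

lemma contrib_asymmetric:
  assumes BF1: "B \<in> F1" and b: "BL B b \<in> \<Gamma>" "trace (\<rho> (BL B b)) \<noteq> 0" and f: "alternating f"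
    and gen: "{v \<in> \<Lambda>. B *v v = v} = {real_of_int z *\<^sub>R f | z. True}" and m: "odd (CARD('n) div 2)" and \<mu>: "\<mu> > 0"
  shows "contrib \<mu> B \<noteq> 0 \<longleftrightarrow> (\<exists>j::nat. \<mu> = (real j + 1/2) / norm f)"
proof -
  note g = generator_facts[OF gen]
  have f0: "f \<noteq> 0" using f by (auto simp: alternating_def)
  define w where "w = (1 / norm f) *\<^sub>R f"
  have w: "norm w = 1" "B *v w = w" using f0 by (simp_all add: w_def matrix_vector_mult_scaleR g(2))
  obtain \<kappa> :: real where \<kappa>: "\<kappa> \<in> {1, -1}"
    "contrib \<mu> B = (if \<mu> *\<^sub>R w \<in> chars then of_real \<kappa> * (- (\<i> ^ Suc (CARD('n) div 2))) *
         2 ^ (CARD('n) div 2) * trace (\<rho> (BL B b)) * of_real (sin (2 * pi * \<mu> * (b \<bullet> w))) else 0)"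
    using contrib_formula(4)[OF BF1 b(1) w] \<mu> by blast
  have iff: "\<mu> *\<^sub>R w \<in> chars \<longleftrightarrow> (\<exists>j::nat. \<mu> = (real j + 1/2) / norm f)"
    unfolding w_def by (rule alternating_chars[OF f \<mu>])
  obtain c :: int where c: "odd c" "f \<bullet> (2 *\<^sub>R b) = of_int c * (norm f)\<^sup>2"
    using translation_component[OF BF1 b(1) f gen m] by blast
  have "sin (2 * pi * \<mu> * (b \<bullet> w)) \<noteq> 0" if j: "\<mu> = (real j + 1/2) / norm f" for j :: nat
  proof
    assume "sin (2 * pi * \<mu> * (b \<bullet> w)) = 0"
    then obtain i :: int where i: "2 * pi * \<mu> * (b \<bullet> w) = of_int i * pi" by (auto simp: sin_zero_iff_int2)
    have "2 * (b \<bullet> w) = of_int c * norm f"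
      using c(2) f0 by (simp add: w_def inner_commute power2_eq_square field_simps)
    then have "2 * pi * \<mu> * (b \<bullet> w) = pi * (\<mu> * (of_int c * norm f))" by (simp add: algebra_simps)
    also have "\<mu> * (of_int c * norm f) = (real j + 1/2) * of_int c" using f0 by (simp add: j)
    finally have "(real j + 1/2) * of_int c = of_int i" using i by simp
    then have "real_of_int ((2 * int j + 1) * c) = real_of_int (2 * i)" by (simp add: algebra_simps)
    then have "(2 * int j + 1) * c = 2 * i" by (simp only: of_int_eq_iff)
    then have "even ((2 * int j + 1) * c)" by simp
    then show False using c(1) by simp
  qed
  then show ?thesis unfolding \<kappa>(2) using iff \<kappa>(1) b(2) by auto
qed

section \<open>From contributions to multiplicities and harmonic spinors\<close>

lemma symmetric_iff:
  assumes "\<mu> > 0"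
  shows "dirac_mult L \<Gamma> \<epsilon> \<rho> (2 * pi * \<mu>) = dirac_mult L \<Gamma> \<epsilon> \<rho> (- (2 * pi * \<mu>)) \<longleftrightarrow> (\<Sum>B\<in>F1. contrib \<mu> B) = 0"
proof -
  let ?d = "\<lambda>t. dirac_mult L \<Gamma> \<epsilon> \<rho> t" and ?X = "\<Sum>B\<in>F1. contrib \<mu> B"
  have "(of_nat (?d (2 * pi * \<mu>)) - of_nat (?d (- (2 * pi * \<mu>))) :: complex) = 2 * ?X / 2 ^ k"
    using multiplicity(2)[OF assms, of 1] multiplicity(2)[OF assms, of "-1"]
    by (simp add: add_divide_distrib diff_divide_distrib)
  then have "?X = 0 \<longleftrightarrow> (of_nat (?d (2 * pi * \<mu>)) :: complex) = of_nat (?d (- (2 * pi * \<mu>)))" by auto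
  then show ?thesis by (simp only: of_nat_eq_iff)
qed

text \<open>The exponent \<open>m - k - 1\<close> can be negative, hence the integer power.\<close>

lemma multiplicity_symmetric:
  assumes "\<mu> > 0" "s \<in> {1, -1}" "(\<Sum>B\<in>F1. contrib \<mu> B) = 0"
  shows "real (dirac_mult L \<Gamma> \<epsilon> \<rho> (s * (2 * pi * \<mu>))) =
    2 powi (int (CARD('n) div 2) - int k - 1) * real CARD('v) * real (card (dual_shell \<Gamma> \<epsilon> \<mu>))"
proof -
  let ?d = "dirac_mult L \<Gamma> \<epsilon> \<rho> (s * (2 * pi * \<mu>))"
  have "complex_of_real (real ?d) = complex_of_real (2 ^ (CARD('n) div 2) / 2 * real CARD('v) * real (card (dual_shell \<Gamma> \<epsilon> \<mu>)) / 2 ^ k)"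
    using multiplicity(2)[OF assms(1,2)] by (simp add: assms(3))
  then have "real ?d = 2 ^ (CARD('n) div 2) / 2 * real CARD('v) * real (card (dual_shell \<Gamma> \<epsilon> \<mu>)) / 2 ^ k"
    by (simp only: of_real_eq_iff)
  then show ?thesis by (simp add: power_int_diff)
qed

lemma all_finite_mult: "finite_mult L \<Gamma> \<epsilon> \<rho> t"
proof (cases "t = 0")
  case True then show ?thesis using harmonic(1) by simp
next
  case False
  have "t = sgn t * (2 * pi * (\<bar>t\<bar> / (2 * pi)))" by (simp add: sgn_mult_abs)
  moreover have "sgn t \<in> {1, -1}" "\<bar>t\<bar> / (2 * pi) > 0" using False by (auto simp: sgn_if)
  ultimately show ?thesis using multiplicity(1) by metis
qed

text \<open>The shell of radius 0 is empty, so the Fourier expansion has no terms. This gives the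
  space itself rather than the value of \<open>field.dim\<close>, which is 0 on infinite-dimensional
  spaces too.\<close>

lemma no_harmonic:
  assumes "\<not> spin_trivial \<Gamma> \<epsilon>" shows "eigenspace L \<Gamma> \<epsilon> \<rho> 0 = {\<lambda>x. 0}"
proof -
  have S: "dual_shell \<Gamma> \<epsilon> 0 = {}" using assms by (auto simp: dual_shell_chars spin_trivial_iff)
  have "\<psi> = (\<lambda>x. 0)" if \<psi>: "\<psi> \<in> eigenspace L \<Gamma> \<epsilon> \<rho> 0" for \<psi>
  proof
    fix x
    have c: "\<psi> \<in> cfield 0" "quasi \<psi>" using \<psi> eigenspace_quasi[OF \<psi>] by (auto simp: eigenspace_iff)
    show "\<psi> x = 0" using fourier_expansion[OF c, of x] by (simp add: S)
  qed
  moreover have "(\<lambda>x. 0) \<in> eigenspace L \<Gamma> \<epsilon> \<rho> 0"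
    using field.subspace_0[OF eigenspace_subspace] by (simp add: zero_fun_def)
  ultimately show ?thesis by blast
qed

text \<open>With a one-dimensional twist the kernel dimension \<open>d\<close> satisfies
  \<open>d * 2 ^ k = 2 ^ m\<close>. For a larger twist the factor \<open>d_\<rho>\<close> could
  absorb powers of two, and no bound on \<open>k\<close> would follow.\<close>

lemma trivial_spin_bound:
  assumes "spin_trivial \<Gamma> \<epsilon>" "CARD('v) = 1" shows "k \<le> CARD('n) div 2"
proof -
  let ?m = "CARD('n) div 2" and ?d = "dirac_mult L \<Gamma> \<epsilon> \<rho> 0"
  have "(of_nat ?d :: complex) * 2 ^ k = 2 ^ ?m" using harmonic(2) assms by simp
  then have "(of_nat (?d * 2 ^ k) :: complex) = of_nat (2 ^ ?m)" by simp
  then have eq: "?d * 2 ^ k = 2 ^ ?m" by (simp only: of_nat_eq_iff)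
  then have "?d > 0" by (metis gr0I mult_0 power_not_zero zero_neq_numeral)
  then have "(2::nat) ^ k \<le> ?d * 2 ^ k" by simp
  then have "(2::nat) ^ k \<le> 2 ^ ?m" by (simp only: eq)
  then show ?thesis by simp
qed

text \<open>Comparison with \<open>harmonic\<close> gives \<open>2 ^ k = 1\<close>, so the holonomy
  is trivial and every element of \<Gamma> is a translation.\<close>

lemma max_harmonic_torus:
  assumes "dirac_mult L \<Gamma> \<epsilon> \<rho> 0 = 2 ^ (CARD('n) div 2) * CARD('v)"
  shows "\<Gamma> = transl ` \<Lambda> \<and> (\<forall>\<gamma>\<in>\<Gamma>. \<epsilon> \<gamma> = 1)"
proof -
  have h: "2 ^ (CARD('n) div 2) * of_nat CARD('v) =
     (if spin_trivial \<Gamma> \<epsilon> then 2 ^ (CARD('n) div 2) * of_nat CARD('v) / 2 ^ k else (0 :: complex))"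
    using harmonic(2) assms by simp
  have triv: "spin_trivial \<Gamma> \<epsilon>"
  proof (rule ccontr)
    assume "\<not> spin_trivial \<Gamma> \<epsilon>"
    with h show False by simp
  qed
  with h have "(2 ^ k :: complex) = 1" by (simp add: field_simps)
  then have "complex_of_nat (2 ^ k) = of_nat 1" by simp
  then have "(2::nat) ^ k = 1" by (simp only: of_nat_eq_iff)
  then have "card F = 1" by (simp add: F_facts(2))
  then have F: "F = {mat 1}" using one_F by (metis card_1_singletonE singletonD)
  have "\<gamma> \<in> transl ` \<Lambda>" if \<gamma>: "\<gamma> \<in> \<Gamma>" for \<gamma>
  proof -
    obtain B b where "\<gamma> = BL B b" "rot \<gamma> = B" by (rule \<Gamma>_cases[OF \<gamma>])
    moreover have "rot \<gamma> = mat 1" using F \<gamma> by blast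
    ultimately show ?thesis using \<gamma> by (auto simp: lattice_of_def)
  qed
  note mem = this
  then have "\<Gamma> = transl ` \<Lambda>" by (auto simp: lattice_of_def)
  moreover have "\<epsilon> \<gamma> = 1" if "\<gamma> \<in> \<Gamma>" for \<gamma>
    using mem[OF that] triv unfolding spin_trivial_def by blast
  ultimately show ?thesis by blast
qed

end

lemma trivial_twisting_rep: "twisting_rep \<Gamma> (\<lambda>_. mat 1 :: complex^'v^'v)"
proof -
  have "(\<chi> i j. cnj (mat 1 $ j $ i)) = (mat 1 :: complex^'v^'v)" by (auto simp: mat_def vec_eq_iff)
  then show ?thesis by (auto simp: twisting_rep_def hom_def isometry_group_def unitary_group_def)
qed


theorem theorem3p2:
  fixes \<Gamma> :: "'n::{finite,linorder} emap set"
    and \<epsilon> :: "'n emap \<Rightarrow> 'n clifford"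
    and \<rho> :: "'n emap \<Rightarrow> complex^'v^'v"
    and L :: "'n clifford \<Rightarrow> complex^'s^'s"
    and k m :: nat
  defines "m \<equiv> CARD('n) div 2"
    and "d \<equiv> dirac_mult L \<Gamma> \<epsilon> \<rho>"
    and "F1 \<equiv> {B \<in> rot ` \<Gamma>. fixdim B = 1}"
  assumes "bieberbach_group \<Gamma>"
    and "\<forall>B \<in> rot ` \<Gamma>. rotation_matrix B"
    and "holonomy_group \<Gamma> \<cong> product_group {..<k} (\<lambda>_. integer_mod_group 2)"
    and "spin_structure \<Gamma> \<epsilon>"
    and "twisting_rep \<Gamma> \<rho>"
    and "spinor_module L"
  shows
    "(\<forall>t. finite_mult L \<Gamma> \<epsilon> \<rho> t) \<and>
     (F1 = {} \<longrightarrow>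
        symmetric_spectrum L \<Gamma> \<epsilon> \<rho> \<and>
        (\<forall>\<mu>>0. \<forall>s\<in>{1, -1}.
           real (d (s * (2 * pi * \<mu>))) =
             2 powi (int m - int k - 1) * real CARD('v) * real (card (dual_shell \<Gamma> \<epsilon> \<mu>)))) \<and>
     (F1 \<noteq> {} \<longrightarrow>
        (\<not> symmetric_spectrum L \<Gamma> \<epsilon> \<rho> \<longleftrightarrow>
           (\<exists>r. CARD('n) = 4 * r + 3) \<and> (\<exists>B b. asymmetry_witness \<Gamma> \<epsilon> \<rho> B b)) \<and>
        (\<not> symmetric_spectrum L \<Gamma> \<epsilon> \<rho> \<longrightarrow>
           (\<exists>B b f. asymmetry_witness \<Gamma> \<epsilon> \<rho> B b \<and>
              {v \<in> lattice_of \<Gamma>. B *v v = v} = {real_of_int z *\<^sub>R f | z. True} \<and>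
              \<bar>f \<bullet> (2 *\<^sub>R b)\<bar> = (norm f)\<^sup>2) \<and>
           (\<forall>r B b f. CARD('n) = 4 * r + 3 \<and> asymmetry_witness \<Gamma> \<epsilon> \<rho> B b \<and>
              {v \<in> lattice_of \<Gamma>. B *v v = v} = {real_of_int z *\<^sub>R f | z. True} \<longrightarrow>
              asymmetric_part L \<Gamma> \<epsilon> \<rho> =
                {s * (2 * pi * ((real j + 1 / 2) / norm f)) | s j. s \<in> {1, -1}} \<and>
              ((\<exists>l::nat. \<bar>f \<bullet> (2 *\<^sub>R b)\<bar> = real (4 * l + 1) * (norm f)\<^sup>2) \<longrightarrow>
                 (\<forall>\<mu>>0. \<forall>s\<in>{1, -1::real}.
                    (\<forall>j. \<mu> = (real j + 1 / 2) / norm f \<longrightarrow>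
                       complex_of_nat (d (s * (2 * pi * \<mu>))) =
                         2 powi (int m - int k - 1) *
                           (of_nat CARD('v) * of_nat (card (dual_shell \<Gamma> \<epsilon> \<mu>)) +
                            of_real s * 2 *
                              of_real (spin_sigma (\<epsilon> (BL B b)) ((f \<bullet> (2 *\<^sub>R b)) *\<^sub>R f)) *
                              (-1) ^ (r + j) * trace (\<rho> (BL B b)))) \<and>
                    ((\<forall>j. \<mu> \<noteq> (real j + 1 / 2) / norm f) \<longrightarrow>
                       real (d (s * (2 * pi * \<mu>))) =
                         2 powi (int m - int k - 1) *
                           real CARD('v) * real (card (dual_shell \<Gamma> \<epsilon> \<mu>))))))) \<and>
        (symmetric_spectrum L \<Gamma> \<epsilon> \<rho> \<longrightarrow>
           (\<forall>\<mu>>0. \<forall>s\<in>{1, -1}.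
              real (d (s * (2 * pi * \<mu>))) =
                2 powi (int m - int k - 1) * real CARD('v) * real (card (dual_shell \<Gamma> \<epsilon> \<mu>))))) \<and>
     real (d 0) = (if spin_trivial \<Gamma> \<epsilon> then 2 powi (int m - int k) * real CARD('v) else 0) \<and>
     (k > m \<longrightarrow>
        (\<forall>\<epsilon>'. spin_structure \<Gamma> \<epsilon>' \<longrightarrow>
           \<not> spin_trivial \<Gamma> \<epsilon>' \<and> eigenspace L \<Gamma> \<epsilon>' \<rho> 0 = {\<lambda>x. 0})) \<and>
     (d 0 = 2 ^ m * CARD('v) \<longrightarrow>
        \<Gamma> = transl ` lattice_of \<Gamma> \<and> (\<forall>\<gamma>\<in>\<Gamma>. \<epsilon> \<gamma> = 1))"
proof -
  interpret S: flat_spin \<Gamma> k L \<epsilon> \<rho>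
    using assms by unfold_locales
  define X where "X \<mu> = (\<Sum>B\<in>S.F1. S.contrib \<mu> B)" for \<mu>
  have sym: "symmetric_spectrum L \<Gamma> \<epsilon> \<rho> \<longleftrightarrow> (\<forall>\<mu>>0. X \<mu> = 0)"
    unfolding symmetric_spectrum_def X_def using S.symmetric_iff by auto
  have formula: "\<forall>\<mu>>0. \<forall>s\<in>{1, -1}. real (d (s * (2 * pi * \<mu>))) =
      2 powi (int m - int k - 1) * real CARD('v) * real (card (dual_shell \<Gamma> \<epsilon> \<mu>))"
    if "\<forall>\<mu>>0. X \<mu> = 0"
    using S.multiplicity_symmetric that unfolding d_def m_def X_def by auto
  have mod4: "odd CARD('n) \<Longrightarrow> odd (CARD('n) div 2) \<Longrightarrow> \<exists>r. CARD('n) = 4 * r + 3"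
    by presburger
  have F1_empty: "\<forall>\<mu>>0. X \<mu> = 0" if "F1 = {}"
  proof -
    have "S.F1 = {}" using that by (auto simp: F1_def S.F1_def)
    then show ?thesis by (simp add: X_def)
  qed
  have wit_F1: "B \<in> S.F1 \<and> BL B b \<in> \<Gamma> \<and> trace (\<rho> (BL B b)) \<noteq> 0 \<and> S.alternating f \<and> B *v f = f \<and>
      (\<forall>\<mu>>0. X \<mu> = S.contrib \<mu> B) \<and> (\<forall>\<mu>>0. X \<mu> \<noteq> 0 \<longleftrightarrow> (\<exists>j::nat. \<mu> = (real j + 1/2) / norm f))"
    if "CARD('n) = 4 * r + 3" "asymmetry_witness \<Gamma> \<epsilon> \<rho> B b"
      "{v \<in> lattice_of \<Gamma>. B *v v = v} = {real_of_int z *\<^sub>R f | z. True}" for r B b f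
  proof -
    have n: "CARD('n) \<ge> 2" "odd (CARD('n) div 2)" using that(1) by presburger+
    note w = S.witness_alternating[OF that(2) n(1) that(3)]
    note g = S.generator_facts[OF that(3)]
    have "X \<mu> = S.contrib \<mu> B" if "\<mu> > 0" for \<mu>
      unfolding X_def by (rule S.contrib_sum[OF w(1) g(2) w(4) that])
    moreover have "S.contrib \<mu> B \<noteq> 0 \<longleftrightarrow> (\<exists>j::nat. \<mu> = (real j + 1/2) / norm f)" if "\<mu> > 0" for \<mu>
      by (rule S.contrib_asymmetric[OF w(1,2,3,4) \<open>{v \<in> lattice_of \<Gamma>. B *v v = v} = _\<close> n(2) that])
    ultimately show ?thesis using w g(2) by auto
  qed
  have asym_witness: "\<exists>B b f r. CARD('n) = 4 * r + 3 \<and> asymmetry_witness \<Gamma> \<epsilon> \<rho> B b \<and>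
      {v \<in> lattice_of \<Gamma>. B *v v = v} = {real_of_int z *\<^sub>R f | z. True} \<and> \<bar>f \<bullet> (2 *\<^sub>R b)\<bar> = (norm f)\<^sup>2"
    if asym: "\<not> symmetric_spectrum L \<Gamma> \<epsilon> \<rho>"
  proof -
    obtain \<mu> where \<mu>: "\<mu> > 0" "X \<mu> \<noteq> 0" using asym sym by blast
    then obtain B where B: "B \<in> S.F1" "S.contrib \<mu> B \<noteq> 0"
      unfolding X_def by (metis sum.neutral)
    obtain f where gen: "{v \<in> lattice_of \<Gamma>. B *v v = v} = {real_of_int z *\<^sub>R f | z. True}"
      using S.fixed_lattice_generator[OF B(1)] by blast
    note nz = S.contrib_nonzero[OF B(1) \<mu>(1) B(2) gen]
    note g = S.generator_facts[OF gen]
    note BF = S.F1D(1)[OF B(1)]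
    have b0: "BL B (S.shift B) \<in> \<Gamma>" using S.rep_BL[OF BF] S.rep(1)[OF BF] by simp
    obtain c :: int where c: "odd c" "f \<bullet> (2 *\<^sub>R S.shift B) = of_int c * (norm f)\<^sup>2"
      using S.translation_component[OF B(1) b0 nz(4) gen nz(2)] by blast
    obtain a where "c = 2 * a + 1" using c(1) by (elim oddE)
    \<comment> \<open>Adding \<open>z f\<close> to the translation part changes \<open>c\<close> by
      \<open>2 z\<close>; as \<open>c\<close> is odd, the value 1 can be reached.\<close>
    then obtain z where z: "1 - c = 2 * z" by (intro that[of "- a"]) simp
    define b where "b = S.shift B + of_int z *\<^sub>R f"
    have zf: "of_int z *\<^sub>R f \<in> lattice_of \<Gamma>" by (rule S.lattice.int_mem[OF g(1)])
    have "BL B b = BL B (S.shift B) \<circ> transl (of_int z *\<^sub>R f)"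
      by (simp add: b_def BL_def fun_eq_iff add_ac)
    then have b: "BL B b \<in> \<Gamma>" "trace (\<rho> (BL B b)) = trace (\<rho> (S.rep B))"
      using S.comp_mem[OF b0 S.latticeD[OF zf]] S.\<rho>_comp[OF b0 S.latticeD[OF zf]]
      by (simp_all add: S.\<rho>_transl[OF zf] S.rep_BL[OF BF])
    have "f \<bullet> (2 *\<^sub>R b) = of_int c * (norm f)\<^sup>2 + 2 * of_int z * (norm f)\<^sup>2"
      using c(2) by (simp add: b_def inner_add_right distrib_left power2_norm_eq_inner)
    also have "\<dots> = of_int (c + 2 * z) * (norm f)\<^sup>2" by (simp add: distrib_right)
    also have "c + 2 * z = 1" using z by simp
    finally have "\<bar>f \<bullet> (2 *\<^sub>R b)\<bar> = (norm f)\<^sup>2" by simp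
    moreover have "asymmetry_witness \<Gamma> \<epsilon> \<rho> B b"
      by (rule S.alternating_witness[OF B(1) b(1) _ nz(4) g(2)]) (use b(2) nz(3) in simp)
    ultimately show ?thesis using mod4[OF nz(1,2)] gen by blast
  qed
  have witness_asym: "\<not> symmetric_spectrum L \<Gamma> \<epsilon> \<rho>"
    if r: "CARD('n) = 4 * r + 3" and w: "asymmetry_witness \<Gamma> \<epsilon> \<rho> B b" for r B b
  proof -
    have "fixdim B = 1" "BL B b \<in> \<Gamma>" using w by (auto simp: asymmetry_witness_def)
    moreover obtain C c where C: "BL B b = BL C c" "orthogonal_matrix C" "rot (BL B b) = C"
      by (rule S.\<Gamma>_cases[OF \<open>BL B b \<in> \<Gamma>\<close>])
    moreover have "C = B" by (rule BL_inject(1)[OF C(2) C(1)[symmetric]])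
    moreover have "B \<noteq> mat 1" using \<open>fixdim B = 1\<close> r by (auto simp: fixdim_mat_1)
    ultimately have "B \<in> S.F1" unfolding S.F1_def by (metis (mono_tags, lifting) imageI mem_Collect_eq)
    then obtain f where gen: "{v \<in> lattice_of \<Gamma>. B *v v = v} = {real_of_int z *\<^sub>R f | z. True}"
      using S.fixed_lattice_generator by blast
    note h = wit_F1[OF r w gen]
    have "f \<noteq> 0" using h by (auto simp: S.alternating_def)
    \<comment> \<open>The lowest frequency, \<open>j = 0\<close>, already shows asymmetry.\<close>
    then have "(real 0 + 1/2) / norm f > 0" by simp
    then show ?thesis using h sym by blast
  qed
  have part: "asymmetric_part L \<Gamma> \<epsilon> \<rho> = {s * (2 * pi * ((real j + 1 / 2) / norm f)) | s j. s \<in> {1, -1}}"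
    if "CARD('n) = 4 * r + 3" "asymmetry_witness \<Gamma> \<epsilon> \<rho> B b"
      "{v \<in> lattice_of \<Gamma>. B *v v = v} = {real_of_int z *\<^sub>R f | z. True}" for r B b f
  proof -
    note h = wit_F1[OF that]
    have "f \<noteq> 0" using h by (auto simp: S.alternating_def)
    then have pos: "(real j + 1/2) / norm f > 0" for j by (simp add: add_nonneg_pos)
    have iff: "\<mu> > 0 \<and> dirac_mult L \<Gamma> \<epsilon> \<rho> (2 * pi * \<mu>) \<noteq> dirac_mult L \<Gamma> \<epsilon> \<rho> (- (2 * pi * \<mu>)) \<longleftrightarrow>
        (\<exists>j::nat. \<mu> = (real j + 1/2) / norm f)" for \<mu>
      using S.symmetric_iff[of \<mu>] h pos unfolding X_def by blast
    show ?thesis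
    proof (intro subset_antisym subsetI)
      fix x assume "x \<in> asymmetric_part L \<Gamma> \<epsilon> \<rho>"
      then obtain s \<mu> where x: "x = s * (2 * pi * \<mu>)" "s \<in> {1, -1}" and "\<mu> > 0"
        "dirac_mult L \<Gamma> \<epsilon> \<rho> (2 * pi * \<mu>) \<noteq> dirac_mult L \<Gamma> \<epsilon> \<rho> (- (2 * pi * \<mu>))"
        unfolding asymmetric_part_def by blast
      then obtain j :: nat where "\<mu> = (real j + 1/2) / norm f" using iff[of \<mu>] by blast
      then show "x \<in> {s * (2 * pi * ((real j + 1 / 2) / norm f)) | s j. s \<in> {1, -1}}" using x by blast
    next
      fix x assume "x \<in> {s * (2 * pi * ((real j + 1 / 2) / norm f)) | s j. s \<in> {1, -1}}"
      then obtain s j where x: "x = s * (2 * pi * ((real j + 1 / 2) / norm f))" "s \<in> {1, -1}" by blast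
      show "x \<in> asymmetric_part L \<Gamma> \<epsilon> \<rho>"
        unfolding asymmetric_part_def
        by (rule CollectI, rule exI[of _ s], rule exI[of _ "(real j + 1 / 2) / norm f"])
          (use x iff[of "(real j + 1 / 2) / norm f"] in blast)
    qed
  qed
  have val: "complex_of_nat (d (s * (2 * pi * \<mu>))) =
      2 powi (int m - int k - 1) *
        (of_nat CARD('v) * of_nat (card (dual_shell \<Gamma> \<epsilon> \<mu>)) +
         of_real s * 2 * of_real (spin_sigma (\<epsilon> (BL B b)) ((f \<bullet> (2 *\<^sub>R b)) *\<^sub>R f)) *
         (-1) ^ (r + j) * trace (\<rho> (BL B b)))"
    if n: "CARD('n) = 4 * r + 3" and w: "asymmetry_witness \<Gamma> \<epsilon> \<rho> B b"
      and gen: "{v \<in> lattice_of \<Gamma>. B *v v = v} = {real_of_int z *\<^sub>R f | z. True}"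
      and l: "\<bar>f \<bullet> (2 *\<^sub>R b)\<bar> = real (4 * l + 1) * (norm f)\<^sup>2"
      and \<mu>: "\<mu> > 0" "\<mu> = (real j + 1 / 2) / norm f" and s: "s \<in> {1, -1::real}"
    for r B b f l \<mu> s j
  proof -
    note h = wit_F1[OF n w gen]
    have f0: "f \<noteq> 0" using h by (auto simp: S.alternating_def)
    have "odd (CARD('n) div 2)" using n by presburger
    then obtain c :: int where c: "f \<bullet> (2 *\<^sub>R b) = of_int c * (norm f)\<^sup>2"
      using S.translation_component[of B b f] h gen by blast
    then have "of_int \<bar>c\<bar> * (norm f)\<^sup>2 = real (4 * l + 1) * (norm f)\<^sup>2" using l by (simp add: abs_mult)
    then have "real_of_int \<bar>c\<bar> = real_of_int (4 * int l + 1)" using f0 by simp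
    then have cl: "\<bar>c\<bar> = 4 * int l + 1" by (simp only: of_int_eq_iff)
    have Xv: "X \<mu> = of_real (spin_sigma (\<epsilon> (BL B b)) ((f \<bullet> (2 *\<^sub>R b)) *\<^sub>R f)) *
        (-1) ^ (r + j) * 2 ^ m * trace (\<rho> (BL B b))"
      using S.contrib_value[of B b f r c l j] h n c cl \<mu> unfolding m_def by simp
    have pw: "2 powi (int m - int k - 1) = (2 ^ m / 2 / 2 ^ k :: complex)"
      by (simp add: power_int_diff)
    show ?thesis
      unfolding pw using Xv S.multiplicity(2)[OF \<mu>(1) s] unfolding d_def X_def[symmetric] m_def[symmetric]
      by (simp add: field_simps)
  qed
  have off: "real (d (s * (2 * pi * \<mu>))) =
      2 powi (int m - int k - 1) * real CARD('v) * real (card (dual_shell \<Gamma> \<epsilon> \<mu>))"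
    if "CARD('n) = 4 * r + 3" "asymmetry_witness \<Gamma> \<epsilon> \<rho> B b"
      "{v \<in> lattice_of \<Gamma>. B *v v = v} = {real_of_int z *\<^sub>R f | z. True}"
      and \<mu>: "\<mu> > 0" "\<forall>j. \<mu> \<noteq> (real j + 1 / 2) / norm f" and s: "s \<in> {1, -1::real}"
    for r B b f \<mu> s
  proof -
    have "X \<mu> = 0" using wit_F1[OF that(1-3)] \<mu> by blast
    then show ?thesis using S.multiplicity_symmetric[OF \<mu>(1) s] unfolding d_def m_def X_def by blast
  qed
  have zero: "real (d 0) = (if spin_trivial \<Gamma> \<epsilon> then 2 powi (int m - int k) * real CARD('v) else 0)"
  proof -
    have "complex_of_real (real (d 0)) =
        complex_of_real (if spin_trivial \<Gamma> \<epsilon> then 2 ^ m * real CARD('v) / 2 ^ k else 0)"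
      unfolding d_def m_def using S.harmonic(2) by simp
    then have "real (d 0) = (if spin_trivial \<Gamma> \<epsilon> then 2 ^ m * real CARD('v) / 2 ^ k else 0)"
      by (simp only: of_real_eq_iff)
    then show ?thesis by (simp add: power_int_diff)
  qed
  have bound: "\<not> spin_trivial \<Gamma> \<epsilon>' \<and> eigenspace L \<Gamma> \<epsilon>' \<rho> 0 = {\<lambda>x. 0}"
    if km: "k > m" and spin': "spin_structure \<Gamma> \<epsilon>'" for \<epsilon>'
  proof -
    \<comment> \<open>Triviality of the spin structure does not involve the twist, so the bound on
      \<open>k\<close> is taken with the trivial one-dimensional representation; the kernel itself
      is treated with \<rho>.\<close>
    interpret T: flat_spin \<Gamma> k L \<epsilon>' "\<lambda>_. mat 1 :: complex^1^1"
      by unfold_locales (use spin' trivial_twisting_rep in auto)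
    interpret U: flat_spin \<Gamma> k L \<epsilon>' \<rho>
      by unfold_locales (use spin' assms in auto)
    have "\<not> spin_trivial \<Gamma> \<epsilon>'" using T.trivial_spin_bound km by (auto simp: m_def)
    then show ?thesis using U.no_harmonic by blast
  qed
  show ?thesis
  proof (intro conjI impI allI ballI; (elim conjE exE)?)
    show "finite_mult L \<Gamma> \<epsilon> \<rho> t" for t by (rule S.all_finite_mult)
    show "symmetric_spectrum L \<Gamma> \<epsilon> \<rho>" if "F1 = {}" using F1_empty[OF that] sym by blast
    show "real (d (s * (2 * pi * \<mu>))) =
        2 powi (int m - int k - 1) * real CARD('v) * real (card (dual_shell \<Gamma> \<epsilon> \<mu>))"
      if "F1 = {}" "0 < \<mu>" "s \<in> {1, -1}" for \<mu> s
      using formula[OF F1_empty[OF that(1)]] that(2,3) by blast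
    show "(\<not> symmetric_spectrum L \<Gamma> \<epsilon> \<rho>) = ((\<exists>r. CARD('n) = 4 * r + 3) \<and> (\<exists>B b. asymmetry_witness \<Gamma> \<epsilon> \<rho> B b))"
      using asym_witness witness_asym by blast
    show "\<exists>B b f. asymmetry_witness \<Gamma> \<epsilon> \<rho> B b \<and>
        {v \<in> lattice_of \<Gamma>. B *v v = v} = {real_of_int z *\<^sub>R f | z. True} \<and> \<bar>f \<bullet> (2 *\<^sub>R b)\<bar> = (norm f)\<^sup>2"
      if "\<not> symmetric_spectrum L \<Gamma> \<epsilon> \<rho>"
      using asym_witness[OF that] by blast
    show "real (d (s * (2 * pi * \<mu>))) =
        2 powi (int m - int k - 1) * real CARD('v) * real (card (dual_shell \<Gamma> \<epsilon> \<mu>))"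
      if "symmetric_spectrum L \<Gamma> \<epsilon> \<rho>" "0 < \<mu>" "s \<in> {1, -1}" for \<mu> s
      using formula sym that by blast
    show "real (d 0) = (if spin_trivial \<Gamma> \<epsilon> then 2 powi (int m - int k) * real CARD('v) else 0)" by (rule zero)
    show "\<not> spin_trivial \<Gamma> \<epsilon>'" "eigenspace L \<Gamma> \<epsilon>' \<rho> 0 = {\<lambda>x. 0}"
      if "k > m" "spin_structure \<Gamma> \<epsilon>'" for \<epsilon>'
      using bound[OF that] by blast+
    show "\<Gamma> = transl ` lattice_of \<Gamma>" if "d 0 = 2 ^ m * CARD('v)"
      using S.max_harmonic_torus that unfolding d_def m_def by blast
    show "\<epsilon> \<gamma> = 1" if "d 0 = 2 ^ m * CARD('v)" "\<gamma> \<in> \<Gamma>" for \<gamma>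
      using S.max_harmonic_torus that unfolding d_def m_def by blast
  qed (rule part val off; assumption)+
qed

end
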